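(* Let $p \in [1, \infty) \setminus \{ 2 \}$, and let $A = \varinjlim_m (A_m, \varphi_{n, m})$ be a spatial $L^p$ AF algebra, expressed as the direct limit of a spatial $L^p$ AF direct system, with canonical maps $\varphi_n \colon A_n \to A$ for $n \in \mathbb{Z}_{>0}$. Then $A$ is a separable nondegenerately representable $L^p$ operator algebra. Moreover, $e = ( \varphi_n (1_{A_n} ))_{n \in \mathbb{Z}_{>0}}$ is a nondecreasing approximate identity of idempotents such that the corresponding homomorphism $\theta_e\colon C_{\mathrm{c}}(\mathbb{Z}_{>0})\to A$ is contractive.
   Context: All algebras are over $\mathbb{C}$; homomorphisms need not be unital. $L(E)$ is the Banach algebra of bounded operators on a Banach space $E$. An $L^p$ operator algebra is a Banach algebra isometrically isomorphic to a norm closed subalgebra of $L(L^p(X,\mu))$ for some measure space. It is nondegenerately representable if there is an isometric homomorphism $\pi\colon A\to L(L^p(Y,\nu))$, for some measure space, such that the linear span of $\{\pi(a)\xi: a\in A,\ \xi\in L^p(Y,\nu)\}$ is dense in $L^p(Y,\nu)$. $M_d^p=L(l_d^p)$ is the algebra of $d\times d$ complex matrices with the operator norm on $l_d^p=l^p(\{1,\dots,d\})$; finite direct sums have the norm $\max_k\|a_k\|$. In a unital Banach algebra with $\|1\|=1$, an idempotent $e$ is hermitian if $\|\exp(i\lambda e)\|=1$ for all $\lambda\in\mathbb{R}$. A spatial semisimple finite dimensional $L^p$ operator algebra is a Banach algebra isometrically isomorphic to $\bigoplus_{k=1}^N M_{d_k}^p$ for some $N,d_1,\dots,d_N\in\mathbb{Z}_{>0}$.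 A homomorphism $\varphi\colon\bigoplus_{k=1}^N M_{d_k}^p\to B$ between two such algebras is spatial if for every $k$ its restriction to $M_{d_k}^p$ is contractive and sends the identity of $M_{d_k}^p$ to a hermitian idempotent of $B$ (zero allowed). A spatial $L^p$ AF direct system consists of spatial semisimple finite dimensional $L^p$ operator algebras $A_m$ ($m\in\mathbb{Z}_{\ge0}$) and contractive spatial homomorphisms $\varphi_{n,m}\colon A_m\to A_n$ ($m\le n$) with $\varphi_{m,m}=\mathrm{id}$, $\varphi_{n,m}\circ\varphi_{m,k}=\varphi_{n,k}$. Its direct limit is the completion of the algebraic direct limit modulo elements of seminorm zero, for the seminorm that sends the class of $a\in A_m$ to $\lim_n\|\varphi_{n,m}(a)\|$. A sequence $(e_n)_{n\in\mathbb{Z}_{>0}}$ of idempotents is nondecreasing if $e_ne_{n+1}=e_{n+1}e_n=e_n$ for all $n$, and is an approximate identity if $e_na\to a$ and $ae_n\to a$ for all $a\in A$. With $e_0=0$, $\theta_e\colon C_{\mathrm{c}}(\mathbb{Z}_{>0})\to A$ is the homomorphism with $\theta_e(\chi_{\{n\}})=e_n-e_{n-1}$ for all $n\in\mathbb{Z}_{>0}$, where the algebra $C_{\mathrm{c}}(\mathbb{Z}_{>0})$ of finitely supported functions has the norm $\|\cdot\|_\infty$. *)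

theory Defs
  imports "HOL-Analysis.Analysis" "HOL-Algebra.Module" "HOL-Algebra.Algebraic_Closure_Type"
begin

section \<open>Complex normed spaces and Banach algebras with explicit carriers\<close>

text \<open>
  Algebras need not be unital: outside of \<open>unital_banach_algebra\<close> the field \<open>one\<close> of the
  record (and, for mere normed spaces, also the field \<open>mult\<close>) carries no information.
\<close>

record 'a normed_module = "(complex, 'a) module" +
  nrm :: "'a \<Rightarrow> real"

abbreviation complex_ring :: "complex ring" where
  "complex_ring \<equiv> ring_of_type_algebra"

text \<open>The guard makes \<open>ndist\<close> symmetric and nonnegative off the carrier, as \<open>Metric_space\<close> requires.\<close>

definition ndist :: "('a, 'm) normed_module_scheme \<Rightarrow> 'a \<Rightarrow> 'a \<Rightarrow> real" where
  "ndist V x y = (if x \<in> carrier V \<and> y \<in> carrier V then nrm V (x \<ominus>\<^bsub>V\<^esub> y) else 0)"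

abbreviation ntopology :: "('a, 'm) normed_module_scheme \<Rightarrow> 'a topology" where
  "ntopology V \<equiv> Metric_space.mtopology (carrier V) (ndist V)"

locale complex_normed_space =
  Module.module complex_ring V for V :: "('a, 'm) normed_module_scheme" (structure) +
  assumes nrm_eq_0_iff: "x \<in> carrier V \<Longrightarrow> nrm V x = 0 \<longleftrightarrow> x = \<zero>"
    and nrm_triangle: "\<lbrakk>x \<in> carrier V; y \<in> carrier V\<rbrakk> \<Longrightarrow> nrm V (x \<oplus> y) \<le> nrm V x + nrm V y"
    and nrm_smult: "x \<in> carrier V \<Longrightarrow> nrm V (c \<odot> x) = cmod c * nrm V x"

locale complex_banach_space = complex_normed_space +
  assumes complete: "Metric_space.mcomplete (carrier V) (ndist V)"

locale banach_algebra = complex_banach_space A for A :: "('a, 'm) normed_module_scheme" (structure) +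
  assumes mult_closed: "\<lbrakk>x \<in> carrier A; y \<in> carrier A\<rbrakk> \<Longrightarrow> x \<otimes> y \<in> carrier A"
    and mult_assoc: "\<lbrakk>x \<in> carrier A; y \<in> carrier A; z \<in> carrier A\<rbrakk> \<Longrightarrow>
      (x \<otimes> y) \<otimes> z = x \<otimes> (y \<otimes> z)"
    and mult_distr_left: "\<lbrakk>x \<in> carrier A; y \<in> carrier A; z \<in> carrier A\<rbrakk> \<Longrightarrow>
      (x \<oplus> y) \<otimes> z = (x \<otimes> z) \<oplus> (y \<otimes> z)"
    and mult_distr_right: "\<lbrakk>x \<in> carrier A; y \<in> carrier A; z \<in> carrier A\<rbrakk> \<Longrightarrow>
      z \<otimes> (x \<oplus> y) = (z \<otimes> x) \<oplus> (z \<otimes> y)"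
    and smult_mult_left: "\<lbrakk>x \<in> carrier A; y \<in> carrier A\<rbrakk> \<Longrightarrow> (c \<odot> x) \<otimes> y = c \<odot> (x \<otimes> y)"
    and smult_mult_right: "\<lbrakk>x \<in> carrier A; y \<in> carrier A\<rbrakk> \<Longrightarrow> x \<otimes> (c \<odot> y) = c \<odot> (x \<otimes> y)"
    and nrm_mult: "\<lbrakk>x \<in> carrier A; y \<in> carrier A\<rbrakk> \<Longrightarrow> nrm A (x \<otimes> y) \<le> nrm A x * nrm A y"

locale unital_banach_algebra = banach_algebra +
  assumes one_closed: "\<one> \<in> carrier A"
    and one_left: "x \<in> carrier A \<Longrightarrow> \<one> \<otimes> x = x"
    and one_right: "x \<in> carrier A \<Longrightarrow> x \<otimes> \<one> = x"

lemma (in complex_normed_space) Metric_space_ndist: "Metric_space (carrier V) (ndist V)"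
proof -
  have m1: "\<ominus> x = (-1) \<odot> x" if "x \<in> carrier V" for x
  proof -
    have 1: "\<ominus>\<^bsub>complex_ring\<^esub> \<one>\<^bsub>complex_ring\<^esub> = -1"
      by (rule abelian_group.minus_equality)
         (auto simp: ring_of_type_algebra_def R.is_abelian_group[unfolded ring_of_type_algebra_def])
    show ?thesis
      using smult_l_minus[of "\<one>\<^bsub>complex_ring\<^esub>" x] smult_one[OF that] that 1 by simp
  qed
  have nm: "nrm V (\<ominus> x) = nrm V x" if "x \<in> carrier V" for x
    using that by (simp add: m1 nrm_smult)
  have n0: "nrm V \<zero> = 0"
    by (simp add: nrm_eq_0_iff)
  have pos: "0 \<le> nrm V x" if "x \<in> carrier V" for x
    using nrm_triangle[of x "\<ominus> x"] that by (simp add: nm n0 M.r_neg)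
  show ?thesis
  proof
    show "0 \<le> ndist V x y" for x y
      by (simp add: ndist_def pos)
    show "ndist V x y = ndist V y x" for x y
    proof (cases "x \<in> carrier V \<and> y \<in> carrier V")
      case True
      then have "\<ominus> (x \<ominus> y) = y \<ominus> x"
        by (simp add: M.minus_eq M.minus_add M.a_comm)
      then show ?thesis using True nm[of "x \<ominus> y"] by (simp add: ndist_def)
    qed (auto simp: ndist_def)
    show "ndist V x y = 0 \<longleftrightarrow> x = y" if "x \<in> carrier V" "y \<in> carrier V" for x y
    proof -
      have "x = (x \<ominus> y) \<oplus> y"
        using that by (simp add: M.minus_eq M.a_assoc M.l_neg)
      then have "x \<ominus> y = \<zero> \<longleftrightarrow> x = y"
        using that by (metis M.l_zero M.minus_eq M.r_neg)
      then show ?thesis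
        using that by (simp add: ndist_def nrm_eq_0_iff)
    qed
    show "ndist V x z \<le> ndist V x y + ndist V y z"
      if "x \<in> carrier V" "y \<in> carrier V" "z \<in> carrier V" for x y z
    proof -
      have "x \<ominus> z = (x \<ominus> y) \<oplus> (y \<ominus> z)"
        using that by (simp add: M.minus_eq M.a_assoc M.r_neg1)
      then show ?thesis
        using nrm_triangle[of "x \<ominus> y" "y \<ominus> z"] that by (simp add: ndist_def)
    qed
  qed
qed


section \<open>Homomorphisms\<close>

definition linear_maps ::
  "('a, 'm) normed_module_scheme \<Rightarrow> ('b, 'n) normed_module_scheme \<Rightarrow> ('a \<Rightarrow> 'b) set" where
  "linear_maps V W = {f \<in> carrier V \<rightarrow> carrier W.
     (\<forall>x\<in>carrier V. \<forall>y\<in>carrier V. f (x \<oplus>\<^bsub>V\<^esub> y) = f x \<oplus>\<^bsub>W\<^esub> f y) \<and>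
     (\<forall>c. \<forall>x\<in>carrier V. f (c \<odot>\<^bsub>V\<^esub> x) = c \<odot>\<^bsub>W\<^esub> f x)}"

definition alg_hom ::
  "('a, 'm) normed_module_scheme \<Rightarrow> ('b, 'n) normed_module_scheme \<Rightarrow> ('a \<Rightarrow> 'b) set" where
  "alg_hom A B = linear_maps A B \<inter> hom A B"

definition contractive ::
  "('a, 'm) normed_module_scheme \<Rightarrow> ('b, 'n) normed_module_scheme \<Rightarrow> ('a \<Rightarrow> 'b) \<Rightarrow> bool" where
  "contractive V W f \<longleftrightarrow> (\<forall>x\<in>carrier V. nrm W (f x) \<le> nrm V x)"

definition isometric ::
  "('a, 'm) normed_module_scheme \<Rightarrow> ('b, 'n) normed_module_scheme \<Rightarrow> ('a \<Rightarrow> 'b) \<Rightarrow> bool" where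
  "isometric V W f \<longleftrightarrow> (\<forall>x\<in>carrier V. nrm W (f x) = nrm V x)"

definition isometric_iso ::
  "('a, 'm) normed_module_scheme \<Rightarrow> ('b, 'n) normed_module_scheme \<Rightarrow> ('a \<Rightarrow> 'b) set" where
  "isometric_iso A B = {f \<in> alg_hom A B. isometric A B f \<and> bij_betw f (carrier A) (carrier B)}"


section \<open>Bounded operators and \<open>L\<^sup>p\<close> spaces\<close>

definition bounded_operators :: "('a, 'm) normed_module_scheme \<Rightarrow> ('a \<Rightarrow> 'a) normed_module" where
  "bounded_operators E =
    \<lparr>carrier = {T \<in> linear_maps E E \<inter> extensional (carrier E).
        \<exists>C. \<forall>x\<in>carrier E. nrm E (T x) \<le> C * nrm E x},
     mult = compose (carrier E),
     one = (\<lambda>x\<in>carrier E. x),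
     zero = (\<lambda>x\<in>carrier E. \<zero>\<^bsub>E\<^esub>),
     add = (\<lambda>S T. \<lambda>x\<in>carrier E. S x \<oplus>\<^bsub>E\<^esub> T x),
     smult = (\<lambda>c T. \<lambda>x\<in>carrier E. c \<odot>\<^bsub>E\<^esub> T x),
     nrm = (\<lambda>T. SUP x\<in>{x \<in> carrier E. nrm E x \<le> 1}. nrm E (T x))\<rparr>"

definition Lp_functions :: "real \<Rightarrow> 'x measure \<Rightarrow> ('x \<Rightarrow> complex) set" where
  "Lp_functions p M = {f \<in> borel_measurable M. integrable M (\<lambda>x. cmod (f x) powr p)}"

definition ae_eq_rel :: "real \<Rightarrow> 'x measure \<Rightarrow> (('x \<Rightarrow> complex) \<times> ('x \<Rightarrow> complex)) set" where
  "ae_eq_rel p M =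
     {(f, g). f \<in> Lp_functions p M \<and> g \<in> Lp_functions p M \<and> (AE x in M. f x = g x)}"

definition Lp_space :: "real \<Rightarrow> 'x measure \<Rightarrow> ('x \<Rightarrow> complex) set normed_module" where
  "Lp_space p M =
    \<lparr>carrier = Lp_functions p M // ae_eq_rel p M,
     mult = undefined,
     one = undefined,
     zero = ae_eq_rel p M `` {\<lambda>x. 0},
     add = (\<lambda>F G. \<Union>f\<in>F. \<Union>g\<in>G. ae_eq_rel p M `` {\<lambda>x. f x + g x}),
     smult = (\<lambda>c F. \<Union>f\<in>F. ae_eq_rel p M `` {\<lambda>x. c * f x}),
     nrm = (\<lambda>F. (LINT x|M. cmod ((SOME f. f \<in> F) x) powr p) powr (1 / p))\<rparr>"

text \<open>
  The type \<open>'x\<close> of the points of the measure space cannot be quantified existentially inside a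
  formula, so it is a parameter.  For separable algebras \<open>'x = real\<close> loses no generality:
  representations may be cut down to a separable \<open>L\<^sup>p\<close> space, and every such space is isometric
  to \<open>L\<^sup>p\<close> of some measure on the reals.
\<close>

definition Lp_operator_algebra ::
  "'x itself \<Rightarrow> real \<Rightarrow> ('a, 'm) normed_module_scheme \<Rightarrow> bool" where
  "Lp_operator_algebra PT p A \<longleftrightarrow> banach_algebra A \<and>
     (\<exists>(M :: 'x measure) B \<pi>.
        submodule B complex_ring (bounded_operators (Lp_space p M)) \<and>
        (\<forall>S\<in>B. \<forall>T\<in>B. S \<otimes>\<^bsub>bounded_operators (Lp_space p M)\<^esub> T \<in> B) \<and>
        closedin (ntopology (bounded_operators (Lp_space p M))) B \<and>
        \<pi> \<in> isometric_iso A ((bounded_operators (Lp_space p M))\<lparr>carrier := B\<rparr>))"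

definition linear_span :: "('a, 'm) normed_module_scheme \<Rightarrow> 'a set \<Rightarrow> 'a set" where
  "linear_span V S = (\<lambda>H. submodule H complex_ring V) hull S"

definition nondegenerately_representable ::
  "'x itself \<Rightarrow> real \<Rightarrow> ('a, 'm) normed_module_scheme \<Rightarrow> bool" where
  "nondegenerately_representable PT p A \<longleftrightarrow>
     (\<exists>(M :: 'x measure) \<pi>.
        \<pi> \<in> alg_hom A (bounded_operators (Lp_space p M)) \<and>
        isometric A (bounded_operators (Lp_space p M)) \<pi> \<and>
        ntopology (Lp_space p M) closure_of
          linear_span (Lp_space p M) {\<pi> a \<xi> | a \<xi>. a \<in> carrier A \<and> \<xi> \<in> carrier (Lp_space p M)}
        = carrier (Lp_space p M))"


section \<open>Spatial semisimple finite dimensional algebras and spatial homomorphisms\<close>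

text \<open>
  \<open>L(l\<^sup>p({1,\<dots>,d}))\<close>: over \<open>count_space {1..d}\<close>, functions are identified when they agree on \<open>{1..d}\<close>.
\<close>

definition matrix_algebra ::
  "real \<Rightarrow> nat \<Rightarrow> ((nat \<Rightarrow> complex) set \<Rightarrow> (nat \<Rightarrow> complex) set) normed_module" where
  "matrix_algebra p d = bounded_operators (Lp_space p (count_space {1..d}))"

definition direct_sum ::
  "'i set \<Rightarrow> ('i \<Rightarrow> ('a, 'm) normed_module_scheme) \<Rightarrow> ('i \<Rightarrow> 'a) normed_module" where
  "direct_sum I A =
    \<lparr>carrier = (\<Pi>\<^sub>E k\<in>I. carrier (A k)),
     mult = (\<lambda>a b. \<lambda>k\<in>I. a k \<otimes>\<^bsub>A k\<^esub> b k),
     one = (\<lambda>k\<in>I. \<one>\<^bsub>A k\<^esub>),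
     zero = (\<lambda>k\<in>I. \<zero>\<^bsub>A k\<^esub>),
     add = (\<lambda>a b. \<lambda>k\<in>I. a k \<oplus>\<^bsub>A k\<^esub> b k),
     smult = (\<lambda>c a. \<lambda>k\<in>I. c \<odot>\<^bsub>A k\<^esub> a k),
     nrm = (\<lambda>a. Max ((\<lambda>k. nrm (A k) (a k)) ` I))\<rparr>"

definition summand_embedding ::
  "'i set \<Rightarrow> ('i \<Rightarrow> ('a, 'm) normed_module_scheme) \<Rightarrow> 'i \<Rightarrow> 'a \<Rightarrow> ('i \<Rightarrow> 'a)" where
  "summand_embedding I A k a = (\<lambda>j\<in>I. if j = k then a else \<zero>\<^bsub>A j\<^esub>)"

abbreviation matrix_sum ::
  "real \<Rightarrow> nat \<Rightarrow> (nat \<Rightarrow> nat) \<Rightarrow> (nat \<Rightarrow> (nat \<Rightarrow> complex) set \<Rightarrow> (nat \<Rightarrow> complex) set) normed_module" where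
  "matrix_sum p N d \<equiv> direct_sum {1..N} (\<lambda>k. matrix_algebra p (d k))"

definition matrix_decomposition ::
  "real \<Rightarrow> ('a, 'm) normed_module_scheme \<Rightarrow> nat \<Rightarrow> (nat \<Rightarrow> nat) \<Rightarrow>
    ((nat \<Rightarrow> (nat \<Rightarrow> complex) set \<Rightarrow> (nat \<Rightarrow> complex) set) \<Rightarrow> 'a) \<Rightarrow> bool" where
  "matrix_decomposition p A N d \<psi> \<longleftrightarrow>
     0 < N \<and> (\<forall>k\<in>{1..N}. 0 < d k) \<and> \<psi> \<in> isometric_iso (matrix_sum p N d) A"

text \<open>
  Unitality of \<open>A\<close> is automatic from the isomorphism; requiring it only says that the record
  field \<open>\<one>\<^bsub>A\<^esub>\<close> holds the identity.
\<close>

definition spatial_fd_algebra :: "real \<Rightarrow> ('a, 'm) normed_module_scheme \<Rightarrow> bool" where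
  "spatial_fd_algebra p A \<longleftrightarrow>
     unital_banach_algebra A \<and> (\<exists>N d \<psi>. matrix_decomposition p A N d \<psi>)"

definition alg_exp :: "('a, 'm) normed_module_scheme \<Rightarrow> 'a \<Rightarrow> 'a" where
  "alg_exp B x = (THE y. limitin (ntopology B)
     (\<lambda>n. \<Oplus>\<^bsub>B\<^esub>k\<in>{..<n}. (1 / fact k) \<odot>\<^bsub>B\<^esub> (x [^]\<^bsub>B\<^esub> k)) y sequentially)"

definition hermitian_idempotent :: "('a, 'm) normed_module_scheme \<Rightarrow> 'a \<Rightarrow> bool" where
  "hermitian_idempotent B e \<longleftrightarrow> e \<in> carrier B \<and> e \<otimes>\<^bsub>B\<^esub> e = e \<and>
     (\<forall>l::real. nrm B (alg_exp B ((\<i> * complex_of_real l) \<odot>\<^bsub>B\<^esub> e)) = 1)"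

text \<open>
  The decomposition of \<open>A\<close> into matrix algebras is only determined up to isometric automorphisms
  of the sum; these permute the summands (the minimal two-sided ideals), so the choice of \<open>\<psi>\<close> is
  immaterial.
\<close>

definition spatial_hom ::
  "real \<Rightarrow> ('a, 'm) normed_module_scheme \<Rightarrow> ('b, 'n) normed_module_scheme \<Rightarrow> ('a \<Rightarrow> 'b) \<Rightarrow> bool" where
  "spatial_hom p A B \<phi> \<longleftrightarrow> \<phi> \<in> alg_hom A B \<and>
     (\<exists>N d \<psi>. matrix_decomposition p A N d \<psi> \<and>
        (\<forall>k\<in>{1..N}.
           let \<iota> = summand_embedding {1..N} (\<lambda>k. matrix_algebra p (d k)) k in
           contractive (matrix_algebra p (d k)) B (\<lambda>a. \<phi> (\<psi> (\<iota> a))) \<and>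
           hermitian_idempotent B (\<phi> (\<psi> (\<iota> \<one>\<^bsub>matrix_algebra p (d k)\<^esub>)))))"


section \<open>Direct systems and direct limits\<close>

text \<open>\<open>\<phi> n m\<close> is the map from stage \<open>m\<close> to stage \<open>n\<close>; only its values for \<open>m \<le> n\<close> matter.\<close>

definition spatial_AF_system ::
  "real \<Rightarrow> (nat \<Rightarrow> ('a, 'm) normed_module_scheme) \<Rightarrow> (nat \<Rightarrow> nat \<Rightarrow> 'a \<Rightarrow> 'a) \<Rightarrow> bool" where
  "spatial_AF_system p A \<phi> \<longleftrightarrow>
     (\<forall>m. spatial_fd_algebra p (A m)) \<and>
     (\<forall>m n. m \<le> n \<longrightarrow> spatial_hom p (A m) (A n) (\<phi> n m) \<and> contractive (A m) (A n) (\<phi> n m)) \<and>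
     (\<forall>m. \<forall>a\<in>carrier (A m). \<phi> m m a = a) \<and>
     (\<forall>k m n. k \<le> m \<longrightarrow> m \<le> n \<longrightarrow> (\<forall>a\<in>carrier (A k). \<phi> n m (\<phi> m k a) = \<phi> n k a))"

definition limit_rel ::
  "(nat \<Rightarrow> ('a, 'm) normed_module_scheme) \<Rightarrow> (nat \<Rightarrow> nat \<Rightarrow> 'a \<Rightarrow> 'a) \<Rightarrow>
    ((nat \<times> 'a) \<times> (nat \<times> 'a)) set" where
  "limit_rel A \<phi> = {((m, a), (n, b)).
     a \<in> carrier (A m) \<and> b \<in> carrier (A n) \<and> (\<exists>k\<ge>max m n. \<phi> k m a = \<phi> k n b)}"

definition limit_class ::
  "(nat \<Rightarrow> ('a, 'm) normed_module_scheme) \<Rightarrow> (nat \<Rightarrow> nat \<Rightarrow> 'a \<Rightarrow> 'a) \<Rightarrow> nat \<Rightarrow> 'a \<Rightarrow> (nat \<times> 'a) set" where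
  "limit_class A \<phi> m a = limit_rel A \<phi> `` {(m, a)}"

text \<open>Here \<open>nrm\<close> is only a seminorm.\<close>

definition algebraic_direct_limit ::
  "(nat \<Rightarrow> ('a, 'm) normed_module_scheme) \<Rightarrow> (nat \<Rightarrow> nat \<Rightarrow> 'a \<Rightarrow> 'a) \<Rightarrow>
    (nat \<times> 'a) set normed_module" where
  "algebraic_direct_limit A \<phi> =
    \<lparr>carrier = (SIGMA m : UNIV. carrier (A m)) // limit_rel A \<phi>,
     mult = (\<lambda>F G. \<Union>(m, a)\<in>F. \<Union>(n, b)\<in>G. let k = max m n in
       limit_class A \<phi> k (\<phi> k m a \<otimes>\<^bsub>A k\<^esub> \<phi> k n b)),
     one = undefined,
     zero = limit_class A \<phi> 0 \<zero>\<^bsub>A 0\<^esub>,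
     add = (\<lambda>F G. \<Union>(m, a)\<in>F. \<Union>(n, b)\<in>G. let k = max m n in
       limit_class A \<phi> k (\<phi> k m a \<oplus>\<^bsub>A k\<^esub> \<phi> k n b)),
     smult = (\<lambda>c F. \<Union>(m, a)\<in>F. limit_class A \<phi> m (c \<odot>\<^bsub>A m\<^esub> a)),
     nrm = (\<lambda>F. let (m, a) = (SOME z. z \<in> F) in lim (\<lambda>n. nrm (A n) (\<phi> n m a)))\<rparr>"

text \<open>
  \<open>A\<close>, together with \<open>\<iota>\<close>, is the completion of the seminormed algebra \<open>S\<close> modulo the elements of
  seminorm zero: since \<open>\<iota>\<close> preserves the seminorm, its kernel is exactly the set of these elements,
  so it induces an isometric embedding, with dense range, of the quotient normed algebra.
\<close>

definition hausdorff_completion ::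
  "('x, 'm) normed_module_scheme \<Rightarrow> ('a, 'n) normed_module_scheme \<Rightarrow> ('x \<Rightarrow> 'a) \<Rightarrow> bool" where
  "hausdorff_completion S A \<iota> \<longleftrightarrow>
     banach_algebra A \<and> \<iota> \<in> alg_hom S A \<and> isometric S A \<iota> \<and>
     ntopology A closure_of (\<iota> ` carrier S) = carrier A"

definition is_direct_limit ::
  "(nat \<Rightarrow> ('a, 'm) normed_module_scheme) \<Rightarrow> (nat \<Rightarrow> nat \<Rightarrow> 'a \<Rightarrow> 'a) \<Rightarrow>
    ('b, 'n) normed_module_scheme \<Rightarrow> (nat \<Rightarrow> 'a \<Rightarrow> 'b) \<Rightarrow> bool" where
  "is_direct_limit A \<phi> L \<phi>\<^sub>L \<longleftrightarrow>
     (\<exists>\<iota>. hausdorff_completion (algebraic_direct_limit A \<phi>) L \<iota> \<and>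
        (\<forall>n. \<forall>a\<in>carrier (A n). \<phi>\<^sub>L n a = \<iota> (limit_class A \<phi> n a)))"


section \<open>Sequences of idempotents\<close>

text \<open>Only the terms \<open>e n\<close> with \<open>n > 0\<close> belong to the sequence.\<close>

definition nondecreasing_idempotents ::
  "('a, 'm) normed_module_scheme \<Rightarrow> (nat \<Rightarrow> 'a) \<Rightarrow> bool" where
  "nondecreasing_idempotents A e \<longleftrightarrow>
     (\<forall>n>0. e n \<in> carrier A \<and> e n \<otimes>\<^bsub>A\<^esub> e n = e n \<and>
        e n \<otimes>\<^bsub>A\<^esub> e (n + 1) = e n \<and> e (n + 1) \<otimes>\<^bsub>A\<^esub> e n = e n)"

definition approximate_identity ::
  "('a, 'm) normed_module_scheme \<Rightarrow> (nat \<Rightarrow> 'a) \<Rightarrow> bool" where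
  "approximate_identity A e \<longleftrightarrow> (\<forall>a\<in>carrier A.
     limitin (ntopology A) (\<lambda>n. e n \<otimes>\<^bsub>A\<^esub> a) a sequentially \<and>
     limitin (ntopology A) (\<lambda>n. a \<otimes>\<^bsub>A\<^esub> e n) a sequentially)"

text \<open>The algebra \<open>C\<^sub>c(S)\<close> for a set \<open>S\<close> of natural numbers, as functions on \<open>nat\<close> vanishing off \<open>S\<close>.\<close>

definition Cc_algebra :: "nat set \<Rightarrow> (nat \<Rightarrow> complex) normed_module" where
  "Cc_algebra S =
    \<lparr>carrier = {f. finite {n. f n \<noteq> 0} \<and> {n. f n \<noteq> 0} \<subseteq> S},
     mult = (\<lambda>f g n. f n * g n),
     one = undefined,
     zero = (\<lambda>n. 0),
     add = (\<lambda>f g n. f n + g n),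
     smult = (\<lambda>c f n. c * f n),
     nrm = (\<lambda>f. SUP n. cmod (f n))\<rparr>"

text \<open>The update \<open>e(0 := \<zero>)\<close> is the convention that the term of index \<open>0\<close> is zero.\<close>

definition corresponding_hom ::
  "('a, 'm) normed_module_scheme \<Rightarrow> (nat \<Rightarrow> 'a) \<Rightarrow> ((nat \<Rightarrow> complex) \<Rightarrow> 'a) \<Rightarrow> bool" where
  "corresponding_hom A e \<theta> \<longleftrightarrow> \<theta> \<in> alg_hom (Cc_algebra {0<..}) A \<and>
     (\<forall>n>0. \<theta> (indicator {n}) = (e(0 := \<zero>\<^bsub>A\<^esub>)) n \<ominus>\<^bsub>A\<^esub> (e(0 := \<zero>\<^bsub>A\<^esub>)) (n - 1))"

end

theory Submission
  imports Defs
begin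

text \<open>
  A spatial semisimple finite dimensional algebra is the algebra of all block diagonal matrices over a
  finite index set, with the operator norm on \<open>l\<^sup>p\<close> of that set
  (\<open>spatial_fd_algebra_coordinates\<close>).  For \<open>p \<noteq> 2\<close> the geometry of \<open>l\<^sup>p\<close> forces hermitian
  idempotents to be diagonal (\<open>rotations_contractive_imp_diagonal\<close>), and from this one obtains
  the shape of a spatial homomorphism \<open>\<phi>\<close>: it maps diagonal matrix units to coordinate projections,
  and each row of \<open>\<phi> e\<^sub>r\<^sub>i\<close> at a coordinate in the range of \<open>\<phi> e\<^sub>r\<^sub>r\<close> has exactly one
  nonzero entry, of modulus one (\<open>row_monomial\<close>).  In other words, the space on which a block acts can be
  placed isometrically onto coordinates of the next stage, up to phases, in such a way that \<open>\<phi> b\<close>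
  acts there as \<open>b\<close> (\<open>coordinate_embedding\<close>).

  In a direct system only the coordinates that survive at all later stages matter: the limit norm of
  an element is its operator norm on \<open>l\<^sup>p\<close> of the surviving coordinates, because everything else is
  annihilated by some connecting map.  A surviving block always has a surviving coordinate below it at
  the next stage, so the surviving coordinates of one stage embed equivariantly into those of the next.
  The union \<open>C\<close> of this increasing sequence of finite sets, realised as a set of real numbers, carries
  an action of all stages on \<open>l\<^sup>p(C)\<close>.  It is isometric for the limit norm (\<open>nrm_opr\<close>), hence extends
  to the completion (\<open>isometric_graph_extends\<close>), and it is nondegenerate because the identity of stage
  \<open>k\<close> fixes the families supported on the coordinates of stage \<open>k\<close>, which together are dense.  The range
  of an isometric homomorphism of a Banach algebra is complete, so that it is closed.

  Separability follows by approximating matrix entries with rational numbers.  The images of the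
  identities form an approximate identity since they eventually act trivially on each stage.
  Seen from a later stage they are an increasing sequence of coordinate projections, so an element
  \<open>\<theta> f\<close> is the image of a diagonal matrix with entries among \<open>0\<close> and the values of \<open>f\<close>
  (\<open>gap_sum_diagonal\<close>); this gives contractivity.
\<close>

section \<open>Normed spaces with explicit carriers\<close>

lemma complex_ring_simps [simp]:
  "carrier complex_ring = UNIV" "mult complex_ring = (*)" "add complex_ring = (+)"
  "\<zero>\<^bsub>complex_ring\<^esub> = 0" "\<one>\<^bsub>complex_ring\<^esub> = 1"
  by (simp_all add: ring_of_type_algebra_def)

lemma cring_complex_ring: "cring complex_ring"
  by (intro cringI abelian_groupI comm_monoidI) (auto intro: exI[of _ "- x" for x] simp: algebra_simps add_eq_0_iff)

lemma uminus_complex_ring: "\<ominus>\<^bsub>complex_ring\<^esub> c = - c"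
proof -
  interpret R: cring complex_ring by (rule cring_complex_ring)
  show ?thesis by (rule R.minus_equality) auto
qed

context complex_normed_space
begin

lemma csmult_closed [simp, intro]: "x \<in> carrier V \<Longrightarrow> c \<odot> x \<in> carrier V"
  by simp

lemma csmult_add_left: "x \<in> carrier V \<Longrightarrow> (a + b) \<odot> x = a \<odot> x \<oplus> b \<odot> x"
  using smult_l_distr[of a b x] by simp

lemma csmult_add_right: "x \<in> carrier V \<Longrightarrow> y \<in> carrier V \<Longrightarrow> a \<odot> (x \<oplus> y) = a \<odot> x \<oplus> a \<odot> y"
  using smult_r_distr[of a x y] by simp

lemma csmult_assoc: "x \<in> carrier V \<Longrightarrow> a \<odot> (b \<odot> x) = (a * b) \<odot> x"
  using smult_assoc1[of a b x] by simp

lemma csmult_one [simp]: "x \<in> carrier V \<Longrightarrow> 1 \<odot> x = x"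
  using smult_one[of x] by simp

lemma csmult_zero_left [simp]: "x \<in> carrier V \<Longrightarrow> 0 \<odot> x = \<zero>"
  using smult_l_null[of x] by simp

lemma csmult_zero_right [simp]: "c \<odot> \<zero> = \<zero>"
  using smult_r_null[of c] by simp

lemma uminus_csmult: "x \<in> carrier V \<Longrightarrow> \<ominus> x = (-1) \<odot> x"
  using smult_l_minus[of 1 x] by (simp add: uminus_complex_ring)

lemma minus_csmult: "x \<in> carrier V \<Longrightarrow> y \<in> carrier V \<Longrightarrow> x \<ominus> y = x \<oplus> (-1) \<odot> y"
  by (simp add: M.minus_eq uminus_csmult)

lemma nrm_zero [simp]: "nrm V \<zero> = 0"
  by (simp add: nrm_eq_0_iff)

lemma nrm_uminus [simp]: "x \<in> carrier V \<Longrightarrow> nrm V (\<ominus> x) = nrm V x"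
  by (simp add: uminus_csmult nrm_smult)

lemma nrm_nonneg [simp]: "x \<in> carrier V \<Longrightarrow> 0 \<le> nrm V x"
  using nrm_triangle[of x "\<ominus> x"] by (simp add: M.r_neg)

lemma minus_self [simp]: "x \<in> carrier V \<Longrightarrow> x \<ominus> x = \<zero>"
  by (simp add: M.minus_eq M.r_neg)

lemma minus_zero [simp]: "x \<in> carrier V \<Longrightarrow> x \<ominus> \<zero> = x"
  by (simp add: M.minus_eq)

lemma minus_eq_zero_iff: "x \<in> carrier V \<Longrightarrow> y \<in> carrier V \<Longrightarrow> x \<ominus> y = \<zero> \<longleftrightarrow> x = y"
  by (metis M.add.inv_closed M.add.inv_inv M.add.inv_equality M.minus_eq M.r_neg)

lemma nrm_minus_commute: "x \<in> carrier V \<Longrightarrow> y \<in> carrier V \<Longrightarrow> nrm V (x \<ominus> y) = nrm V (y \<ominus> x)"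
proof -
  assume xy: "x \<in> carrier V" "y \<in> carrier V"
  interpret MS: Metric_space "carrier V" "ndist V" by (rule Metric_space_ndist)
  show ?thesis using MS.commute[of x y] xy by (simp add: ndist_def)
qed

lemma nrm_minus_triangle:
  assumes "x \<in> carrier V" "y \<in> carrier V" "z \<in> carrier V"
  shows "nrm V (x \<ominus> z) \<le> nrm V (x \<ominus> y) + nrm V (y \<ominus> z)"
proof -
  interpret MS: Metric_space "carrier V" "ndist V" by (rule Metric_space_ndist)
  show ?thesis using MS.triangle[of x y z] assms by (simp add: ndist_def)
qed

lemma nrm_le_add_minus:
  assumes "x \<in> carrier V" "y \<in> carrier V"
  shows "nrm V x \<le> nrm V y + nrm V (x \<ominus> y)"
  using nrm_minus_triangle[of x y \<zero>] assms by simp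

lemma add_minus_add:
  assumes "x \<in> carrier V" "y \<in> carrier V" "x' \<in> carrier V" "y' \<in> carrier V"
  shows "(x \<oplus> y) \<ominus> (x' \<oplus> y') = (x \<ominus> x') \<oplus> (y \<ominus> y')"
  using assms by (simp add: M.minus_eq M.minus_add M.a_ac)

lemma csmult_minus: "x \<in> carrier V \<Longrightarrow> y \<in> carrier V \<Longrightarrow> c \<odot> (x \<ominus> y) = c \<odot> x \<ominus> c \<odot> y"
  by (simp add: minus_csmult csmult_add_right csmult_assoc)

lemma csmult_diff_left: "x \<in> carrier V \<Longrightarrow> a \<odot> x \<ominus> b \<odot> x = (a - b) \<odot> x"
  using csmult_add_left[of x a "-b"] by (simp add: minus_csmult csmult_assoc)

lemma topspace_ntopology [simp]: "topspace (ntopology V) = carrier V"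
  using Metric_space.topspace_mtopology[OF Metric_space_ndist] .

lemma limitin_ntopology_iff:
  "limitin (ntopology V) s x sequentially \<longleftrightarrow>
    x \<in> carrier V \<and> (\<forall>\<epsilon>>0. \<exists>N. \<forall>n\<ge>N. s n \<in> carrier V \<and> nrm V (s n \<ominus> x) < \<epsilon>)"
  unfolding Metric_space.limitin_metric[OF Metric_space_ndist] eventually_sequentially
  by (metis ndist_def)

lemma in_closure_ntopology_iff:
  assumes "S \<subseteq> carrier V"
  shows "x \<in> ntopology V closure_of S \<longleftrightarrow> x \<in> carrier V \<and> (\<forall>\<epsilon>>0. \<exists>y\<in>S. nrm V (x \<ominus> y) < \<epsilon>)"
  unfolding Metric_space.metric_closure_of[OF Metric_space_ndist]
    Metric_space.in_mball[OF Metric_space_ndist]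
  using assms by (auto simp: ndist_def subset_iff)

lemma dense_iff:
  assumes "S \<subseteq> carrier V"
  shows "ntopology V closure_of S = carrier V \<longleftrightarrow>
    (\<forall>x\<in>carrier V. \<forall>\<epsilon>>0. \<exists>y\<in>S. nrm V (x \<ominus> y) < \<epsilon>)"
  using in_closure_ntopology_iff[OF assms] by blast

text \<open>Algebraic identities pass from a dense subset to the whole space by comparing both sides up to
  multiples of an arbitrarily small error.\<close>

lemma eq_if_nrm_minus_small:
  assumes "x \<in> carrier V" "y \<in> carrier V" "\<And>\<epsilon>. 0 < \<epsilon> \<Longrightarrow> \<epsilon> < 1 \<Longrightarrow> nrm V (x \<ominus> y) \<le> K * \<epsilon>"
  shows "x = y"
proof -
  have "nrm V (x \<ominus> y) \<le> 0"
  proof (rule field_le_epsilon)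
    fix e :: real assume e: "0 < e"
    define d where "d = min (1/2) (e / (\<bar>K\<bar> + 1))"
    have d: "0 < d" "d < 1" "d \<le> e / (\<bar>K\<bar> + 1)" using e by (auto simp: d_def)
    have "nrm V (x \<ominus> y) \<le> K * d" using assms(3)[OF d(1,2)] .
    also have "\<dots> \<le> (\<bar>K\<bar> + 1) * d" using d(1) by (intro mult_right_mono) auto
    also have "\<dots> \<le> e" using d(3) by (simp add: pos_le_divide_eq mult.commute)
    finally show "nrm V (x \<ominus> y) \<le> 0 + e" by simp
  qed
  then have "nrm V (x \<ominus> y) = 0" using nrm_nonneg[OF M.minus_closed[OF assms(1,2)]] by (rule antisym)
  then show ?thesis using assms(1,2) nrm_eq_0_iff[of "x \<ominus> y"] by (simp add: minus_eq_zero_iff)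
qed

lemma mcomplete_ndist_iff:
  "Metric_space.mcomplete (carrier V) (ndist V) \<longleftrightarrow>
    (\<forall>s :: nat \<Rightarrow> 'a. (\<forall>n. s n \<in> carrier V) \<longrightarrow> (\<forall>\<epsilon>>0. \<exists>N. \<forall>m\<ge>N. \<forall>n\<ge>N. nrm V (s m \<ominus> s n) < \<epsilon>) \<longrightarrow>
      (\<exists>x\<in>carrier V. \<forall>\<epsilon>>0. \<exists>N. \<forall>n\<ge>N. nrm V (s n \<ominus> x) < \<epsilon>))"
proof -
  interpret MS: Metric_space "carrier V" "ndist V" by (rule Metric_space_ndist)
  have *: "MS.MCauchy s \<longleftrightarrow> (\<forall>n. s n \<in> carrier V) \<and> (\<forall>\<epsilon>>0. \<exists>N. \<forall>m\<ge>N. \<forall>n\<ge>N. nrm V (s m \<ominus> s n) < \<epsilon>)"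
    for s
    unfolding MS.MCauchy_def by (auto simp: ndist_def image_subset_iff)
  have l: "(\<exists>x. limitin (ntopology V) s x sequentially) \<longleftrightarrow>
      (\<exists>x\<in>carrier V. \<forall>\<epsilon>>0. \<exists>N. \<forall>n\<ge>N. nrm V (s n \<ominus> x) < \<epsilon>)" if "\<forall>n. s n \<in> carrier V" for s
    using that unfolding limitin_ntopology_iff by auto
  have **: "(MS.MCauchy s \<longrightarrow> (\<exists>x. limitin (ntopology V) s x sequentially)) \<longleftrightarrow>
      ((\<forall>n. s n \<in> carrier V) \<longrightarrow> (\<forall>\<epsilon>>0. \<exists>N. \<forall>m\<ge>N. \<forall>n\<ge>N. nrm V (s m \<ominus> s n) < \<epsilon>) \<longrightarrow>
      (\<exists>x\<in>carrier V. \<forall>\<epsilon>>0. \<exists>N. \<forall>n\<ge>N. nrm V (s n \<ominus> x) < \<epsilon>))" for s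
  proof (cases "\<forall>n. s n \<in> carrier V")
    case True
    show ?thesis unfolding * l[OF True] using True by (simp only: simp_thms)
  next
    case False
    then show ?thesis unfolding * by (simp only: simp_thms)
  qed
  show ?thesis
    unfolding MS.mcomplete_def by (simp only: **)
qed

end

lemma complex_normed_spaceI:
  fixes V (structure)
  assumes zero: "\<zero> \<in> carrier V"
    and add: "\<And>x y. x \<in> carrier V \<Longrightarrow> y \<in> carrier V \<Longrightarrow> x \<oplus> y \<in> carrier V"
    and assoc: "\<And>x y z. x \<in> carrier V \<Longrightarrow> y \<in> carrier V \<Longrightarrow> z \<in> carrier V \<Longrightarrow>
      (x \<oplus> y) \<oplus> z = x \<oplus> (y \<oplus> z)"
    and comm: "\<And>x y. x \<in> carrier V \<Longrightarrow> y \<in> carrier V \<Longrightarrow> x \<oplus> y = y \<oplus> x"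
    and l_zero: "\<And>x. x \<in> carrier V \<Longrightarrow> \<zero> \<oplus> x = x"
    and smult: "\<And>c x. x \<in> carrier V \<Longrightarrow> c \<odot> x \<in> carrier V"
    and neg: "\<And>x. x \<in> carrier V \<Longrightarrow> (-1) \<odot> x \<oplus> x = \<zero>"
    and distl: "\<And>a b x. x \<in> carrier V \<Longrightarrow> (a + b) \<odot> x = a \<odot> x \<oplus> b \<odot> x"
    and distr: "\<And>a x y. x \<in> carrier V \<Longrightarrow> y \<in> carrier V \<Longrightarrow> a \<odot> (x \<oplus> y) = a \<odot> x \<oplus> a \<odot> y"
    and sassoc: "\<And>a b x. x \<in> carrier V \<Longrightarrow> (a * b) \<odot> x = a \<odot> (b \<odot> x)"
    and one: "\<And>x. x \<in> carrier V \<Longrightarrow> 1 \<odot> x = x"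
    and n0: "\<And>x. x \<in> carrier V \<Longrightarrow> nrm V x = 0 \<longleftrightarrow> x = \<zero>"
    and tri: "\<And>x y. x \<in> carrier V \<Longrightarrow> y \<in> carrier V \<Longrightarrow> nrm V (x \<oplus> y) \<le> nrm V x + nrm V y"
    and hom: "\<And>c x. x \<in> carrier V \<Longrightarrow> nrm V (c \<odot> x) = cmod c * nrm V x"
  shows "complex_normed_space V"
proof -
  have "abelian_group V"
  proof (rule abelian_groupI)
    show "\<exists>y\<in>carrier V. y \<oplus> x = \<zero>" if "x \<in> carrier V" for x
      using neg[OF that] smult[OF that] by blast
  qed (use zero add assoc comm l_zero in auto)
  then have "Module.module complex_ring V"
    by (intro moduleI cring_complex_ring) (use assms in auto)
  then show ?thesis
    by (intro complex_normed_space.intro complex_normed_space_axioms.intro) (use assms in auto)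
qed

section \<open>The Banach algebra of bounded operators\<close>

lemma linear_mapsD:
  assumes "f \<in> linear_maps V W"
  shows "x \<in> carrier V \<Longrightarrow> f x \<in> carrier W"
    and "x \<in> carrier V \<Longrightarrow> y \<in> carrier V \<Longrightarrow> f (x \<oplus>\<^bsub>V\<^esub> y) = f x \<oplus>\<^bsub>W\<^esub> f y"
    and "x \<in> carrier V \<Longrightarrow> f (c \<odot>\<^bsub>V\<^esub> x) = c \<odot>\<^bsub>W\<^esub> f x"
  using assms by (auto simp: linear_maps_def)

lemma linear_maps_minus:
  assumes "f \<in> linear_maps V W" "complex_normed_space V" "complex_normed_space W"
    "x \<in> carrier V" "y \<in> carrier V"
  shows "f (x \<ominus>\<^bsub>V\<^esub> y) = f x \<ominus>\<^bsub>W\<^esub> f y"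
proof -
  interpret V: complex_normed_space V by fact
  interpret W: complex_normed_space W by fact
  show ?thesis using assms linear_mapsD[OF assms(1)]
    by (simp add: V.minus_csmult W.minus_csmult)
qed

lemma alg_homD:
  assumes "f \<in> alg_hom A B"
  shows "f \<in> linear_maps A B"
    and "x \<in> carrier A \<Longrightarrow> f x \<in> carrier B"
    and "x \<in> carrier A \<Longrightarrow> y \<in> carrier A \<Longrightarrow> f (x \<oplus>\<^bsub>A\<^esub> y) = f x \<oplus>\<^bsub>B\<^esub> f y"
    and "x \<in> carrier A \<Longrightarrow> f (c \<odot>\<^bsub>A\<^esub> x) = c \<odot>\<^bsub>B\<^esub> f x"
    and "x \<in> carrier A \<Longrightarrow> y \<in> carrier A \<Longrightarrow> f (x \<otimes>\<^bsub>A\<^esub> y) = f x \<otimes>\<^bsub>B\<^esub> f y"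
  using assms by (auto simp: alg_hom_def linear_maps_def hom_def)

lemma alg_homI:
  assumes "\<And>x. x \<in> carrier A \<Longrightarrow> f x \<in> carrier B"
    and "\<And>x y. x \<in> carrier A \<Longrightarrow> y \<in> carrier A \<Longrightarrow> f (x \<oplus>\<^bsub>A\<^esub> y) = f x \<oplus>\<^bsub>B\<^esub> f y"
    and "\<And>c x. x \<in> carrier A \<Longrightarrow> f (c \<odot>\<^bsub>A\<^esub> x) = c \<odot>\<^bsub>B\<^esub> f x"
    and "\<And>x y. x \<in> carrier A \<Longrightarrow> y \<in> carrier A \<Longrightarrow> f (x \<otimes>\<^bsub>A\<^esub> y) = f x \<otimes>\<^bsub>B\<^esub> f y"
  shows "f \<in> alg_hom A B"
  using assms by (auto simp: alg_hom_def linear_maps_def hom_def)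

lemma bounded_operators_simps:
  "S \<otimes>\<^bsub>bounded_operators E\<^esub> T = compose (carrier E) S T"
  "\<one>\<^bsub>bounded_operators E\<^esub> = (\<lambda>x\<in>carrier E. x)"
  "\<zero>\<^bsub>bounded_operators E\<^esub> = (\<lambda>x\<in>carrier E. \<zero>\<^bsub>E\<^esub>)"
  "S \<oplus>\<^bsub>bounded_operators E\<^esub> T = (\<lambda>x\<in>carrier E. S x \<oplus>\<^bsub>E\<^esub> T x)"
  "c \<odot>\<^bsub>bounded_operators E\<^esub> T = (\<lambda>x\<in>carrier E. c \<odot>\<^bsub>E\<^esub> T x)"
  "nrm (bounded_operators E) T = (SUP x\<in>{x \<in> carrier E. nrm E x \<le> 1}. nrm E (T x))"
  by (simp_all add: bounded_operators_def)

lemma bounded_operatorsD: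
  assumes "T \<in> carrier (bounded_operators E)"
  shows "T \<in> linear_maps E E" "T \<in> extensional (carrier E)"
    "\<exists>C. \<forall>x\<in>carrier E. nrm E (T x) \<le> C * nrm E x"
  using assms by (auto simp: bounded_operators_def)

lemmas bounded_operators_app = linear_mapsD[OF bounded_operatorsD(1)]

lemma bounded_operatorsI:
  assumes "T \<in> extensional (carrier E)"
    "\<And>x. x \<in> carrier E \<Longrightarrow> T x \<in> carrier E"
    "\<And>x y. x \<in> carrier E \<Longrightarrow> y \<in> carrier E \<Longrightarrow> T (x \<oplus>\<^bsub>E\<^esub> y) = T x \<oplus>\<^bsub>E\<^esub> T y"
    "\<And>c x. x \<in> carrier E \<Longrightarrow> T (c \<odot>\<^bsub>E\<^esub> x) = c \<odot>\<^bsub>E\<^esub> T x"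
    "\<And>x. x \<in> carrier E \<Longrightarrow> nrm E (T x) \<le> C * nrm E x"
  shows "T \<in> carrier (bounded_operators E)"
  proof -
  have "\<exists>C. \<forall>x\<in>carrier E. nrm E (T x) \<le> C * nrm E x" using assms(5) by blast
  then show ?thesis using assms(1-4) by (simp add: bounded_operators_def linear_maps_def)
qed

lemma bounded_operators_eqI:
  assumes "S \<in> carrier (bounded_operators E)" "T \<in> carrier (bounded_operators E)"
    "\<And>x. x \<in> carrier E \<Longrightarrow> S x = T x"
  shows "S = T"
  using assms bounded_operatorsD(2) by (metis extensionalityI)

context complex_normed_space
begin

abbreviation "BO \<equiv> bounded_operators V"

lemma opnorm_bdd:
  assumes "T \<in> carrier BO"
  shows "bdd_above ((\<lambda>x. nrm V (T x)) ` {x \<in> carrier V. nrm V x \<le> 1})"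
proof -
  obtain C where C: "\<forall>x\<in>carrier V. nrm V (T x) \<le> C * nrm V x"
    using bounded_operatorsD(3)[OF assms] by blast
  have "nrm V (T x) \<le> \<bar>C\<bar>" if "x \<in> carrier V" "nrm V x \<le> 1" for x
  proof -
    have "nrm V (T x) \<le> C * nrm V x" using C that by blast
    also have "\<dots> \<le> \<bar>C\<bar> * nrm V x" using that by (intro mult_right_mono) auto
    also have "\<dots> \<le> \<bar>C\<bar> * 1" using that by (intro mult_left_mono) auto
    finally show ?thesis by simp
  qed
  then show ?thesis by (intro bdd_aboveI2[where M="\<bar>C\<bar>"]) auto
qed

lemma opnorm_bound:
  assumes T: "T \<in> carrier BO" and x: "x \<in> carrier V"
  shows "nrm V (T x) \<le> nrm BO T * nrm V x"
proof (cases "x = \<zero>")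
  case True
  have "T \<zero> = T (0 \<odot> \<zero>)" by simp
  also have "\<dots> = \<zero>" using bounded_operators_app[OF T] by (subst bounded_operators_app(3)[OF T]) auto
  finally show ?thesis using True by simp
next
  case False
  then have pos: "nrm V x > 0" using x nrm_eq_0_iff[OF x] nrm_nonneg[OF x] by linarith
  define y where "y = complex_of_real (1 / nrm V x) \<odot> x"
  have y: "y \<in> carrier V" "nrm V y = 1"
    using x pos by (auto simp: y_def nrm_smult norm_divide)
  have "nrm V (T y) \<le> nrm BO T"
    unfolding bounded_operators_simps
    by (rule cSUP_upper) (use y opnorm_bdd[OF T] in auto)
  moreover have "nrm V (T y) = nrm V (T x) / nrm V x"
    using x pos bounded_operators_app[OF T] by (simp add: y_def nrm_smult norm_divide)
  ultimately show ?thesis using pos by (simp add: pos_divide_le_eq)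
qed

lemma opnorm_le:
  assumes T: "T \<in> carrier BO" and C: "0 \<le> C" "\<And>x. x \<in> carrier V \<Longrightarrow> nrm V (T x) \<le> C * nrm V x"
  shows "nrm BO T \<le> C"
  unfolding bounded_operators_simps
proof (rule cSUP_least)
  show "{x \<in> carrier V. nrm V x \<le> 1} \<noteq> {}"
    using M.zero_closed by (auto intro!: exI[of _ "\<zero>"])
  fix x assume "x \<in> {x \<in> carrier V. nrm V x \<le> 1}"
  then have x: "x \<in> carrier V" "nrm V x \<le> 1" by auto
  have "nrm V (T x) \<le> C * nrm V x" using C(2)[OF x(1)] .
  also have "\<dots> \<le> C * 1" using x C(1) by (intro mult_left_mono)
  finally show "nrm V (T x) \<le> C" by simp
qed

lemma opnorm_nonneg: "T \<in> carrier BO \<Longrightarrow> 0 \<le> nrm BO T"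
proof -
  assume T: "T \<in> carrier BO"
  have "nrm V (T \<zero>) \<le> nrm BO T"
    unfolding bounded_operators_simps
    by (rule cSUP_upper) (use opnorm_bdd[OF T] in auto)
  then show ?thesis using nrm_nonneg[OF bounded_operators_app(1)[OF T M.zero_closed]] by linarith
qed

lemma BO_add_closed:
  assumes S: "S \<in> carrier BO" and T: "T \<in> carrier BO"
  shows "S \<oplus>\<^bsub>BO\<^esub> T \<in> carrier BO"
proof (rule bounded_operatorsI[where C = "nrm BO S + nrm BO T"])
  fix x assume x: "x \<in> carrier V"
  have "nrm V (S x \<oplus> T x) \<le> nrm V (S x) + nrm V (T x)"
    using x S T by (intro nrm_triangle) (auto dest: bounded_operators_app)
  also have "\<dots> \<le> nrm BO S * nrm V x + nrm BO T * nrm V x"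
    using opnorm_bound[OF S x] opnorm_bound[OF T x] by linarith
  finally show "nrm V ((S \<oplus>\<^bsub>BO\<^esub> T) x) \<le> (nrm BO S + nrm BO T) * nrm V x"
    using x by (simp add: bounded_operators_simps distrib_right)
next
  note S' = bounded_operators_app[OF S] and T' = bounded_operators_app[OF T]
  fix x assume x: "x \<in> carrier V"
  show "(S \<oplus>\<^bsub>BO\<^esub> T) x \<in> carrier V" using S' T' x by (simp add: bounded_operators_simps)
  show "(S \<oplus>\<^bsub>BO\<^esub> T) (c \<odot> x) = c \<odot> (S \<oplus>\<^bsub>BO\<^esub> T) x" for c
    using x S'(1,3) T'(1,3) by (simp add: bounded_operators_simps csmult_add_right)
  fix y assume y: "y \<in> carrier V"
  have "(S x \<oplus> S y) \<oplus> (T x \<oplus> T y) = (S x \<oplus> T x) \<oplus> (S y \<oplus> T y)"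
    using S'(1)[OF x] T'(1)[OF x] S'(1)[OF y] T'(1)[OF y] by (simp add: M.a_ac)
  then show "(S \<oplus>\<^bsub>BO\<^esub> T) (x \<oplus> y) = (S \<oplus>\<^bsub>BO\<^esub> T) x \<oplus> (S \<oplus>\<^bsub>BO\<^esub> T) y"
    using x y by (simp add: bounded_operators_simps S'(2) T'(2))
qed (simp add: bounded_operators_simps)

lemma BO_smult_closed:
  assumes T: "T \<in> carrier BO"
  shows "c \<odot>\<^bsub>BO\<^esub> T \<in> carrier BO"
proof (rule bounded_operatorsI[where C = "cmod c * nrm BO T"])
  fix x assume x: "x \<in> carrier V"
  show "nrm V ((c \<odot>\<^bsub>BO\<^esub> T) x) \<le> cmod c * nrm BO T * nrm V x"
    using x opnorm_bound[OF T x] bounded_operators_app[OF T]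
    by (simp add: bounded_operators_simps nrm_smult mult.assoc mult_left_mono)
qed (use bounded_operators_app[OF T] in
      \<open>auto simp: bounded_operators_simps csmult_add_right csmult_assoc mult.commute\<close>)

lemma BO_mult_closed:
  assumes S: "S \<in> carrier BO" and T: "T \<in> carrier BO"
  shows "S \<otimes>\<^bsub>BO\<^esub> T \<in> carrier BO"
    and "nrm BO (S \<otimes>\<^bsub>BO\<^esub> T) \<le> nrm BO S * nrm BO T"
proof -
  have b: "nrm V ((S \<otimes>\<^bsub>BO\<^esub> T) x) \<le> nrm BO S * nrm BO T * nrm V x" if x: "x \<in> carrier V" for x
  proof -
    have "nrm V (S (T x)) \<le> nrm BO S * nrm V (T x)"
      using opnorm_bound[OF S] bounded_operators_app[OF T x] by simp
    also have "\<dots> \<le> nrm BO S * (nrm BO T * nrm V x)"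
      using opnorm_bound[OF T x] opnorm_nonneg[OF S] by (rule mult_left_mono)
    finally show ?thesis using x by (simp add: bounded_operators_simps compose_def mult.assoc)
  qed
  show c: "S \<otimes>\<^bsub>BO\<^esub> T \<in> carrier BO"
    by (rule bounded_operatorsI[where C = "nrm BO S * nrm BO T"])
      (use bounded_operators_app[OF S] bounded_operators_app[OF T] b in
      \<open>auto simp: bounded_operators_simps compose_def\<close>)
  show "nrm BO (S \<otimes>\<^bsub>BO\<^esub> T) \<le> nrm BO S * nrm BO T"
    by (rule opnorm_le[OF c]) (use b opnorm_nonneg S T in auto)
qed

lemma BO_one_closed: "\<one>\<^bsub>BO\<^esub> \<in> carrier BO"
  by (rule bounded_operatorsI[where C = 1]) (auto simp: bounded_operators_simps)

lemma BO_zero_closed: "\<zero>\<^bsub>BO\<^esub> \<in> carrier BO"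
  by (rule bounded_operatorsI[where C = 0]) (auto simp: bounded_operators_simps)

end

context complex_normed_space
begin

lemma complex_normed_space_BO: "complex_normed_space BO"
proof (rule complex_normed_spaceI)
  fix S assume S: "S \<in> carrier BO"
  note S' = bounded_operators_app[OF S]
  have zero: "(\<zero>\<^bsub>BO\<^esub>) x = \<zero>" if "x \<in> carrier V" for x
    using that by (simp add: bounded_operators_simps)
  show "nrm BO S = 0 \<longleftrightarrow> S = \<zero>\<^bsub>BO\<^esub>"
  proof
    assume "nrm BO S = 0"
    then have "S x = \<zero>" if "x \<in> carrier V" for x
      using opnorm_bound[OF S that] nrm_nonneg[OF S'(1)[OF that]] nrm_eq_0_iff[OF S'(1)[OF that]] by simp
    then show "S = \<zero>\<^bsub>BO\<^esub>"
      by (intro bounded_operators_eqI[OF S BO_zero_closed]) (simp add: zero)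
  next
    assume "S = \<zero>\<^bsub>BO\<^esub>"
    then have "nrm BO S \<le> 0" by (intro opnorm_le[OF S]) (auto simp: zero)
    then show "nrm BO S = 0" using opnorm_nonneg[OF S] by simp
  qed
  show "nrm BO (c \<odot>\<^bsub>BO\<^esub> S) = cmod c * nrm BO S" for c
  proof -
    have le: "nrm BO (c \<odot>\<^bsub>BO\<^esub> T) \<le> cmod c * nrm BO T" if T: "T \<in> carrier BO" for T c
      by (rule opnorm_le[OF BO_smult_closed[OF T]])
        (use opnorm_bound[OF T] opnorm_nonneg[OF T] bounded_operators_app[OF T] in
          \<open>auto simp: bounded_operators_simps nrm_smult mult.assoc mult_left_mono\<close>)
    show ?thesis
    proof (cases "c = 0")
      case True
      have "nrm BO (0 \<odot>\<^bsub>BO\<^esub> S) \<le> 0" using le[OF S, of 0] by simp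
      then have "nrm BO (0 \<odot>\<^bsub>BO\<^esub> S) = 0"
        using opnorm_nonneg[OF BO_smult_closed[OF S, of 0]] by (rule antisym)
      then show ?thesis using True by simp
    next
      case False
      have "(1/c) \<odot>\<^bsub>BO\<^esub> (c \<odot>\<^bsub>BO\<^esub> S) = S"
        by (rule bounded_operators_eqI[OF BO_smult_closed[OF BO_smult_closed[OF S]] S])
          (use S' False in \<open>auto simp: bounded_operators_simps csmult_assoc\<close>)
      then have "nrm BO S \<le> cmod (1/c) * nrm BO (c \<odot>\<^bsub>BO\<^esub> S)"
        using le[OF BO_smult_closed[OF S], of "1/c" c] by simp
      then have "cmod c * nrm BO S \<le> nrm BO (c \<odot>\<^bsub>BO\<^esub> S)"
        using False by (simp add: norm_divide pos_le_divide_eq mult.commute)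
      then show ?thesis using le[OF S, of c] by simp
    qed
  qed
next
  fix S T assume S: "S \<in> carrier BO" and T: "T \<in> carrier BO"
  show "nrm BO (S \<oplus>\<^bsub>BO\<^esub> T) \<le> nrm BO S + nrm BO T"
  proof (rule opnorm_le[OF BO_add_closed[OF S T]])
    fix x assume x: "x \<in> carrier V"
    have "nrm V (S x \<oplus> T x) \<le> nrm V (S x) + nrm V (T x)"
      using x S T by (intro nrm_triangle) (auto dest: bounded_operators_app)
    also have "\<dots> \<le> nrm BO S * nrm V x + nrm BO T * nrm V x"
      using opnorm_bound[OF S x] opnorm_bound[OF T x] by linarith
    finally show "nrm V ((S \<oplus>\<^bsub>BO\<^esub> T) x) \<le> (nrm BO S + nrm BO T) * nrm V x"
      using x by (simp add: bounded_operators_simps distrib_right)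
  qed (use opnorm_nonneg S T in auto)
next
  fix a :: complex and x assume x: "x \<in> carrier BO"
  note [simp] = bounded_operators_app(1)[OF x]
  show "(-1) \<odot>\<^bsub>BO\<^esub> x \<oplus>\<^bsub>BO\<^esub> x = \<zero>\<^bsub>BO\<^esub>"
    by (auto simp: bounded_operators_simps fun_eq_iff uminus_csmult[symmetric] M.l_neg)
  show "\<zero>\<^bsub>BO\<^esub> \<oplus>\<^bsub>BO\<^esub> x = x"
    using bounded_operatorsD(2)[OF x] by (auto simp: bounded_operators_simps fun_eq_iff extensional_def)
  show "(a + b) \<odot>\<^bsub>BO\<^esub> x = a \<odot>\<^bsub>BO\<^esub> x \<oplus>\<^bsub>BO\<^esub> b \<odot>\<^bsub>BO\<^esub> x" for b
    by (auto simp: bounded_operators_simps fun_eq_iff csmult_add_left)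
  show "(a * b) \<odot>\<^bsub>BO\<^esub> x = a \<odot>\<^bsub>BO\<^esub> (b \<odot>\<^bsub>BO\<^esub> x)" for b
    by (auto simp: bounded_operators_simps fun_eq_iff csmult_assoc)
  show "1 \<odot>\<^bsub>BO\<^esub> x = x"
    using bounded_operatorsD(2)[OF x] by (auto simp: bounded_operators_simps fun_eq_iff extensional_def)
  fix y assume y: "y \<in> carrier BO"
  note [simp] = bounded_operators_app(1)[OF y]
  show "x \<oplus>\<^bsub>BO\<^esub> y = y \<oplus>\<^bsub>BO\<^esub> x"
    by (auto simp: bounded_operators_simps fun_eq_iff M.a_comm)
  show "a \<odot>\<^bsub>BO\<^esub> (x \<oplus>\<^bsub>BO\<^esub> y) = a \<odot>\<^bsub>BO\<^esub> x \<oplus>\<^bsub>BO\<^esub> a \<odot>\<^bsub>BO\<^esub> y"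
    by (auto simp: bounded_operators_simps fun_eq_iff csmult_add_right)
  fix z assume z: "z \<in> carrier BO"
  note [simp] = bounded_operators_app(1)[OF z]
  show "(x \<oplus>\<^bsub>BO\<^esub> y) \<oplus>\<^bsub>BO\<^esub> z = x \<oplus>\<^bsub>BO\<^esub> (y \<oplus>\<^bsub>BO\<^esub> z)"
    by (auto simp: bounded_operators_simps fun_eq_iff M.a_assoc)
qed (simp_all add: BO_zero_closed BO_add_closed BO_smult_closed)

lemma BO_minus_app:
  assumes "S \<in> carrier BO" "T \<in> carrier BO" "x \<in> carrier V"
  shows "(S \<ominus>\<^bsub>BO\<^esub> T) x = S x \<ominus> T x"
proof -
  interpret B: complex_normed_space BO by (rule complex_normed_space_BO)
  show ?thesis
    using assms bounded_operators_app(1)[OF assms(1,3)] bounded_operators_app(1)[OF assms(2,3)]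
    by (subst B.minus_csmult) (auto simp: minus_csmult bounded_operators_simps)
qed

text \<open>The pointwise limit of a Cauchy sequence of operators inherits linearity, and the Cauchy estimate
  passes to the limit with the factor \<open>nrm V x\<close>, hence uniformly on the unit ball.\<close>

lemma complex_banach_space_BO:
  assumes "complex_banach_space V"
  shows "complex_banach_space BO"
proof -
  interpret B: complex_normed_space BO by (rule complex_normed_space_BO)
  have compl: "\<exists>x\<in>carrier V. \<forall>\<epsilon>>0. \<exists>N. \<forall>n\<ge>N. nrm V (s n \<ominus> x) < \<epsilon>"
    if "\<And>n. s n \<in> carrier V" "\<And>\<epsilon>. \<epsilon> > 0 \<Longrightarrow> \<exists>N. \<forall>m\<ge>N. \<forall>n\<ge>N. nrm V (s m \<ominus> s n) < \<epsilon>" for s :: "nat \<Rightarrow> 'a"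
    by (rule complex_banach_space.complete[OF assms, unfolded mcomplete_ndist_iff, THEN spec, THEN mp, THEN mp])
      (use that in simp_all)
  have "\<exists>T\<in>carrier BO. \<forall>\<epsilon>>0. \<exists>N. \<forall>n\<ge>N. nrm BO (s n \<ominus>\<^bsub>BO\<^esub> T) < \<epsilon>"
    if s: "\<forall>n. s n \<in> carrier BO"
      and cauchy: "\<forall>\<epsilon>>0. \<exists>N. \<forall>m\<ge>N. \<forall>n\<ge>N. nrm BO (s m \<ominus>\<^bsub>BO\<^esub> s n) < \<epsilon>" for s :: "nat \<Rightarrow> 'a \<Rightarrow> 'a"
  proof -
    have sc: "s n x \<in> carrier V" if "x \<in> carrier V" for n x
      using that by (rule bounded_operators_app(1)[OF s[rule_format]])
    have diff: "nrm V (s m x \<ominus> s n x) \<le> nrm BO (s m \<ominus>\<^bsub>BO\<^esub> s n) * nrm V x" if "x \<in> carrier V" for m n x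
      using opnorm_bound[of "s m \<ominus>\<^bsub>BO\<^esub> s n" x] s that by (simp add: BO_minus_app)
    have "\<exists>y\<in>carrier V. \<forall>\<epsilon>>0. \<exists>N. \<forall>n\<ge>N. nrm V (s n x \<ominus> y) < \<epsilon>" if x: "x \<in> carrier V" for x
    proof (rule compl)
      fix \<epsilon> :: real assume "\<epsilon> > 0"
      then obtain N where N: "\<forall>m\<ge>N. \<forall>n\<ge>N. nrm BO (s m \<ominus>\<^bsub>BO\<^esub> s n) < \<epsilon> / (nrm V x + 1)"
        using cauchy x by (metis divide_pos_pos nrm_nonneg add_nonneg_pos zero_less_one)
      have "nrm V (s m x \<ominus> s n x) < \<epsilon>" if "m \<ge> N" "n \<ge> N" for m n
      proof -
        have "nrm V (s m x \<ominus> s n x) \<le> nrm BO (s m \<ominus>\<^bsub>BO\<^esub> s n) * nrm V x" by (rule diff[OF x])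
        also have "\<dots> \<le> \<epsilon> / (nrm V x + 1) * nrm V x"
          using N that x by (intro mult_right_mono) (auto simp: less_imp_le)
        also have "\<dots> < \<epsilon>" using \<open>\<epsilon> > 0\<close> nrm_nonneg[OF x] by (simp add: divide_simps)
        finally show ?thesis .
      qed
      then show "\<exists>N. \<forall>m\<ge>N. \<forall>n\<ge>N. nrm V (s m x \<ominus> s n x) < \<epsilon>" by blast
    qed (use sc x in auto)
    then obtain T0 where T0: "\<And>x. x \<in> carrier V \<Longrightarrow> T0 x \<in> carrier V"
      "\<And>x \<epsilon>. x \<in> carrier V \<Longrightarrow> \<epsilon> > 0 \<Longrightarrow> \<exists>N. \<forall>n\<ge>N. nrm V (s n x \<ominus> T0 x) < \<epsilon>"
      by metis
    have est: "nrm V (s n x \<ominus> T0 x) \<le> \<epsilon> * nrm V x"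
      if N: "\<forall>m\<ge>N. \<forall>n\<ge>N. nrm BO (s m \<ominus>\<^bsub>BO\<^esub> s n) < \<epsilon>" and n: "n \<ge> N" and x: "x \<in> carrier V" for N n \<epsilon> x
    proof (rule field_le_epsilon)
      fix e :: real assume "0 < e"
      then obtain N' where N': "\<forall>n\<ge>N'. nrm V (s n x \<ominus> T0 x) < e" using T0(2)[OF x] by blast
      define m where "m = max N N'"
      have "nrm V (s n x \<ominus> T0 x) \<le> nrm V (s n x \<ominus> s m x) + nrm V (s m x \<ominus> T0 x)"
        using sc T0(1) x by (intro nrm_minus_triangle) auto
      also have "nrm V (s n x \<ominus> s m x) \<le> \<epsilon> * nrm V x"
      proof -
        have "nrm BO (s n \<ominus>\<^bsub>BO\<^esub> s m) \<le> \<epsilon>" using N n by (simp add: m_def less_imp_le)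
        then have "nrm BO (s n \<ominus>\<^bsub>BO\<^esub> s m) * nrm V x \<le> \<epsilon> * nrm V x"
          using x by (intro mult_right_mono) auto
        then show ?thesis using diff[OF x, of n m] by linarith
      qed
      also have "nrm V (s m x \<ominus> T0 x) \<le> e" using N' by (simp add: m_def less_imp_le)
      finally show "nrm V (s n x \<ominus> T0 x) \<le> \<epsilon> * nrm V x + e" by simp
    qed
    obtain N1 where N1: "\<forall>m\<ge>N1. \<forall>n\<ge>N1. nrm BO (s m \<ominus>\<^bsub>BO\<^esub> s n) < 1" using cauchy zero_less_one by blast
    define T where "T = restrict T0 (carrier V)"
    have T: "T \<in> carrier BO"
    proof (rule bounded_operatorsI[where C = "nrm BO (s N1) + 1"])
      fix x assume x: "x \<in> carrier V"
      have "nrm V (T0 x) \<le> nrm V (s N1 x) + nrm V (T0 x \<ominus> s N1 x)"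
        using T0(1) sc x by (intro nrm_le_add_minus) auto
      also have "nrm V (T0 x \<ominus> s N1 x) \<le> 1 * nrm V x"
        using est[OF N1 _ x, of N1] T0(1) sc x by (simp add: nrm_minus_commute)
      also have "nrm V (s N1 x) \<le> nrm BO (s N1) * nrm V x" by (rule opnorm_bound[OF s[rule_format] x])
      finally show "nrm V (T x) \<le> (nrm BO (s N1) + 1) * nrm V x"
        using x by (simp add: T_def distrib_right)
      show "T x \<in> carrier V" using T0(1) x by (simp add: T_def)
      show "T (c \<odot> x) = c \<odot> T x" for c
      proof -
        have "T0 (c \<odot> x) = c \<odot> T0 x"
        proof (rule eq_if_nrm_minus_small[where K = "1 + cmod c"])
          fix \<epsilon> :: real assume e: "0 < \<epsilon>"
          obtain N where N: "\<forall>n\<ge>N. nrm V (s n (c \<odot> x) \<ominus> T0 (c \<odot> x)) < \<epsilon>" using T0(2)[of "c \<odot> x"] e x by auto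
          obtain N' where N': "\<forall>n\<ge>N'. nrm V (s n x \<ominus> T0 x) < \<epsilon>" using T0(2)[of x] e x by auto
          define m where "m = max N N'"
          have "nrm V (T0 (c \<odot> x) \<ominus> c \<odot> T0 x) \<le>
              nrm V (T0 (c \<odot> x) \<ominus> s m (c \<odot> x)) + nrm V (s m (c \<odot> x) \<ominus> c \<odot> T0 x)"
            using T0(1) sc x by (intro nrm_minus_triangle) auto
          also have "s m (c \<odot> x) = c \<odot> s m x" by (rule bounded_operators_app(3)[OF s[rule_format] x])
          also have "nrm V (c \<odot> s m x \<ominus> c \<odot> T0 x) = cmod c * nrm V (s m x \<ominus> T0 x)"
            using sc T0(1) x by (simp add: csmult_minus[symmetric] nrm_smult)
          also have "\<dots> \<le> cmod c * \<epsilon>" using N' by (intro mult_left_mono) (auto simp: m_def less_imp_le)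
          also have "nrm V (T0 (c \<odot> x) \<ominus> c \<odot> s m x) \<le> \<epsilon>"
            proof -
            have "nrm V (T0 (c \<odot> x) \<ominus> c \<odot> s m x) = nrm V (s m (c \<odot> x) \<ominus> T0 (c \<odot> x))"
              using T0(1)[of "c \<odot> x"] sc[OF x, of m] x bounded_operators_app(3)[OF s[rule_format] x, of m c]
              by (simp add: nrm_minus_commute)
            also have "\<dots> \<le> \<epsilon>" using N by (simp add: m_def less_imp_le)
            finally show ?thesis .
          qed
          finally show "nrm V (T0 (c \<odot> x) \<ominus> c \<odot> T0 x) \<le> (1 + cmod c) * \<epsilon>" by (simp add: distrib_right)
        qed (use T0(1) x in auto)
        then show ?thesis using x by (simp add: T_def)
      qed
      show "T (x \<oplus> y) = T x \<oplus> T y" if y: "y \<in> carrier V" for y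
      proof -
        have "T0 (x \<oplus> y) = T0 x \<oplus> T0 y"
        proof (rule eq_if_nrm_minus_small[where K = 3])
          fix \<epsilon> :: real assume e: "0 < \<epsilon>"
          obtain N where N: "\<forall>n\<ge>N. nrm V (s n (x \<oplus> y) \<ominus> T0 (x \<oplus> y)) < \<epsilon>" using T0(2)[of "x \<oplus> y"] e x y by auto
          obtain N' where N': "\<forall>n\<ge>N'. nrm V (s n x \<ominus> T0 x) < \<epsilon>" using T0(2)[of x] e x by auto
          obtain N'' where N'': "\<forall>n\<ge>N''. nrm V (s n y \<ominus> T0 y) < \<epsilon>" using T0(2)[of y] e y by auto
          define m where "m = max N (max N' N'')"
          have sm: "s m (x \<oplus> y) = s m x \<oplus> s m y" by (rule bounded_operators_app(2)[OF s[rule_format] x y])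
          have "nrm V (T0 (x \<oplus> y) \<ominus> (T0 x \<oplus> T0 y)) \<le>
              nrm V (T0 (x \<oplus> y) \<ominus> s m (x \<oplus> y)) + nrm V (s m (x \<oplus> y) \<ominus> (T0 x \<oplus> T0 y))"
            using T0(1) sc x y by (intro nrm_minus_triangle) auto
          also have "s m (x \<oplus> y) \<ominus> (T0 x \<oplus> T0 y) = (s m x \<ominus> T0 x) \<oplus> (s m y \<ominus> T0 y)"
            unfolding sm using sc T0(1) x y by (intro add_minus_add) auto
          also have "nrm V \<dots> \<le> nrm V (s m x \<ominus> T0 x) + nrm V (s m y \<ominus> T0 y)"
            using sc T0(1) x y by (intro nrm_triangle) auto
          also have "nrm V (T0 (x \<oplus> y) \<ominus> s m (x \<oplus> y)) = nrm V (s m (x \<oplus> y) \<ominus> T0 (x \<oplus> y))"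
            using T0(1) sc x y by (intro nrm_minus_commute) auto
          also have "\<dots> \<le> \<epsilon>" using N by (simp add: m_def less_imp_le)
          also have "nrm V (s m x \<ominus> T0 x) \<le> \<epsilon>" using N' by (simp add: m_def less_imp_le)
          also have "nrm V (s m y \<ominus> T0 y) \<le> \<epsilon>" using N'' by (simp add: m_def less_imp_le)
          finally show "nrm V (T0 (x \<oplus> y) \<ominus> (T0 x \<oplus> T0 y)) \<le> 3 * \<epsilon>" by simp
        qed (use T0(1) x y in auto)
        then show ?thesis using x y by (simp add: T_def)
      qed
    qed (simp add: T_def)
    have "\<exists>N. \<forall>n\<ge>N. nrm BO (s n \<ominus>\<^bsub>BO\<^esub> T) < \<epsilon>" if e: "\<epsilon> > 0" for \<epsilon>
    proof -
      obtain N where N: "\<forall>m\<ge>N. \<forall>n\<ge>N. nrm BO (s m \<ominus>\<^bsub>BO\<^esub> s n) < \<epsilon>/2"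
        using cauchy e half_gt_zero by blast
      have "nrm BO (s n \<ominus>\<^bsub>BO\<^esub> T) \<le> \<epsilon>/2" if n: "n \<ge> N" for n
      proof (rule opnorm_le)
        fix x assume x: "x \<in> carrier V"
        show "nrm V ((s n \<ominus>\<^bsub>BO\<^esub> T) x) \<le> \<epsilon>/2 * nrm V x"
          using est[OF N n x] s T x by (simp add: BO_minus_app) (simp add: T_def)
      qed (use s T e in auto)
      then show ?thesis using e by (intro exI[of _ N]) fastforce
    qed
    then show ?thesis using T by blast
  qed
  then have "Metric_space.mcomplete (carrier BO) (ndist BO)"
    unfolding B.mcomplete_ndist_iff by simp
  then show ?thesis
    by (intro complex_banach_space.intro complex_banach_space_axioms.intro complex_normed_space_BO)
qed

lemma banach_algebra_BO:
  assumes "complex_banach_space V"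
  shows "banach_algebra BO"
proof (intro banach_algebra.intro banach_algebra_axioms.intro complex_banach_space_BO[OF assms])
  fix S T c assume S: "S \<in> carrier BO" and T: "T \<in> carrier BO"
  note [simp] = bounded_operators_app[OF S] bounded_operators_app[OF T]
  show "S \<otimes>\<^bsub>BO\<^esub> T \<in> carrier BO" "nrm BO (S \<otimes>\<^bsub>BO\<^esub> T) \<le> nrm BO S * nrm BO T"
    using BO_mult_closed S T by auto
  show "(c \<odot>\<^bsub>BO\<^esub> S) \<otimes>\<^bsub>BO\<^esub> T = c \<odot>\<^bsub>BO\<^esub> (S \<otimes>\<^bsub>BO\<^esub> T)"
    "S \<otimes>\<^bsub>BO\<^esub> (c \<odot>\<^bsub>BO\<^esub> T) = c \<odot>\<^bsub>BO\<^esub> (S \<otimes>\<^bsub>BO\<^esub> T)"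
    by (auto simp: bounded_operators_simps compose_def fun_eq_iff)
  fix R assume R: "R \<in> carrier BO"
  note [simp] = bounded_operators_app[OF R]
  show "(S \<otimes>\<^bsub>BO\<^esub> T) \<otimes>\<^bsub>BO\<^esub> R = S \<otimes>\<^bsub>BO\<^esub> (T \<otimes>\<^bsub>BO\<^esub> R)"
    "(S \<oplus>\<^bsub>BO\<^esub> T) \<otimes>\<^bsub>BO\<^esub> R = (S \<otimes>\<^bsub>BO\<^esub> R) \<oplus>\<^bsub>BO\<^esub> (T \<otimes>\<^bsub>BO\<^esub> R)"
    "R \<otimes>\<^bsub>BO\<^esub> (S \<oplus>\<^bsub>BO\<^esub> T) = (R \<otimes>\<^bsub>BO\<^esub> S) \<oplus>\<^bsub>BO\<^esub> (R \<otimes>\<^bsub>BO\<^esub> T)"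
    by (auto simp: bounded_operators_simps compose_def fun_eq_iff)
qed

end

context banach_algebra
begin

lemma mult_minus_right:
  "x \<in> carrier A \<Longrightarrow> y \<in> carrier A \<Longrightarrow> z \<in> carrier A \<Longrightarrow> x \<otimes> (y \<ominus> z) = x \<otimes> y \<ominus> x \<otimes> z"
  by (simp add: minus_csmult mult_closed mult_distr_right smult_mult_right)

lemma mult_minus_left:
  "x \<in> carrier A \<Longrightarrow> y \<in> carrier A \<Longrightarrow> z \<in> carrier A \<Longrightarrow> (x \<ominus> y) \<otimes> z = x \<otimes> z \<ominus> y \<otimes> z"
  by (simp add: minus_csmult mult_closed mult_distr_left smult_mult_left)

lemma mult_zero_left [simp]: "x \<in> carrier A \<Longrightarrow> \<zero> \<otimes> x = \<zero>"
  using mult_minus_left[of "\<zero>" "\<zero>" x] by (simp add: mult_closed)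

lemma mult_zero_right [simp]: "x \<in> carrier A \<Longrightarrow> x \<otimes> \<zero> = \<zero>"
  using mult_minus_right[of x "\<zero>" "\<zero>"] by (simp add: mult_closed)

lemma nrm_mult_minus_mult:
  assumes "x \<in> carrier A" "y \<in> carrier A" "a \<in> carrier A" "b \<in> carrier A"
  shows "nrm A (x \<otimes> y \<ominus> a \<otimes> b) \<le> nrm A x * nrm A (y \<ominus> b) + nrm A (x \<ominus> a) * nrm A b"
proof -
  have "nrm A (x \<otimes> y \<ominus> a \<otimes> b) \<le> nrm A (x \<otimes> y \<ominus> x \<otimes> b) + nrm A (x \<otimes> b \<ominus> a \<otimes> b)"
    using assms by (intro nrm_minus_triangle) (auto intro: mult_closed)
  also have "\<dots> = nrm A (x \<otimes> (y \<ominus> b)) + nrm A ((x \<ominus> a) \<otimes> b)"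
    using assms by (simp add: mult_minus_left mult_minus_right)
  also have "\<dots> \<le> nrm A x * nrm A (y \<ominus> b) + nrm A (x \<ominus> a) * nrm A b"
    using assms by (intro add_mono nrm_mult) auto
  finally show ?thesis .
qed

lemma mult_approx:
  assumes "x \<in> carrier A" "y \<in> carrier A" "a \<in> carrier A" "b \<in> carrier A"
    and d: "0 < d" "d \<le> 1" "nrm A (x \<ominus> a) < d" "nrm A (y \<ominus> b) < d"
  shows "nrm A (x \<otimes> y \<ominus> a \<otimes> b) \<le> (nrm A x + nrm A y + 1) * d"
proof -
  have b: "nrm A b \<le> nrm A y + 1"
    using nrm_le_add_minus[of b y] assms nrm_minus_commute[of b y] by simp
  have "nrm A (x \<otimes> y \<ominus> a \<otimes> b) \<le> nrm A x * nrm A (y \<ominus> b) + nrm A (x \<ominus> a) * nrm A b"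
    using assms by (intro nrm_mult_minus_mult) auto
  also have "nrm A x * nrm A (y \<ominus> b) \<le> nrm A x * d"
    using assms by (intro mult_left_mono) auto
  also have "nrm A (x \<ominus> a) * nrm A b \<le> d * (nrm A y + 1)"
    using assms b by (intro mult_mono) auto
  finally show ?thesis by (simp add: algebra_simps)
qed

end

section \<open>Extension of an isometric homomorphism from a dense subalgebra\<close>

text \<open>The homomorphism to be extended is given by its graph \<open>G\<close>, which spares a proof that it is well
  defined: the closure \<open>lim\<close> of \<open>G\<close> is again closed under the operations and norm preserving, so it is
  single valued, and completeness of the target makes it total.\<close>

lemma isometric_graph_extends:
  fixes U :: "('a, 'm) normed_module_scheme" and W :: "('b, 'n) normed_module_scheme"
  assumes U: "banach_algebra U" and W: "banach_algebra W"
    and sub: "\<And>a T. (a, T) \<in> G \<Longrightarrow> a \<in> carrier U \<and> T \<in> carrier W"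
    and add: "\<And>a T b S. (a, T) \<in> G \<Longrightarrow> (b, S) \<in> G \<Longrightarrow> (a \<oplus>\<^bsub>U\<^esub> b, T \<oplus>\<^bsub>W\<^esub> S) \<in> G"
    and smult: "\<And>a T c. (a, T) \<in> G \<Longrightarrow> (c \<odot>\<^bsub>U\<^esub> a, c \<odot>\<^bsub>W\<^esub> T) \<in> G"
    and mult: "\<And>a T b S. (a, T) \<in> G \<Longrightarrow> (b, S) \<in> G \<Longrightarrow> (a \<otimes>\<^bsub>U\<^esub> b, T \<otimes>\<^bsub>W\<^esub> S) \<in> G"
    and norm: "\<And>a T. (a, T) \<in> G \<Longrightarrow> nrm W T = nrm U a"
    and dense: "\<And>x \<epsilon>. x \<in> carrier U \<Longrightarrow> 0 < \<epsilon> \<Longrightarrow> \<exists>(a, T) \<in> G. nrm U (x \<ominus>\<^bsub>U\<^esub> a) < \<epsilon>"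
  shows "\<exists>\<pi>. \<pi> \<in> alg_hom U W \<and> isometric U W \<pi> \<and> (\<forall>(a, T) \<in> G. \<pi> a = T)"
proof -
  interpret U: banach_algebra U by fact
  interpret W: banach_algebra W by fact
  define lim where "lim x y \<longleftrightarrow> x \<in> carrier U \<and> y \<in> carrier W \<and>
    (\<forall>\<epsilon>>0. \<exists>a T. (a, T) \<in> G \<and> nrm U (x \<ominus>\<^bsub>U\<^esub> a) < \<epsilon> \<and> nrm W (y \<ominus>\<^bsub>W\<^esub> T) < \<epsilon>)" for x y
  have lim_G: "lim a T" if "(a, T) \<in> G" for a T
    using that sub[OF that] unfolding lim_def
    by (intro conjI allI impI exI[of _ a] exI[of _ T]) simp_all
  have lim_nrm: "nrm W y = nrm U x" if "lim x y" for x y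
  proof (rule antisym)
    have xy: "x \<in> carrier U" "y \<in> carrier W" using that by (auto simp: lim_def)
    have "nrm W y \<le> nrm U x + e \<and> nrm U x \<le> nrm W y + e" if e: "0 < e" for e
    proof -
      obtain a T where aT: "(a, T) \<in> G" "nrm U (x \<ominus>\<^bsub>U\<^esub> a) < e/2" "nrm W (y \<ominus>\<^bsub>W\<^esub> T) < e/2"
        using \<open>lim x y\<close> e unfolding lim_def by (metis half_gt_zero)
      note s = sub[OF aT(1)]
      have "nrm W y \<le> nrm W T + e/2" "nrm U x \<le> nrm U a + e/2"
        using W.nrm_le_add_minus[of y T] U.nrm_le_add_minus[of x a] aT s xy by auto
      moreover have "nrm W T \<le> nrm W y + e/2" "nrm U a \<le> nrm U x + e/2"
        using W.nrm_le_add_minus[of T y] U.nrm_le_add_minus[of a x] aT s xy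
          W.nrm_minus_commute[of T y] U.nrm_minus_commute[of a x] by auto
      ultimately show ?thesis using norm[OF aT(1)] by auto
    qed
    then show "nrm W y \<le> nrm U x" "nrm U x \<le> nrm W y" by (auto intro: field_le_epsilon)
  qed
  have lim_add: "lim (x \<oplus>\<^bsub>U\<^esub> x') (y \<oplus>\<^bsub>W\<^esub> y')" if l: "lim x y" "lim x' y'" for x y x' y'
    unfolding lim_def
  proof (intro conjI allI impI)
    have c: "x \<in> carrier U" "x' \<in> carrier U" "y \<in> carrier W" "y' \<in> carrier W"
      using l by (auto simp: lim_def)
    then show "x \<oplus>\<^bsub>U\<^esub> x' \<in> carrier U" "y \<oplus>\<^bsub>W\<^esub> y' \<in> carrier W" by auto
    fix e :: real assume "0 < e"
    then have "0 < e/2" by simp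
    then obtain a T b S where aT: "(a, T) \<in> G" "nrm U (x \<ominus>\<^bsub>U\<^esub> a) < e/2" "nrm W (y \<ominus>\<^bsub>W\<^esub> T) < e/2"
      and bS: "(b, S) \<in> G" "nrm U (x' \<ominus>\<^bsub>U\<^esub> b) < e/2" "nrm W (y' \<ominus>\<^bsub>W\<^esub> S) < e/2"
      using l unfolding lim_def by metis
    have "nrm U ((x \<oplus>\<^bsub>U\<^esub> x') \<ominus>\<^bsub>U\<^esub> (a \<oplus>\<^bsub>U\<^esub> b)) < e"
      using U.nrm_triangle[of "x \<ominus>\<^bsub>U\<^esub> a" "x' \<ominus>\<^bsub>U\<^esub> b"] c sub[OF aT(1)] sub[OF bS(1)] aT bS
      by (simp add: U.add_minus_add)
    moreover have "nrm W ((y \<oplus>\<^bsub>W\<^esub> y') \<ominus>\<^bsub>W\<^esub> (T \<oplus>\<^bsub>W\<^esub> S)) < e"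
      using W.nrm_triangle[of "y \<ominus>\<^bsub>W\<^esub> T" "y' \<ominus>\<^bsub>W\<^esub> S"] c sub[OF aT(1)] sub[OF bS(1)] aT bS
      by (simp add: W.add_minus_add)
    ultimately show "\<exists>a T. (a, T) \<in> G \<and> nrm U ((x \<oplus>\<^bsub>U\<^esub> x') \<ominus>\<^bsub>U\<^esub> a) < e \<and>
        nrm W ((y \<oplus>\<^bsub>W\<^esub> y') \<ominus>\<^bsub>W\<^esub> T) < e"
      using add[OF aT(1) bS(1)] by blast
  qed
  have lim_smult: "lim (c \<odot>\<^bsub>U\<^esub> x) (c \<odot>\<^bsub>W\<^esub> y)" if l: "lim x y" for c x y
    unfolding lim_def
  proof (intro conjI allI impI)
    have c: "x \<in> carrier U" "y \<in> carrier W"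
      using l by (auto simp: lim_def)
    then show "c \<odot>\<^bsub>U\<^esub> x \<in> carrier U" "c \<odot>\<^bsub>W\<^esub> y \<in> carrier W" by auto
    fix e :: real assume e: "0 < e"
    then have "0 < e / (cmod c + 1)" by (simp add: add_nonneg_pos)
    then obtain a T where aT: "(a, T) \<in> G" "nrm U (x \<ominus>\<^bsub>U\<^esub> a) < e / (cmod c + 1)"
        "nrm W (y \<ominus>\<^bsub>W\<^esub> T) < e / (cmod c + 1)"
      using l unfolding lim_def by metis
    note s = sub[OF aT(1)]
    have k: "cmod c * r < e" if "r < e / (cmod c + 1)" "0 \<le> r" for r
    proof -
      have "cmod c * r \<le> (cmod c + 1) * r" using that by (simp add: mult_right_mono)
      also have "\<dots> < e" using that(1) by (simp add: pos_less_divide_eq add_nonneg_pos mult.commute)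
      finally show ?thesis .
    qed
    have "nrm U (c \<odot>\<^bsub>U\<^esub> x \<ominus>\<^bsub>U\<^esub> c \<odot>\<^bsub>U\<^esub> a) < e" "nrm W (c \<odot>\<^bsub>W\<^esub> y \<ominus>\<^bsub>W\<^esub> c \<odot>\<^bsub>W\<^esub> T) < e"
      using k aT s c by (simp_all add: U.csmult_minus[symmetric] W.csmult_minus[symmetric] U.nrm_smult W.nrm_smult)
    then show "\<exists>a T. (a, T) \<in> G \<and> nrm U (c \<odot>\<^bsub>U\<^esub> x \<ominus>\<^bsub>U\<^esub> a) < e \<and> nrm W (c \<odot>\<^bsub>W\<^esub> y \<ominus>\<^bsub>W\<^esub> T) < e"
      using smult[OF aT(1)] by blast
  qed
  have lim_mult: "lim (x \<otimes>\<^bsub>U\<^esub> x') (y \<otimes>\<^bsub>W\<^esub> y')" if l: "lim x y" "lim x' y'" for x y x' y'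
    unfolding lim_def
  proof (intro conjI allI impI)
    have c: "x \<in> carrier U" "x' \<in> carrier U" "y \<in> carrier W" "y' \<in> carrier W"
      using l by (auto simp: lim_def)
    then show "x \<otimes>\<^bsub>U\<^esub> x' \<in> carrier U" "y \<otimes>\<^bsub>W\<^esub> y' \<in> carrier W"
      by (auto intro: U.mult_closed W.mult_closed)
    fix e :: real assume e: "0 < e"
    define K where "K = nrm U x + nrm U x' + 1"
    have K: "K > 0" "K = nrm W y + nrm W y' + 1"
      using c lim_nrm[OF l(1)] lim_nrm[OF l(2)] by (auto simp: K_def add_nonneg_pos)
    define d where "d = min 1 (e / (2 * K))"
    have d: "0 < d" "d \<le> 1" "K * d < e"
    proof -
      show "0 < d" "d \<le> 1" using e K by (auto simp: d_def)
      have "K * d \<le> K * (e / (2 * K))" using K by (intro mult_left_mono) (auto simp: d_def)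
      also have "\<dots> = e / 2" using K(1) by simp
      finally show "K * d < e" using e by linarith
    qed
    obtain a T b S where aT: "(a, T) \<in> G" "nrm U (x \<ominus>\<^bsub>U\<^esub> a) < d" "nrm W (y \<ominus>\<^bsub>W\<^esub> T) < d"
      and bS: "(b, S) \<in> G" "nrm U (x' \<ominus>\<^bsub>U\<^esub> b) < d" "nrm W (y' \<ominus>\<^bsub>W\<^esub> S) < d"
      using l d(1) unfolding lim_def by metis
    have "nrm U (x \<otimes>\<^bsub>U\<^esub> x' \<ominus>\<^bsub>U\<^esub> a \<otimes>\<^bsub>U\<^esub> b) < e"
      using U.mult_approx[of x x' a b d] c d sub[OF aT(1)] sub[OF bS(1)] aT bS by (auto simp: K_def)
    moreover have "nrm W (y \<otimes>\<^bsub>W\<^esub> y' \<ominus>\<^bsub>W\<^esub> T \<otimes>\<^bsub>W\<^esub> S) < e"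
      using W.mult_approx[of y y' T S d] c d sub[OF aT(1)] sub[OF bS(1)] aT bS by (auto simp: K(2))
    ultimately show "\<exists>a T. (a, T) \<in> G \<and> nrm U (x \<otimes>\<^bsub>U\<^esub> x' \<ominus>\<^bsub>U\<^esub> a) < e \<and>
        nrm W (y \<otimes>\<^bsub>W\<^esub> y' \<ominus>\<^bsub>W\<^esub> T) < e"
      using mult[OF aT(1) bS(1)] by blast
  qed
  have lim_unique: "y = y'" if l: "lim x y" "lim x y'" for x y y'
  proof -
    have c: "x \<in> carrier U" "y \<in> carrier W" "y' \<in> carrier W" using l by (auto simp: lim_def)
    have "lim (x \<ominus>\<^bsub>U\<^esub> x) (y \<ominus>\<^bsub>W\<^esub> y')"
      using lim_add[OF l(1) lim_smult[OF l(2), of "-1"]] c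
      by (simp only: U.minus_csmult W.minus_csmult)
    then have "nrm W (y \<ominus>\<^bsub>W\<^esub> y') = 0" using lim_nrm c by fastforce
    then show ?thesis using c by (simp add: W.nrm_eq_0_iff W.minus_eq_zero_iff)
  qed
  have lim_ex: "\<exists>y. lim x y" if x: "x \<in> carrier U" for x
  proof -
    have "\<forall>n. \<exists>z. z \<in> G \<and> nrm U (x \<ominus>\<^bsub>U\<^esub> fst z) < 1 / real (Suc n)"
    proof
      fix n
      obtain z where "z \<in> G" "case z of (a, T) \<Rightarrow> nrm U (x \<ominus>\<^bsub>U\<^esub> a) < 1 / real (Suc n)"
        using dense[OF x, of "1 / real (Suc n)"] by auto
      then show "\<exists>z. z \<in> G \<and> nrm U (x \<ominus>\<^bsub>U\<^esub> fst z) < 1 / real (Suc n)"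
        by (intro exI[of _ z]) (simp add: case_prod_beta)
    qed
    then have "\<exists>z. \<forall>n. z n \<in> G \<and> nrm U (x \<ominus>\<^bsub>U\<^esub> fst (z n)) < 1 / real (Suc n)" by (rule choice)
    then obtain z where z: "\<And>n. z n \<in> G" "\<And>n. nrm U (x \<ominus>\<^bsub>U\<^esub> fst (z n)) < 1 / real (Suc n)" by blast
    define a where "a n = fst (z n)" for n
    define T where "T n = snd (z n)" for n
    have aT: "\<And>n. (a n, T n) \<in> G" "\<And>n. nrm U (x \<ominus>\<^bsub>U\<^esub> a n) < 1 / real (Suc n)"
      using z by (simp_all add: a_def T_def)
    note s = sub[OF aT(1)]
    have small: "\<exists>N. \<forall>n\<ge>N. nrm U (x \<ominus>\<^bsub>U\<^esub> a n) < e" if "0 < e" for e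
    proof -
      obtain N where N: "1 / real (Suc N) < e" by (rule nat_approx_posE[OF \<open>0 < e\<close>])
      show ?thesis
      proof (intro exI[of _ N] allI impI)
        fix n assume "N \<le> n"
        have "nrm U (x \<ominus>\<^bsub>U\<^esub> a n) < 1 / real (Suc n)" by (rule aT(2))
        also have "\<dots> \<le> 1 / real (Suc N)" using \<open>N \<le> n\<close> by (simp add: frac_le)
        finally show "nrm U (x \<ominus>\<^bsub>U\<^esub> a n) < e" using N by simp
      qed
    qed
    have diff: "nrm W (T m \<ominus>\<^bsub>W\<^esub> T n) = nrm U (a m \<ominus>\<^bsub>U\<^esub> a n)" for m n
      using norm[OF add[OF aT(1)[of m] smult[OF aT(1)[of n], of "-1"]]] s
      by (simp add: U.minus_csmult W.minus_csmult)
    have "\<exists>y\<in>carrier W. \<forall>\<epsilon>>0. \<exists>N. \<forall>n\<ge>N. nrm W (T n \<ominus>\<^bsub>W\<^esub> y) < \<epsilon>"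
    proof (rule W.complete[unfolded W.mcomplete_ndist_iff, rule_format])
      fix e :: real assume "0 < e"
      then obtain N where N: "\<forall>n\<ge>N. nrm U (x \<ominus>\<^bsub>U\<^esub> a n) < e/2" using small[of "e/2"] by auto
      have "nrm W (T m \<ominus>\<^bsub>W\<^esub> T n) < e" if "m \<ge> N" "n \<ge> N" for m n
      proof -
        have "nrm U (a m \<ominus>\<^bsub>U\<^esub> a n) \<le> nrm U (a m \<ominus>\<^bsub>U\<^esub> x) + nrm U (x \<ominus>\<^bsub>U\<^esub> a n)"
          using s x by (intro U.nrm_minus_triangle) auto
        moreover have "nrm U (a m \<ominus>\<^bsub>U\<^esub> x) < e/2" "nrm U (x \<ominus>\<^bsub>U\<^esub> a n) < e/2"
          using N that s x by (auto simp: U.nrm_minus_commute[of _ x])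
        ultimately show ?thesis unfolding diff by linarith
      qed
      then show "\<exists>N. \<forall>m\<ge>N. \<forall>n\<ge>N. nrm W (T m \<ominus>\<^bsub>W\<^esub> T n) < e" by blast
    qed (use s in auto)
    then obtain y where y: "y \<in> carrier W" "\<And>e. e > 0 \<Longrightarrow> \<exists>N. \<forall>n\<ge>N. nrm W (T n \<ominus>\<^bsub>W\<^esub> y) < e" by blast
    have "lim x y"
      unfolding lim_def
    proof (intro conjI x y(1) allI impI)
      fix e :: real assume e: "0 < e"
      obtain N where N: "\<forall>n\<ge>N. nrm U (x \<ominus>\<^bsub>U\<^esub> a n) < e" using small[OF e] by auto
      obtain M where M: "\<forall>n\<ge>M. nrm W (T n \<ominus>\<^bsub>W\<^esub> y) < e" using y(2)[OF e] by auto
      show "\<exists>a T. (a, T) \<in> G \<and> nrm U (x \<ominus>\<^bsub>U\<^esub> a) < e \<and> nrm W (y \<ominus>\<^bsub>W\<^esub> T) < e"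
        using N M aT(1)[of "max N M"] s[of "max N M"] y(1) W.nrm_minus_commute[of y "T (max N M)"]
        by (intro exI[of _ "a (max N M)"] exI[of _ "T (max N M)"]) auto
    qed
    then show ?thesis ..
  qed
  define \<pi> where "\<pi> x = (THE y. lim x y)" for x
  have \<pi>: "\<pi> x = y" if "lim x y" for x y
    unfolding \<pi>_def using that lim_unique by blast
  have \<pi>': "lim x (\<pi> x)" if "x \<in> carrier U" for x
    using lim_ex[OF that] \<pi> by metis
  have "\<pi> \<in> alg_hom U W"
  proof (rule alg_homI)
    show "\<pi> x \<in> carrier W" if "x \<in> carrier U" for x using \<pi>'[OF that] by (simp add: lim_def)
  qed (blast intro: \<pi> \<pi>' lim_add lim_smult lim_mult)+
  moreover have "isometric U W \<pi>" unfolding isometric_def using \<pi>' lim_nrm by blast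
  ultimately show ?thesis using \<pi> lim_G by blast
qed

section \<open>The spaces of p-summable families\<close>

text \<open>Sums of \<open>p\<close>-th powers are additive over disjoint sets of coordinates, so most estimates below are
  made for them and not for the norm \<open>lp_norm\<close>.\<close>

definition lp_sum :: "real \<Rightarrow> 'c set \<Rightarrow> ('c \<Rightarrow> complex) \<Rightarrow> real" where
  "lp_sum p C f = (LINT x|count_space C. cmod (f x) powr p)"

lemma Lp_functions_count_space:
  "f \<in> Lp_functions p (count_space C) \<longleftrightarrow> integrable (count_space C) (\<lambda>x. cmod (f x) powr p)"
  by (simp add: Lp_functions_def)

lemma lp_sum_cong: "(\<And>x. x \<in> C \<Longrightarrow> f x = g x) \<Longrightarrow> lp_sum p C f = lp_sum p C g"
  unfolding lp_sum_def by (rule Bochner_Integration.integral_cong) auto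

lemma lp_sum_nonneg: "0 \<le> lp_sum p C f"
  unfolding lp_sum_def by (rule integral_nonneg_AE) auto

lemma lp_sum_finite: "finite C \<Longrightarrow> lp_sum p C f = (\<Sum>x\<in>C. cmod (f x) powr p)"
  unfolding lp_sum_def by (rule lebesgue_integral_count_space_finite)

lemma Lp_functions_finite: "finite C \<Longrightarrow> f \<in> Lp_functions p (count_space C)"
  by (simp add: Lp_functions_count_space integrable_count_space)

lemma integrable_count_space_iff_summable_on:
  fixes g :: "'c \<Rightarrow> real"
  assumes "\<And>x. 0 \<le> g x"
  shows "integrable (count_space C) g \<longleftrightarrow> g summable_on C"
proof -
  have "g summable_on C \<longleftrightarrow> Infinite_Set_Sum.abs_summable_on g C"
    by (rule trans[OF summable_on_iff_abs_summable_on_real abs_summable_equivalent])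
  then show ?thesis by (simp add: Infinite_Set_Sum.abs_summable_on_def)
qed

lemma LINT_count_space_eq_infsum:
  fixes g :: "'c \<Rightarrow> real"
  assumes "\<And>x. 0 \<le> g x" "integrable (count_space C) g"
  shows "(LINT x|count_space C. g x) = infsum g C"
  using assms infsetsum_infsum[of g C] by (simp add: Infinite_Set_Sum.abs_summable_on_def infsetsum_def)

text \<open>Integrals over counting measures are controlled through finite subsums: integrability of a
  nonnegative function is boundedness of these, and the integral is their supremum.\<close>

lemma Lp_functionsI:
  assumes "\<And>F. finite F \<Longrightarrow> F \<subseteq> C \<Longrightarrow> (\<Sum>x\<in>F. cmod (f x) powr p) \<le> K"
  shows "f \<in> Lp_functions p (count_space C)"
proof -
  have "(\<lambda>x. cmod (f x) powr p) summable_on C"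
    by (rule nonneg_bdd_above_summable_on) (use assms in \<open>auto intro!: bdd_aboveI[where M = K]\<close>)
  then show ?thesis
    by (simp add: Lp_functions_count_space integrable_count_space_iff_summable_on)
qed

lemma sum_le_lp_sum:
  assumes "f \<in> Lp_functions p (count_space C)" "finite F" "F \<subseteq> C"
  shows "(\<Sum>x\<in>F. cmod (f x) powr p) \<le> lp_sum p C f"
proof -
  have i: "integrable (count_space C) (\<lambda>x. cmod (f x) powr p)"
    using assms(1) by (simp add: Lp_functions_count_space)
  then have "(\<lambda>x. cmod (f x) powr p) summable_on C"
    by (simp add: integrable_count_space_iff_summable_on)
  then show ?thesis
    unfolding lp_sum_def LINT_count_space_eq_infsum[OF powr_ge_zero i]
    using finite_sum_le_infsum[of "\<lambda>x. cmod (f x) powr p" C F] assms by simp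
qed

lemma lp_sum_le:
  assumes "\<And>F. finite F \<Longrightarrow> F \<subseteq> C \<Longrightarrow> (\<Sum>x\<in>F. cmod (f x) powr p) \<le> K"
  shows "lp_sum p C f \<le> K"
proof -
  have i: "integrable (count_space C) (\<lambda>x. cmod (f x) powr p)"
    using Lp_functionsI[OF assms] by (simp add: Lp_functions_count_space)
  then have "(\<lambda>x. cmod (f x) powr p) summable_on C"
    by (simp add: integrable_count_space_iff_summable_on)
  then show ?thesis
    unfolding lp_sum_def LINT_count_space_eq_infsum[OF powr_ge_zero i]
    by (rule infsum_le_finite_sums) (use assms in auto)
qed

lemma powr_p_le_cancel: "0 < p \<Longrightarrow> 0 \<le> a \<Longrightarrow> 0 \<le> b \<Longrightarrow> a powr p \<le> b powr p \<Longrightarrow> a \<le> (b::real)"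
  by (meson linorder_not_le powr_less_mono2)

text \<open>Minkowski's inequality in homogeneous form: it follows from the convexity of
  \<open>\<lambda>t. t powr p\<close>, applied to \<open>(u + v) / (a + b)\<close> as a convex combination of \<open>u / a\<close> and \<open>v / b\<close>.\<close>

lemma powr_add_le:
  assumes p: "1 \<le> p" and ab: "0 < a" "0 < b" and uv: "0 \<le> u" "0 \<le> (v::real)"
  shows "(u + v) powr p \<le> (a + b) powr p * (a / (a + b) * (u / a) powr p + b / (a + b) * (v / b) powr p)"
proof (cases "u = 0 \<or> v = 0")
  case False
  then have uv: "0 < u" "0 < v" using uv by auto
  have c: "convex_on {0<..} (\<lambda>x::real. x powr p)" using powr_convex[OF p] by simp
  have "(a / (a + b) * (u / a) + b / (a + b) * (v / b)) powr p
      \<le> a / (a + b) * (u / a) powr p + b / (a + b) * (v / b) powr p"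
    using convex_onD[OF c, of "b / (a + b)" "u / a" "v / b"] ab uv
    by (auto simp: divide_simps)
  also have "a / (a + b) * (u / a) + b / (a + b) * (v / b) = (u + v) / (a + b)"
    using ab by (simp add: add_divide_distrib)
  finally have "((u + v) / (a + b)) powr p \<le> a / (a + b) * (u / a) powr p + b / (a + b) * (v / b) powr p" .
  then have "(a + b) powr p * ((u + v) / (a + b)) powr p \<le> (a + b) powr p *
      (a / (a + b) * (u / a) powr p + b / (a + b) * (v / b) powr p)"
    by (rule mult_left_mono) simp
  then show ?thesis using ab uv by (simp add: powr_mult[symmetric])
next
  case True
  have *: "t powr p \<le> (s + r) powr p * (s / (s + r) * (t / s) powr p)"
    if "0 < s" "0 < r" "0 \<le> t" for s r t :: real
  proof -
    have "s powr (p - 1) \<le> (s + r) powr (p - 1)" using that p by (intro powr_mono2) auto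
    then have "t powr p * s powr (p - 1) \<le> t powr p * (s + r) powr (p - 1)" by (rule mult_left_mono) simp
    then show ?thesis using that by (simp add: powr_divide powr_diff divide_simps mult_ac)
  qed
  show ?thesis using True *[of a b u] *[of b a v] ab uv p by (auto simp: add.commute)
qed

lemma lp_sum_add:
  assumes p: "1 \<le> p" and f: "f \<in> Lp_functions p (count_space C)" and g: "g \<in> Lp_functions p (count_space C)"
  shows "(\<lambda>x. f x + g x) \<in> Lp_functions p (count_space C)"
    and "lp_sum p C (\<lambda>x. f x + g x) powr (1/p) \<le> lp_sum p C f powr (1/p) + lp_sum p C g powr (1/p)"
proof -
  define s where "s = lp_sum p C f powr (1/p)"
  define t where "t = lp_sum p C g powr (1/p)"
  have st: "0 \<le> s" "0 \<le> t" "s powr p = lp_sum p C f" "t powr p = lp_sum p C g"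
    using p lp_sum_nonneg[of p C f] lp_sum_nonneg[of p C g] by (auto simp: s_def t_def powr_powr)
  \<comment> \<open>the summand \<open>e\<close> makes both scales positive even if a family has norm zero\<close>
  have key: "(\<Sum>x\<in>F. cmod (f x + g x) powr p) \<le> (s + t + 2 * e) powr p"
    if F: "finite F" "F \<subseteq> C" and e: "0 < e" for F e
  proof -
    define a where "a = s + e"
    define b where "b = t + e"
    have ab: "0 < a" "0 < b" using st e by (auto simp: a_def b_def)
    have fa: "(\<Sum>x\<in>F. (cmod (f x) / a) powr p) \<le> 1"
    proof -
      have "(\<Sum>x\<in>F. (cmod (f x) / a) powr p) = (\<Sum>x\<in>F. cmod (f x) powr p) / a powr p"
        using ab by (simp add: powr_divide sum_divide_distrib)
      also have "\<dots> \<le> s powr p / a powr p"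
        using sum_le_lp_sum[OF f F] st by (intro divide_right_mono) auto
      also have "s powr p \<le> a powr p" using st e p by (intro powr_mono2) (auto simp: a_def)
      then have "s powr p / a powr p \<le> 1" using ab by (simp add: divide_simps)
      finally show ?thesis .
    qed
    have gb: "(\<Sum>x\<in>F. (cmod (g x) / b) powr p) \<le> 1"
    proof -
      have "(\<Sum>x\<in>F. (cmod (g x) / b) powr p) = (\<Sum>x\<in>F. cmod (g x) powr p) / b powr p"
        using ab by (simp add: powr_divide sum_divide_distrib)
      also have "\<dots> \<le> t powr p / b powr p"
        using sum_le_lp_sum[OF g F] st by (intro divide_right_mono) auto
      also have "t powr p \<le> b powr p" using st e p by (intro powr_mono2) (auto simp: b_def)
      then have "t powr p / b powr p \<le> 1" using ab by (simp add: divide_simps)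
      finally show ?thesis .
    qed
    have "(\<Sum>x\<in>F. cmod (f x + g x) powr p) \<le> (\<Sum>x\<in>F. (a + b) powr p *
        (a / (a + b) * (cmod (f x) / a) powr p + b / (a + b) * (cmod (g x) / b) powr p))"
    proof (rule sum_mono)
      fix x
      have "cmod (f x + g x) powr p \<le> (cmod (f x) + cmod (g x)) powr p"
        using p by (intro powr_mono2 norm_triangle_ineq) auto
      also have "\<dots> \<le> (a + b) powr p *
        (a / (a + b) * (cmod (f x) / a) powr p + b / (a + b) * (cmod (g x) / b) powr p)"
        using p ab by (intro powr_add_le) auto
      finally show "cmod (f x + g x) powr p \<le> \<dots>" .
    qed
    also have "\<dots> = (a + b) powr p * (a / (a + b) * (\<Sum>x\<in>F. (cmod (f x) / a) powr p) +
        b / (a + b) * (\<Sum>x\<in>F. (cmod (g x) / b) powr p))"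
      by (simp only: sum_distrib_left[symmetric] sum.distrib)
    also have "\<dots> \<le> (a + b) powr p * (a / (a + b) * 1 + b / (a + b) * 1)"
      using fa gb ab by (intro mult_left_mono add_mono) auto
    also have "\<dots> = (a + b) powr p" using ab by (simp add: add_divide_distrib[symmetric])
    finally show ?thesis by (simp add: a_def b_def algebra_simps)
  qed
  show "(\<lambda>x. f x + g x) \<in> Lp_functions p (count_space C)"
    by (rule Lp_functionsI[where K = "(s + t + 2 * 1) powr p"]) (rule key, auto)
  show "lp_sum p C (\<lambda>x. f x + g x) powr (1/p) \<le> lp_sum p C f powr (1/p) + lp_sum p C g powr (1/p)"
    unfolding s_def[symmetric] t_def[symmetric]
  proof (rule field_le_epsilon)
    fix e :: real assume e: "0 < e"
    have "lp_sum p C (\<lambda>x. f x + g x) \<le> (s + t + 2 * (e/2)) powr p"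
      by (rule lp_sum_le, rule key) (use e in auto)
    then have "lp_sum p C (\<lambda>x. f x + g x) powr (1/p) \<le> ((s + t + e) powr p) powr (1/p)"
      using p lp_sum_nonneg by (intro powr_mono2) auto
    then show "lp_sum p C (\<lambda>x. f x + g x) powr (1/p) \<le> s + t + e"
      using p st e by (simp add: powr_powr)
  qed
qed

lemma lp_sum_cmult:
  assumes p: "1 \<le> p" and f: "f \<in> Lp_functions p (count_space C)"
  shows "(\<lambda>x. c * f x) \<in> Lp_functions p (count_space C)"
    and "lp_sum p C (\<lambda>x. c * f x) = cmod c powr p * lp_sum p C f"
  using f by (simp_all add: Lp_functions_count_space lp_sum_def norm_mult powr_mult)

lemma lp_sum_eq_0_iff:
  assumes p: "1 \<le> p" and f: "f \<in> Lp_functions p (count_space C)"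
  shows "lp_sum p C f = 0 \<longleftrightarrow> (\<forall>x\<in>C. f x = 0)"
proof
  assume 0: "lp_sum p C f = 0"
  show "\<forall>x\<in>C. f x = 0"
  proof
    fix x assume "x \<in> C"
    then have "cmod (f x) powr p \<le> 0" using sum_le_lp_sum[OF f, of "{x}"] 0 by simp
    then have "cmod (f x) powr p = 0" by (intro antisym) auto
    then show "f x = 0" by simp
  qed
next
  assume "\<forall>x\<in>C. f x = 0"
  then have "lp_sum p C f = lp_sum p C (\<lambda>x. 0)" by (intro lp_sum_cong) auto
  then show "lp_sum p C f = 0" by (simp add: lp_sum_def)
qed

definition lp_norm :: "real \<Rightarrow> 'c set \<Rightarrow> ('c \<Rightarrow> complex) \<Rightarrow> real" where
  "lp_norm p C f = lp_sum p C f powr (1/p)"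

lemma lp_norm_nonneg [simp]: "0 \<le> lp_norm p C f"
  by (simp add: lp_norm_def)

lemma lp_norm_powr: "1 \<le> p \<Longrightarrow> lp_norm p C f powr p = lp_sum p C f"
  using lp_sum_nonneg[of p C f] by (simp add: lp_norm_def powr_powr)

lemma lp_norm_le_iff: "1 \<le> p \<Longrightarrow> 0 \<le> K \<Longrightarrow> lp_norm p C f \<le> K \<longleftrightarrow> lp_sum p C f \<le> K powr p"
proof
  assume "1 \<le> p" "lp_norm p C f \<le> K"
  then show "lp_sum p C f \<le> K powr p"
    using powr_mono2[of p "lp_norm p C f" K] by (simp add: lp_norm_powr)
next
  assume "1 \<le> p" "0 \<le> K" "lp_sum p C f \<le> K powr p"
  then show "lp_norm p C f \<le> K"
    by - (rule powr_p_le_cancel[of p], simp_all add: lp_norm_powr)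
qed

lemma lp_norm_le:
  assumes "1 \<le> p" "0 \<le> K" "\<And>F. finite F \<Longrightarrow> F \<subseteq> C \<Longrightarrow> (\<Sum>x\<in>F. cmod (f x) powr p) \<le> K powr p"
  shows "lp_norm p C f \<le> K"
  using lp_sum_le[OF assms(3)] assms by (simp add: lp_norm_le_iff)

lemma lp_norm_cong: "(\<And>x. x \<in> C \<Longrightarrow> f x = g x) \<Longrightarrow> lp_norm p C f = lp_norm p C g"
  unfolding lp_norm_def by (subst lp_sum_cong[of C f g]) auto

lemma lp_norm_triangle:
  assumes "1 \<le> p" "f \<in> Lp_functions p (count_space C)" "g \<in> Lp_functions p (count_space C)"
  shows "lp_norm p C (\<lambda>x. f x + g x) \<le> lp_norm p C f + lp_norm p C g"
  using lp_sum_add(2)[OF assms] by (simp add: lp_norm_def)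

lemma lp_norm_cmult:
  assumes "1 \<le> p" "f \<in> Lp_functions p (count_space C)"
  shows "lp_norm p C (\<lambda>x. c * f x) = cmod c * lp_norm p C f"
  using assms lp_sum_nonneg[of p C f] by (simp add: lp_norm_def lp_sum_cmult powr_mult powr_powr)

lemma lp_norm_eq_0_iff:
  assumes "1 \<le> p" "f \<in> Lp_functions p (count_space C)"
  shows "lp_norm p C f = 0 \<longleftrightarrow> (\<forall>x\<in>C. f x = 0)"
  using lp_sum_eq_0_iff[OF assms] by (simp add: lp_norm_def)

lemma cmod_le_lp_norm:
  assumes "1 \<le> p" "f \<in> Lp_functions p (count_space C)" "x \<in> C"
  shows "cmod (f x) \<le> lp_norm p C f"
proof -
  have "cmod (f x) powr p \<le> lp_norm p C f powr p"
    using sum_le_lp_sum[OF assms(2), of "{x}"] assms by (simp add: lp_norm_powr)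
  then show ?thesis using assms(1) by - (rule powr_p_le_cancel[of p], simp_all)
qed

section \<open>The spaces \<open>Lp_space p (count_space C)\<close>\<close>

abbreviation "lpf p C \<equiv> Lp_functions p (count_space C)"
abbreviation "lps p C \<equiv> Lp_space p (count_space C)"

definition lp_class :: "real \<Rightarrow> 'c set \<Rightarrow> ('c \<Rightarrow> complex) \<Rightarrow> ('c \<Rightarrow> complex) set" where
  "lp_class p C f = ae_eq_rel p (count_space C) `` {f}"

text \<open>The representative is chosen in the same way as in the norm of \<open>Lp_space\<close>.\<close>

definition lp_fun :: "('c \<Rightarrow> complex) set \<Rightarrow> 'c \<Rightarrow> complex" where
  "lp_fun F = (SOME f. f \<in> F)"

lemma lp_class_iff:
  "g \<in> lp_class p C f \<longleftrightarrow> f \<in> lpf p C \<and> g \<in> lpf p C \<and> (\<forall>x\<in>C. f x = g x)"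
  by (auto simp: lp_class_def ae_eq_rel_def AE_count_space)

lemma carrier_Lp_space: "carrier (lps p C) = lp_class p C ` lpf p C"
  by (auto simp: Lp_space_def quotient_def lp_class_def)

lemma lp_class_closed [simp]: "f \<in> lpf p C \<Longrightarrow> lp_class p C f \<in> carrier (lps p C)"
  by (simp add: carrier_Lp_space)

lemma lp_class_eqI: "(\<And>x. x \<in> C \<Longrightarrow> f x = g x) \<Longrightarrow> f \<in> lpf p C \<Longrightarrow> g \<in> lpf p C \<Longrightarrow> lp_class p C f = lp_class p C g"
  by (auto simp: set_eq_iff lp_class_iff)

lemma lp_class_eq_iff:
  "f \<in> lpf p C \<Longrightarrow> g \<in> lpf p C \<Longrightarrow> lp_class p C f = lp_class p C g \<longleftrightarrow> (\<forall>x\<in>C. f x = g x)"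
proof
  assume "f \<in> lpf p C" "g \<in> lpf p C" "lp_class p C f = lp_class p C g"
  then have "g \<in> lp_class p C f" by (simp add: lp_class_iff)
  then show "\<forall>x\<in>C. f x = g x" by (simp add: lp_class_iff)
qed (rule lp_class_eqI, auto)

lemma lp_fun_class:
  assumes "f \<in> lpf p C"
  shows "lp_fun (lp_class p C f) \<in> lpf p C" "x \<in> C \<Longrightarrow> lp_fun (lp_class p C f) x = f x"
proof -
  have "f \<in> lp_class p C f" using assms by (simp add: lp_class_iff)
  then have "lp_fun (lp_class p C f) \<in> lp_class p C f" 
    unfolding lp_fun_def by (rule someI[of "\<lambda>g. g \<in> lp_class p C f"])
  then show "lp_fun (lp_class p C f) \<in> lpf p C" "x \<in> C \<Longrightarrow> lp_fun (lp_class p C f) x = f x"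
    by (simp_all add: lp_class_iff)
qed

lemma lp_fun_closed: "F \<in> carrier (lps p C) \<Longrightarrow> lp_fun F \<in> lpf p C"
  by (auto simp: carrier_Lp_space lp_fun_class)

lemma lp_class_fun: "F \<in> carrier (lps p C) \<Longrightarrow> lp_class p C (lp_fun F) = F"
proof -
  assume "F \<in> carrier (lps p C)"
  then obtain f where f: "f \<in> lpf p C" "F = lp_class p C f" by (auto simp: carrier_Lp_space)
  show ?thesis unfolding f(2) by (rule lp_class_eqI) (use lp_fun_class[OF f(1)] f in auto)
qed

lemma lp_class_add:
  assumes "1 \<le> p" "f \<in> lpf p C" "g \<in> lpf p C"
  shows "lp_class p C f \<oplus>\<^bsub>lps p C\<^esub> lp_class p C g = lp_class p C (\<lambda>x. f x + g x)"
proof -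
  have "ae_eq_rel p (count_space C) `` {\<lambda>x. f' x + g' x} = lp_class p C (\<lambda>x. f x + g x)"
    if "f' \<in> lp_class p C f" "g' \<in> lp_class p C g" for f' g'
    unfolding lp_class_def[symmetric]
    by (rule lp_class_eqI) (use that assms in \<open>auto simp: lp_class_iff intro: lp_sum_add\<close>)
  moreover have "f \<in> lp_class p C f" "g \<in> lp_class p C g" using assms by (auto simp: lp_class_iff)
  ultimately show ?thesis unfolding Lp_space_def by auto
qed

lemma lp_class_smult:
  assumes "1 \<le> p" "f \<in> lpf p C"
  shows "c \<odot>\<^bsub>lps p C\<^esub> lp_class p C f = lp_class p C (\<lambda>x. c * f x)"
proof -
  have "ae_eq_rel p (count_space C) `` {\<lambda>x. c * f' x} = lp_class p C (\<lambda>x. c * f x)"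
    if "f' \<in> lp_class p C f" for f'
    unfolding lp_class_def[symmetric]
    by (rule lp_class_eqI) (use that assms in \<open>auto simp: lp_class_iff intro: lp_sum_cmult\<close>)
  moreover have "f \<in> lp_class p C f" using assms by (auto simp: lp_class_iff)
  ultimately show ?thesis unfolding Lp_space_def by auto
qed

lemma lp_zero_closed: "(\<lambda>x. 0) \<in> lpf p C"
  by (simp add: Lp_functions_count_space)

lemma lp_class_zero: "\<zero>\<^bsub>lps p C\<^esub> = lp_class p C (\<lambda>x. 0)"
  by (simp add: Lp_space_def lp_class_def)

lemma nrm_Lp_space: "nrm (lps p C) F = lp_norm p C (lp_fun F)"
  by (simp add: Lp_space_def lp_norm_def lp_sum_def lp_fun_def)

lemma nrm_lp_class: "f \<in> lpf p C \<Longrightarrow> nrm (lps p C) (lp_class p C f) = lp_norm p C f"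
  unfolding nrm_Lp_space by (rule lp_norm_cong) (rule lp_fun_class)

lemma complex_normed_space_Lp:
  assumes p: "1 \<le> p"
  shows "complex_normed_space (lps p C)"
proof (rule complex_normed_spaceI)
  note [simp] = lp_class_add[OF p] lp_class_smult[OF p] lp_class_zero lp_zero_closed
    lp_sum_add(1)[OF p] lp_sum_cmult(1)[OF p] nrm_lp_class
  show "\<zero>\<^bsub>lps p C\<^esub> \<in> carrier (lps p C)" by simp
  fix F assume "F \<in> carrier (lps p C)"
  then obtain f where f: "f \<in> lpf p C" "F = lp_class p C f" by (auto simp: carrier_Lp_space)
  show "\<zero>\<^bsub>lps p C\<^esub> \<oplus>\<^bsub>lps p C\<^esub> F = F" "1 \<odot>\<^bsub>lps p C\<^esub> F = F"
    "(-1) \<odot>\<^bsub>lps p C\<^esub> F \<oplus>\<^bsub>lps p C\<^esub> F = \<zero>\<^bsub>lps p C\<^esub>"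
    using f lp_sum_cmult(1)[OF p f(1), of "-1"] by (simp_all)
  show "c \<odot>\<^bsub>lps p C\<^esub> F \<in> carrier (lps p C)" for c
    using f by simp
  show "(a + b) \<odot>\<^bsub>lps p C\<^esub> F = a \<odot>\<^bsub>lps p C\<^esub> F \<oplus>\<^bsub>lps p C\<^esub> b \<odot>\<^bsub>lps p C\<^esub> F" for a b
    using f by (simp add: distrib_right)
  show "(a * b) \<odot>\<^bsub>lps p C\<^esub> F = a \<odot>\<^bsub>lps p C\<^esub> (b \<odot>\<^bsub>lps p C\<^esub> F)" for a b
    using f by (simp add: mult.assoc)
  show "nrm (lps p C) F = 0 \<longleftrightarrow> F = \<zero>\<^bsub>lps p C\<^esub>"
    using f by (simp add: lp_norm_eq_0_iff[OF p] lp_class_eq_iff)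
  show "nrm (lps p C) (c \<odot>\<^bsub>lps p C\<^esub> F) = cmod c * nrm (lps p C) F" for c
    using f by (simp add: lp_norm_cmult[OF p])
  fix G assume "G \<in> carrier (lps p C)"
  then obtain g where g: "g \<in> lpf p C" "G = lp_class p C g" by (auto simp: carrier_Lp_space)
  show "F \<oplus>\<^bsub>lps p C\<^esub> G \<in> carrier (lps p C)" "F \<oplus>\<^bsub>lps p C\<^esub> G = G \<oplus>\<^bsub>lps p C\<^esub> F"
    using f g by (simp_all add: add.commute)
  show "a \<odot>\<^bsub>lps p C\<^esub> (F \<oplus>\<^bsub>lps p C\<^esub> G) = a \<odot>\<^bsub>lps p C\<^esub> F \<oplus>\<^bsub>lps p C\<^esub> a \<odot>\<^bsub>lps p C\<^esub> G" for a
    using f g by (simp add: distrib_left)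
  show "nrm (lps p C) (F \<oplus>\<^bsub>lps p C\<^esub> G) \<le> nrm (lps p C) F + nrm (lps p C) G"
    using f g by (simp add: lp_norm_triangle[OF p])
  fix H assume "H \<in> carrier (lps p C)"
  then obtain h where h: "h \<in> lpf p C" "H = lp_class p C h" by (auto simp: carrier_Lp_space)
  show "(F \<oplus>\<^bsub>lps p C\<^esub> G) \<oplus>\<^bsub>lps p C\<^esub> H = F \<oplus>\<^bsub>lps p C\<^esub> (G \<oplus>\<^bsub>lps p C\<^esub> H)"
    using f g h by (simp add: add.assoc)
qed

lemma lp_class_minus:
  assumes p: "1 \<le> p" and f: "f \<in> lpf p C" and g: "g \<in> lpf p C"
  shows "lp_class p C f \<ominus>\<^bsub>lps p C\<^esub> lp_class p C g = lp_class p C (\<lambda>x. f x - g x)"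
    and "(\<lambda>x. f x - g x) \<in> lpf p C"
proof -
  interpret complex_normed_space "lps p C" by (rule complex_normed_space_Lp[OF p])
  have g': "(\<lambda>x. -1 * g x) \<in> lpf p C" by (rule lp_sum_cmult(1)[OF p g])
  show "lp_class p C f \<ominus>\<^bsub>lps p C\<^esub> lp_class p C g = lp_class p C (\<lambda>x. f x - g x)"
    using f g g' lp_class_add[OF p f g'] by (simp add: minus_csmult lp_class_smult[OF p])
  show "(\<lambda>x. f x - g x) \<in> lpf p C" using lp_sum_add(1)[OF p f g'] by simp
qed

text \<open>A Cauchy sequence converges pointwise, and the bounds on finite sums pass to the limit.\<close>

lemma complex_banach_space_Lp:
  assumes p: "1 \<le> p"
  shows "complex_banach_space (lps p C)"
proof -
  interpret complex_normed_space "lps p C" by (rule complex_normed_space_Lp[OF p])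
  have "Metric_space.mcomplete (carrier (lps p C)) (ndist (lps p C))"
    unfolding mcomplete_ndist_iff
  proof (intro allI impI)
    fix s :: "nat \<Rightarrow> ('a \<Rightarrow> complex) set"
    assume s: "\<forall>n. s n \<in> carrier (lps p C)"
      and cauchy: "\<forall>\<epsilon>>0. \<exists>N. \<forall>m\<ge>N. \<forall>n\<ge>N. nrm (lps p C) (s m \<ominus>\<^bsub>lps p C\<^esub> s n) < \<epsilon>"
    define f where "f n = lp_fun (s n)" for n
    have f: "f n \<in> lpf p C" "s n = lp_class p C (f n)" for n
      using s by (simp_all add: f_def lp_fun_closed lp_class_fun)
    have diff: "nrm (lps p C) (s m \<ominus>\<^bsub>lps p C\<^esub> s n) = lp_norm p C (\<lambda>x. f m x - f n x)" for m n
      using lp_class_minus[OF p f(1)[of m] f(1)[of n]] by (simp add: f(2) nrm_lp_class)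
    have cau: "\<exists>N. \<forall>m\<ge>N. \<forall>n\<ge>N. lp_norm p C (\<lambda>x. f m x - f n x) < \<epsilon>" if "0 < \<epsilon>" for \<epsilon>
      using cauchy that unfolding diff by simp
    have "convergent (\<lambda>n. f n x)" if x: "x \<in> C" for x
    proof (rule Cauchy_convergent, rule metric_CauchyI)
      fix e :: real assume "0 < e"
      then obtain N where N: "\<forall>m\<ge>N. \<forall>n\<ge>N. lp_norm p C (\<lambda>x. f m x - f n x) < e" using cau by blast
      have "dist (f m x) (f n x) < e" if "m \<ge> N" "n \<ge> N" for m n
        using cmod_le_lp_norm[OF p lp_class_minus(2)[OF p f(1)[of m] f(1)[of n]] x] N that
        by (fastforce simp: dist_norm)
      then show "\<exists>M. \<forall>m\<ge>M. \<forall>n\<ge>M. dist (f m x) (f n x) < e" by blast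
    qed
    then have lim: "(\<lambda>n. f n x) \<longlonglongrightarrow> lim (\<lambda>n. f n x)" if "x \<in> C" for x
      using that by (simp add: convergent_LIMSEQ_iff)
    define g where "g x = lim (\<lambda>n. f n x)" for x
    have est: "(\<Sum>x\<in>F. cmod (f n x - g x) powr p) \<le> \<epsilon> powr p"
      if F: "finite F" "F \<subseteq> C" and e: "0 < \<epsilon>"
        and N: "\<forall>m\<ge>N. \<forall>n\<ge>N. lp_norm p C (\<lambda>x. f m x - f n x) < \<epsilon>" and n: "n \<ge> N" for F \<epsilon> N n
    proof (rule LIMSEQ_le_const2)
      show "(\<lambda>m. \<Sum>x\<in>F. cmod (f n x - f m x) powr p) \<longlonglongrightarrow> (\<Sum>x\<in>F. cmod (f n x - g x) powr p)"
        using F lim p unfolding g_def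
        by (intro tendsto_sum tendsto_powr' tendsto_norm tendsto_diff tendsto_const) auto
      have "(\<Sum>x\<in>F. cmod (f n x - f m x) powr p) \<le> \<epsilon> powr p" if "m \<ge> N" for m
      proof -
        have "(\<Sum>x\<in>F. cmod (f n x - f m x) powr p) \<le> lp_sum p C (\<lambda>x. f n x - f m x)"
          by (rule sum_le_lp_sum[OF lp_class_minus(2)[OF p f(1) f(1)] F])
        also have "\<dots> \<le> \<epsilon> powr p"
          using N that n e p by (subst lp_norm_le_iff[symmetric]) (auto simp: less_imp_le)
        finally show ?thesis .
      qed
      then show "\<exists>N. \<forall>m\<ge>N. (\<Sum>x\<in>F. cmod (f n x - f m x) powr p) \<le> \<epsilon> powr p" by blast
    qed
    have g: "g \<in> lpf p C"
    proof -
      obtain N where N: "\<forall>m\<ge>N. \<forall>n\<ge>N. lp_norm p C (\<lambda>x. f m x - f n x) < 1" using cau[of 1] by auto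
      have "(\<lambda>x. f N x - g x) \<in> lpf p C"
        by (rule Lp_functionsI[where K = "1 powr p"]) (use est[OF _ _ _ N] in auto)
      then have "(\<lambda>x. f N x - (f N x - g x)) \<in> lpf p C" by (rule lp_class_minus(2)[OF p f(1)])
      then show ?thesis by simp
    qed
    show "\<exists>G\<in>carrier (lps p C). \<forall>\<epsilon>>0. \<exists>N. \<forall>n\<ge>N. nrm (lps p C) (s n \<ominus>\<^bsub>lps p C\<^esub> G) < \<epsilon>"
    proof (intro bexI[of _ "lp_class p C g"] allI impI)
      fix e :: real assume e: "0 < e"
      then obtain N where N: "\<forall>m\<ge>N. \<forall>n\<ge>N. lp_norm p C (\<lambda>x. f m x - f n x) < e/2" using cau[of "e/2"] by auto
      have "nrm (lps p C) (s n \<ominus>\<^bsub>lps p C\<^esub> lp_class p C g) < e" if n: "n \<ge> N" for n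
      proof -
        have "lp_norm p C (\<lambda>x. f n x - g x) \<le> e/2"
          by (rule lp_norm_le[OF p]) (use e est[OF _ _ _ N n] in auto)
        then show ?thesis
          using e lp_class_minus[OF p f(1)[of n] g] by (simp add: f(2)[of n] nrm_lp_class)
      qed
      then show "\<exists>N. \<forall>n\<ge>N. nrm (lps p C) (s n \<ominus>\<^bsub>lps p C\<^esub> lp_class p C g) < e" by blast
    qed (use g in simp)
  qed
  then show ?thesis
    by (intro complex_banach_space.intro complex_banach_space_axioms.intro complex_normed_space_Lp[OF p])
qed

text \<open>Finitely supported families are dense: a finite set that carries almost all of the sum
  leaves a small tail.\<close>

lemma lp_finite_support_dense:
  assumes p: "1 \<le> p" and f: "f \<in> lpf p C" and e: "0 < e"
  shows "\<exists>F. finite F \<and> F \<subseteq> C \<and> lp_norm p C (\<lambda>x. f x - (if x \<in> F then f x else 0)) < e"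
proof -
  define h where "h = (\<lambda>x. cmod (f x) powr p)"
  have i: "integrable (count_space C) h" using f by (simp add: Lp_functions_count_space h_def)
  then have su: "h summable_on C"
    by (simp add: integrable_count_space_iff_summable_on h_def)
  have "(sum h \<longlongrightarrow> infsum h C) (finite_subsets_at_top C)"
    using has_sum_infsum[OF su] by (simp add: has_sum_def)
  then have "eventually (\<lambda>F. dist (sum h F) (infsum h C) < (e/2) powr p) (finite_subsets_at_top C)"
    by (rule tendstoD) (use e in auto)
  then obtain F where F: "finite F" "F \<subseteq> C" "dist (sum h F) (infsum h C) < (e/2) powr p"
    unfolding eventually_finite_subsets_at_top by blast
  have "lp_norm p C (\<lambda>x. f x - (if x \<in> F then f x else 0)) \<le> e/2"
  proof (rule lp_norm_le[OF p])
    fix G assume G: "finite G" "G \<subseteq> C"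
    have "(\<Sum>x\<in>G. cmod (f x - (if x \<in> F then f x else 0)) powr p) = sum h (G - F)"
      using G(1) by (intro sum.mono_neutral_cong_right) (auto simp: h_def)
    also have "\<dots> = sum h (G \<union> F) - sum h F"
      using G F sum.union_disjoint[of "G - F" F h, OF _ _ Diff_disjoint[THEN trans[OF Int_commute]]] by simp
    also have "\<dots> \<le> infsum h C - sum h F"
      using G F su finite_sum_le_infsum[of h C "G \<union> F"] by (simp add: h_def)
    also have "\<dots> \<le> (e/2) powr p" using F(3) by (simp add: dist_real_def)
    finally show "(\<Sum>x\<in>G. cmod (f x - (if x \<in> F then f x else 0)) powr p) \<le> (e/2) powr p" .
  qed (use e in auto)
  then show ?thesis using F e by (intro exI[of _ F]) auto
qed

lemma lp_finite_support:
  assumes "finite F" "\<And>x. x \<notin> F \<Longrightarrow> f x = 0"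
  shows "f \<in> lpf p C"
proof (rule Lp_functionsI)
  fix G assume G: "finite G" "G \<subseteq> C"
  have "(\<Sum>x\<in>G. cmod (f x) powr p) = (\<Sum>x\<in>G \<inter> F. cmod (f x) powr p)"
    using G assms by (intro sum.mono_neutral_cong_right) auto
  also have "\<dots> \<le> (\<Sum>x\<in>F. cmod (f x) powr p)"
    using assms by (intro sum_mono2) auto
  finally show "(\<Sum>x\<in>G. cmod (f x) powr p) \<le> (\<Sum>x\<in>F. cmod (f x) powr p)" .
qed

section \<open>Hermitian idempotents on finite dimensional \<open>l\<^sup>p\<close> are diagonal\<close>

definition mv :: "'i set \<Rightarrow> ('i \<Rightarrow> 'i \<Rightarrow> complex) \<Rightarrow> ('i \<Rightarrow> complex) \<Rightarrow> 'i \<Rightarrow> complex" where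
  "mv I a f i = (\<Sum>j\<in>I. a i j * f j)"

lemma mv_cong: "(\<And>j. j \<in> I \<Longrightarrow> f j = g j) \<Longrightarrow> mv I a f i = mv I a g i"
  unfolding mv_def by (rule sum.cong) auto

lemma mv_mv: "mv I a (mv I b f) i = mv I (\<lambda>i j. \<Sum>k\<in>I. a i k * b k j) f i"
  unfolding mv_def
  by (subst sum_distrib_left, subst sum.swap) (simp add: sum_distrib_right mult.assoc)

lemma mv_diag:
  assumes "finite I" "i \<in> I" "\<And>j. j \<in> I \<Longrightarrow> j \<noteq> i \<Longrightarrow> a i j = 0"
  shows "mv I a f i = a i i * f i"
proof -
  have "mv I a f i = (\<Sum>j\<in>{i}. a i j * f j)"
    unfolding mv_def by (rule sum.mono_neutral_right) (use assms in auto)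
  then show ?thesis by simp
qed

text \<open>The function is the power \<open>p/2\<close> of a sum of two squares, which is smooth where it is positive.\<close>

lemma has_real_derivative_cmod_rotation:
  fixes x y :: complex and p :: real
  assumes x: "x \<noteq> 0"
  shows "((\<lambda>l. cmod (x + (cis l - 1) * y) powr p) has_real_derivative
    - p * cmod x powr (p - 2) * Im (cnj x * y)) (at 0)"
proof -
  define q where "q l = (Re x + ((cos l - 1) * Re y - sin l * Im y))\<^sup>2 +
    (Im x + ((cos l - 1) * Im y + sin l * Re y))\<^sup>2" for l :: real
  have eq: "cmod (x + (cis l - 1) * y) powr p = q l powr (p/2)" for l
    unfolding q_def by (simp add: cmod_def powr_half_sqrt[symmetric] powr_powr)
  have q0: "q 0 = (cmod x)\<^sup>2" by (simp add: q_def cmod_power2)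
  have pos: "0 < q 0" using x by (simp add: q0)
  have "(q has_real_derivative 2 * (Re x * (- Im y) + Im x * Re y)) (at 0)"
    unfolding q_def by (auto intro!: derivative_eq_intros)
  from DERIV_fun_powr[OF this pos, of "p/2"]
  have "((\<lambda>l. q l powr (p/2)) has_real_derivative
      (p/2) * q 0 powr (p/2 - 1) * (2 * (Re x * (- Im y) + Im x * Re y))) (at 0)"
    by simp
  moreover have "q 0 powr (p/2 - 1) = cmod x powr (p - 2)"
  proof -
    have "q 0 = cmod x powr 2" using x by (simp add: q0)
    then have "q 0 powr (p/2 - 1) = (cmod x powr 2) powr (p/2 - 1)" by (simp only:)
    also have "\<dots> = cmod x powr (2 * (p/2 - 1))" by (rule powr_powr)
    also have "2 * (p/2 - 1) = p - 2" by simp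
    finally show ?thesis .
  qed
  ultimately show ?thesis unfolding eq by (simp add: algebra_simps)
qed

text \<open>The curve \<open>x + (e\<^sup>i\<^sup>l - 1)y\<close> stays in the ball of radius \<open>\<parallel>x\<parallel>\<close>.  Only the
  coordinates in the support of \<open>x\<close> are differentiated: the others contribute nonnegative terms that
  vanish at \<open>0\<close>, so that the sum over the support is still maximal there.\<close>

lemma rotation_pairing_real:
  fixes x :: "'i \<Rightarrow> complex"
  assumes fin: "finite I" and p: "1 \<le> p"
    and contr: "\<And>l::real. lp_sum p I (\<lambda>i. x i + (cis l - 1) * y i) \<le> lp_sum p I x"
  shows "(\<Sum>i\<in>{i\<in>I. x i \<noteq> 0}. cmod (x i) powr (p - 2) * Im (cnj (x i) * y i)) = 0"
proof -
  define J where "J = {i\<in>I. x i \<noteq> 0}"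
  have J: "finite J" "J \<subseteq> I" using fin by (auto simp: J_def)
  define g where "g l = (\<Sum>i\<in>J. cmod (x i + (cis l - 1) * y i) powr p)" for l
  have "(g has_real_derivative (\<Sum>i\<in>J. - p * cmod (x i) powr (p - 2) * Im (cnj (x i) * y i))) (at 0)"
    unfolding g_def by (intro DERIV_sum has_real_derivative_cmod_rotation) (auto simp: J_def)
  moreover have "g l \<le> g 0" for l
  proof -
    have "g l \<le> lp_sum p I (\<lambda>i. x i + (cis l - 1) * y i)"
      unfolding g_def lp_sum_finite[OF fin] using J fin by (intro sum_mono2) auto
    also have "\<dots> \<le> lp_sum p I x" by (rule contr)
    also have "\<dots> = g 0"
      unfolding g_def lp_sum_finite[OF fin] using J fin
      by (intro sum.mono_neutral_cong_right) (auto simp: J_def)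
    finally show ?thesis .
  qed
  ultimately have "(\<Sum>i\<in>J. - p * cmod (x i) powr (p - 2) * Im (cnj (x i) * y i)) = 0"
    by (intro DERIV_local_max[of g _ 0 1]) auto
  then have "- p * (\<Sum>i\<in>J. cmod (x i) powr (p - 2) * Im (cnj (x i) * y i)) = 0"
    by (simp add: sum_distrib_left mult.assoc)
  then show ?thesis using p by (simp add: J_def)
qed

text \<open>Testing with \<open>\<delta>\<^sub>j + c\<delta>\<^sub>k\<close> gives a relation between the entries \<open>e j k\<close> and \<open>e k j\<close> that is
  homogeneous of degree \<open>1\<close> in \<open>\<bar>c\<bar>\<close> in the first and of degree \<open>p - 1\<close> in the second; this forces
  both to vanish unless \<open>p = 2\<close>.\<close>

lemma rotations_contractive_imp_diagonal:
  assumes fin: "finite I" and p: "1 \<le> p" "p \<noteq> 2"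
    and contr: "\<And>(l::real) f. lp_sum p I (\<lambda>i. f i + (cis l - 1) * mv I e f i) \<le> lp_sum p I f"
    and jk: "j \<in> I" "k \<in> I" "j \<noteq> k"
  shows "e j k = 0"
proof -
  have real: "Im (e i i) = 0" if i: "i \<in> I" for i
  proof -
    define x where "x r = (if r = i then 1 else 0 :: complex)" for r
    have "{r\<in>I. x r \<noteq> 0} = {i}" using i by (auto simp: x_def)
    moreover have "mv I e x i = e i i"
      using i fin by (simp add: mv_def x_def if_distrib cong: if_cong)
    ultimately show ?thesis
      using rotation_pairing_real[OF fin p(1) contr[of x]] by (simp add: x_def)
  qed
  have rel: "Im (c * e j k) + cmod c powr (p - 2) * Im (cnj c * e k j) = 0" if c: "c \<noteq> 0" for c
  proof -
    define x where "x r = (if r = j then 1 else if r = k then c else 0)" for r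
    have J: "{r\<in>I. x r \<noteq> 0} = {j, k}" using jk c by (auto simp: x_def)
    have mv: "mv I e x i = e i j + e i k * c" for i
    proof -
      have "mv I e x i = (\<Sum>r\<in>{j, k}. e i r * x r)"
        unfolding mv_def by (rule sum.mono_neutral_right) (use fin jk in \<open>auto simp: x_def\<close>)
      then show ?thesis using jk by (simp add: x_def)
    qed
    have "Im (e j j + e j k * c) + cmod c powr (p - 2) * Im (cnj c * (e k j + e k k * c)) = 0"
      using rotation_pairing_real[OF fin p(1) contr[of x]] jk unfolding J by (simp add: mv x_def)
    moreover have "Im (cnj c * (e k j + e k k * c)) = Im (cnj c * e k j)"
    proof -
      have "cnj c * (e k k * c) = complex_of_real ((cmod c)\<^sup>2) * e k k"
        by (simp only: complex_norm_square mult_ac)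
      then have "Im (cnj c * (e k k * c)) = 0"
        using real[OF jk(2)] by simp
      then show ?thesis by (simp add: distrib_left)
    qed
    ultimately show ?thesis using real[OF jk(1)] by (simp add: mult.commute)
  qed
  have "Im (w * e j k) = 0" if w: "cmod w = 1" for w
  proof -
    have w0: "w \<noteq> 0" using w by auto
    \<comment> \<open>the relation at the moduli \<open>1\<close> and \<open>2\<close>\<close>
    have 1: "Im (w * e j k) + Im (cnj w * e k j) = 0" using rel[OF w0] w by simp
    define a where "a = Im (w * e j k)"
    define b where "b = Im (cnj w * e k j)"
    define r :: real where "r = 2 powr (p - 2)"
    have "Im (2 * w * e j k) + 2 powr (p - 2) * Im (2 * cnj w * e k j) = 0"
      using rel[of "2 * w"] w0 w by (simp add: norm_mult)
    moreover have "Im (2 * w * e j k) = 2 * a" "Im (2 * cnj w * e k j) = 2 * b"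
      by (simp_all add: mult.assoc a_def b_def)
    ultimately have "2 * a + r * (2 * b) = 0" by (simp only: r_def)
    moreover have "b = - a" using 1 by (simp add: a_def b_def)
    ultimately have "a * (1 - r) = 0" by (simp add: algebra_simps)
    moreover have "2 powr (p - 2) \<noteq> 1" using p powr_inj[of 2 "p - 2" 0] by simp
    ultimately show ?thesis by (simp add: a_def r_def)
  qed
  from this[of 1] this[of \<i>] show ?thesis by (simp add: complex_eq_iff)
qed

text \<open>The rotations of a matrix supported on \<open>S \<times> S\<close> fix the coordinates outside of \<open>S\<close>, and the
  \<open>p\<close>-th powers of the norms of the two parts add up.\<close>

lemma corner_rotations_contractive_imp_diagonal:
  assumes fin: "finite I" and p: "1 \<le> p" "p \<noteq> 2" and S: "S \<subseteq> I"
    and supp: "\<And>i j. i \<in> I \<Longrightarrow> j \<in> I \<Longrightarrow> e i j \<noteq> 0 \<Longrightarrow> i \<in> S \<and> j \<in> S"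
    and contr: "\<And>(l::real) f. lp_sum p S (\<lambda>i. f i + (cis l - 1) * mv I e f i) \<le> lp_sum p I f"
    and jk: "j \<in> I" "k \<in> I" "j \<noteq> k"
  shows "e j k = 0"
proof (rule rotations_contractive_imp_diagonal[OF fin p _ jk])
  fix l :: real and f :: "_ \<Rightarrow> complex"
  have finS: "finite S" using fin S finite_subset by blast
  define g where "g i = (if i \<in> S then f i else 0)" for i
  have mvg: "mv I e g i = mv I e f i" if "i \<in> I" for i
    unfolding mv_def using supp[OF that] by (intro sum.cong) (auto simp: g_def)
  have mv0: "mv I e f i = 0" if "i \<in> I - S" for i
    unfolding mv_def using supp[of i] that by (intro sum.neutral) auto
  have "lp_sum p I (\<lambda>i. f i + (cis l - 1) * mv I e f i) =
      lp_sum p S (\<lambda>i. f i + (cis l - 1) * mv I e f i) + (\<Sum>i\<in>I - S. cmod (f i) powr p)"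
    unfolding lp_sum_finite[OF fin] lp_sum_finite[OF finS]
    using sum.subset_diff[OF S fin, of "\<lambda>i. cmod (f i + (cis l - 1) * mv I e f i) powr p"] mv0 by simp
  also have "lp_sum p S (\<lambda>i. f i + (cis l - 1) * mv I e f i) = lp_sum p S (\<lambda>i. g i + (cis l - 1) * mv I e g i)"
    by (rule lp_sum_cong) (use mvg S in \<open>auto simp: g_def\<close>)
  also have "\<dots> \<le> lp_sum p I g" by (rule contr)
  also have "lp_sum p I g = (\<Sum>i\<in>S. cmod (f i) powr p)"
    unfolding lp_sum_finite[OF fin] using S fin
    by (intro sum.mono_neutral_cong_right) (auto simp: g_def)
  also have "(\<Sum>i\<in>S. cmod (f i) powr p) + (\<Sum>i\<in>I - S. cmod (f i) powr p) = lp_sum p I f"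
    unfolding lp_sum_finite[OF fin] using sum.subset_diff[OF S fin, of "\<lambda>i. cmod (f i) powr p"] by simp
  finally show "lp_sum p I (\<lambda>i. f i + (cis l - 1) * mv I e f i) \<le> lp_sum p I f" by simp
qed

lemma contraction_entry_le_1:
  assumes fin: "finite I" and p: "1 \<le> p" and contr: "\<And>f. lp_sum p I (mv I a f) \<le> lp_sum p I f"
    and ij: "i \<in> I" "j \<in> I"
  shows "cmod (a i j) \<le> 1"
proof -
  define x where "x r = (if r = j then 1 else 0 :: complex)" for r
  have "mv I a x i = a i j" using ij fin by (simp add: mv_def x_def if_distrib cong: if_cong)
  then have "cmod (a i j) powr p \<le> lp_sum p I (mv I a x)"
    unfolding lp_sum_finite[OF fin]
    using member_le_sum[of i I "\<lambda>i. cmod (mv I a x i) powr p"] ij fin by simp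
  also have "\<dots> \<le> lp_sum p I x" by (rule contr)
  also have "\<dots> = (\<Sum>r\<in>{j}. cmod (x r) powr p)"
    unfolding lp_sum_finite[OF fin] using ij fin p by (intro sum.mono_neutral_right) (auto simp: x_def)
  also have "\<dots> = 1 powr p" by (simp add: x_def)
  finally show ?thesis using p by - (rule powr_p_le_cancel[of p], simp_all)
qed

text \<open>If the product \<open>vw\<close> of two contractions is the projection onto the coordinates \<open>S\<close>, then
  \<open>v e\<^sub>y\<^sub>y w\<close> is a hermitian idempotent of rank one in the corner of \<open>S\<close>, so it is a diagonal matrix
  unit; hence row \<open>y\<close> of \<open>w\<close> has a single nonzero entry.\<close>

lemma partial_isometry_row:
  fixes v w :: "'i \<Rightarrow> 'i \<Rightarrow> complex"
  assumes fin: "finite I" and p: "1 \<le> p" "p \<noteq> 2" and S: "S \<subseteq> I"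
    and v: "\<And>f. lp_sum p I (mv I v f) \<le> lp_sum p I f"
    and w: "\<And>f. lp_sum p I (mv I w f) \<le> lp_sum p I f"
    and vw: "\<And>i j. i \<in> I \<Longrightarrow> j \<in> I \<Longrightarrow> (\<Sum>k\<in>I. v i k * w k j) = (if i = j \<and> i \<in> S then 1 else 0)"
    and vS: "\<And>i k. i \<in> I \<Longrightarrow> k \<in> I \<Longrightarrow> i \<notin> S \<Longrightarrow> v i k = 0"
    and wS: "\<And>i k. i \<in> I \<Longrightarrow> k \<in> I \<Longrightarrow> i \<notin> S \<Longrightarrow> w k i = 0"
    and y: "y \<in> I" "(\<Sum>k\<in>I. w y k * v k y) = 1"
  shows "\<exists>z\<in>S. cmod (w y z) = 1 \<and> (\<forall>k\<in>I. k \<noteq> z \<longrightarrow> w y k = 0)"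
proof -
  define e where "e i j = v i y * w y j" for i j
  have finS: "finite S" using fin S finite_subset by blast
  have diag: "e j k = 0" if jk: "j \<in> I" "k \<in> I" "j \<noteq> k" for j k
  proof (rule corner_rotations_contractive_imp_diagonal[OF fin p S _ _ jk])
    show "i \<in> S \<and> j \<in> S" if "i \<in> I" "j \<in> I" "e i j \<noteq> 0" for i j
      using that vS[of i y] wS[of j y] y by (auto simp: e_def)
    fix l :: real and f :: "_ \<Rightarrow> complex"
    define g where "g = mv I w f"
    \<comment> \<open>a diagonal isometry applied to \<open>w f\<close>: on \<open>S\<close>, \<open>v u\<close> is the rotation of \<open>f\<close>\<close>
    define u where "u i = (if i = y then cis l * g i else g i)" for i
    have mve: "mv I e f i = v i y * g y" for i
      unfolding mv_def g_def e_def by (simp add: sum_distrib_left mult.assoc)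
    have vu: "mv I v u i = f i + (cis l - 1) * mv I e f i" if i: "i \<in> S" for i
    proof -
      have iI: "i \<in> I" using i S by blast
      have "mv I v u i = (\<Sum>k\<in>I. v i k * g k + (if k = y then (cis l - 1) * (v i y * g y) else 0))"
        unfolding mv_def by (rule sum.cong) (auto simp: u_def algebra_simps)
      also have "\<dots> = mv I v g i + (cis l - 1) * mv I e f i"
        using fin y by (simp add: sum.distrib mv_def[of I v] mve)
      also have "mv I v g i = mv I (\<lambda>i j. \<Sum>k\<in>I. v i k * w k j) f i"
        unfolding g_def by (rule mv_mv)
      also have "\<dots> = f i"
        using vw[OF iI] i iI fin by (subst mv_diag) auto
      finally show ?thesis .
    qed
    have "lp_sum p S (\<lambda>i. f i + (cis l - 1) * mv I e f i) = lp_sum p S (mv I v u)"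
      by (rule lp_sum_cong) (simp add: vu)
    also have "\<dots> \<le> lp_sum p I (mv I v u)"
      unfolding lp_sum_finite[OF fin] lp_sum_finite[OF finS] using S fin by (intro sum_mono2) auto
    also have "\<dots> \<le> lp_sum p I u" by (rule v)
    also have "\<dots> = lp_sum p I g"
      unfolding lp_sum_finite[OF fin] by (rule sum.cong) (auto simp: u_def norm_mult)
    also have "\<dots> \<le> lp_sum p I f" unfolding g_def by (rule w)
    finally show "lp_sum p S (\<lambda>i. f i + (cis l - 1) * mv I e f i) \<le> lp_sum p I f" .
  qed
  obtain z where z: "z \<in> I" "w y z * v z y \<noteq> 0"
    using y(2) sum.neutral[of I "\<lambda>k. w y k * v k y"] by fastforce
  have zero: "w y k = 0" if "k \<in> I" "k \<noteq> z" for k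
    using diag[of z k] that z by (auto simp: e_def)
  have "(\<Sum>k\<in>I. w y k * v k y) = (\<Sum>k\<in>{z}. w y k * v k y)"
    by (rule sum.mono_neutral_right) (use fin z zero in auto)
  then have "cmod (w y z) * cmod (v z y) = 1" using y(2) by (simp add: norm_mult[symmetric])
  moreover have "cmod (w y z) \<le> 1" "cmod (v z y) \<le> 1"
    using contraction_entry_le_1[OF fin p(1)] v w y z by blast+
  ultimately have "cmod (w y z) = 1"
    using mult_left_le[of "cmod (v z y)" "cmod (w y z)"] by simp
  moreover have "z \<in> S" using wS[of z y] z y by auto
  ultimately show ?thesis using zero by blast
qed

section \<open>Coordinates on spatial semisimple finite dimensional algebras\<close>

lemma lp_sum_powr_scale:
  assumes "1 \<le> p" "0 \<le> C"
  shows "lp_norm p I g \<le> C * lp_norm p J f \<longleftrightarrow> lp_sum p I g \<le> C powr p * lp_sum p J f"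
  using assms by (simp add: lp_norm_le_iff powr_mult lp_norm_powr)

lemma lp_norm_le_card:
  assumes fin: "finite J" and p: "1 \<le> p" and K: "0 \<le> K" "\<And>i. i \<in> J \<Longrightarrow> cmod (g i) \<le> K"
  shows "lp_norm p J g \<le> real (card J) * K"
proof (cases "J = {}")
  case True
  then show ?thesis by (simp add: lp_norm_def lp_sum_finite)
next
  case False
  then have c: "1 \<le> real (card J)" using fin by (simp add: Suc_leI card_gt_0_iff)
  have "lp_sum p J g \<le> (\<Sum>i\<in>J. K powr p)"
    unfolding lp_sum_finite[OF fin] using K p by (intro sum_mono powr_mono2) auto
  also have "\<dots> = real (card J) powr 1 * K powr p" by simp
  also have "\<dots> \<le> real (card J) powr p * K powr p"
    using c p by (intro mult_right_mono powr_mono) auto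
  also have "\<dots> = (real (card J) * K) powr p" using K by (simp add: powr_mult)
  finally show ?thesis using p K by (simp add: lp_norm_le_iff)
qed

lemma mv_lp_norm_le:
  assumes fin: "finite J" and p: "1 \<le> p"
  shows "lp_norm p J (mv J a f) \<le> real (card J) * (\<Sum>i\<in>J. \<Sum>j\<in>J. cmod (a i j)) * lp_norm p J f"
proof -
  define S where "S = (\<Sum>i\<in>J. \<Sum>j\<in>J. cmod (a i j))"
  have S: "0 \<le> S" by (simp add: S_def sum_nonneg)
  have "lp_norm p J (mv J a f) \<le> real (card J) * (S * lp_norm p J f)"
  proof (rule lp_norm_le_card[OF fin p])
    fix i assume i: "i \<in> J"
    have "cmod (mv J a f i) \<le> (\<Sum>j\<in>J. cmod (a i j) * cmod (f j))"
      unfolding mv_def by (rule order_trans[OF norm_sum]) (simp add: norm_mult)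
    also have "\<dots> \<le> (\<Sum>j\<in>J. cmod (a i j) * lp_norm p J f)"
      by (intro sum_mono mult_left_mono cmod_le_lp_norm p Lp_functions_finite fin) auto
    also have "\<dots> = (\<Sum>j\<in>J. cmod (a i j)) * lp_norm p J f" by (simp add: sum_distrib_right)
    also have "\<dots> \<le> S * lp_norm p J f"
      unfolding S_def using i fin
      by (intro mult_right_mono member_le_sum[of i J "\<lambda>i. \<Sum>j\<in>J. cmod (a i j)"]) (auto simp: sum_nonneg)
    finally show "cmod (mv J a f i) \<le> S * lp_norm p J f" .
  qed (use S in simp)
  then show ?thesis by (simp add: S_def mult.assoc)
qed

definition delta :: "'c \<Rightarrow> 'c \<Rightarrow> complex" where
  "delta j i = (if i = j then 1 else 0)"

lemma mv_delta: "finite J \<Longrightarrow> j \<in> J \<Longrightarrow> mv J a (delta j) i = a i j"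
  by (simp add: mv_def delta_def if_distrib cong: if_cong)

definition coef :: "real \<Rightarrow> 'c set \<Rightarrow> (('c \<Rightarrow> complex) set \<Rightarrow> ('c \<Rightarrow> complex) set) \<Rightarrow> 'c \<Rightarrow> 'c \<Rightarrow> complex" where
  "coef p J T i j = lp_fun (T (lp_class p J (delta j))) i"

definition mat_op :: "real \<Rightarrow> 'c set \<Rightarrow> ('c \<Rightarrow> 'c \<Rightarrow> complex) \<Rightarrow> ('c \<Rightarrow> complex) set \<Rightarrow> ('c \<Rightarrow> complex) set" where
  "mat_op p J a = (\<lambda>F\<in>carrier (lps p J). lp_class p J (mv J a (lp_fun F)))"

context
  fixes p :: real and J :: "'c set"
  assumes p: "1 \<le> p" and fin: "finite J"
begin

interpretation complex_normed_space "lps p J"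
  by (rule complex_normed_space_Lp[OF p])

lemma all_lpf [simp]: "f \<in> lpf p J"
  by (rule Lp_functions_finite[OF fin])

text \<open>Operators on a finite dimensional space are determined by the images of the coordinate vectors, by
  induction on the set of coordinates in which the argument is supported.\<close>

lemma op_eq_mv:
  assumes T: "T \<in> carrier BO"
  shows "T (lp_class p J f) = lp_class p J (mv J (coef p J T) f)"
proof -
  have "T (lp_class p J (\<lambda>i. if i \<in> K then f i else 0)) =
      lp_class p J (\<lambda>i. \<Sum>j\<in>K. coef p J T i j * f j)" if "K \<subseteq> J" for K
    using finite_subset[OF that fin] that
  proof (induction K)
    case empty
    have "T (0 \<odot>\<^bsub>lps p J\<^esub> lp_class p J (\<lambda>i. 0)) = 0 \<odot>\<^bsub>lps p J\<^esub> T (lp_class p J (\<lambda>i. 0))"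
      using T by (intro bounded_operators_app(3)) auto
    then have "T (\<zero>\<^bsub>lps p J\<^esub>) = \<zero>\<^bsub>lps p J\<^esub>"
      using bounded_operators_app(1)[OF T, of "lp_class p J (\<lambda>i. 0)"] by simp
    then show ?case by (simp add: lp_class_zero)
  next
    case (insert k K)
    have k: "k \<in> J" using insert by auto
    have 1: "lp_class p J (\<lambda>i. if i \<in> insert k K then f i else 0) =
        lp_class p J (\<lambda>i. if i \<in> K then f i else 0) \<oplus>\<^bsub>lps p J\<^esub> f k \<odot>\<^bsub>lps p J\<^esub> lp_class p J (delta k)"
      using insert(2) by (simp add: lp_class_add[OF p] lp_class_smult[OF p])
        (rule lp_class_eqI, auto simp: delta_def)
    have Tk: "T (lp_class p J (delta k)) = lp_class p J (\<lambda>i. coef p J T i k)"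
    proof -
      have "T (lp_class p J (delta k)) = lp_class p J (lp_fun (T (lp_class p J (delta k))))"
        by (rule lp_class_fun[symmetric], rule bounded_operators_app(1)[OF T]) simp
      then show ?thesis by (simp add: coef_def)
    qed
    have "T (lp_class p J (\<lambda>i. if i \<in> insert k K then f i else 0)) =
        T (lp_class p J (\<lambda>i. if i \<in> K then f i else 0)) \<oplus>\<^bsub>lps p J\<^esub> f k \<odot>\<^bsub>lps p J\<^esub> T (lp_class p J (delta k))"
      unfolding 1 using bounded_operators_app(2)[OF T, of _ "f k \<odot>\<^bsub>lps p J\<^esub> lp_class p J (delta k)"]
        bounded_operators_app(3)[OF T, of "lp_class p J (delta k)" "f k"] by simp
    also have "\<dots> = lp_class p J (\<lambda>i. (\<Sum>j\<in>K. coef p J T i j * f j) + f k * coef p J T i k)"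
      using insert by (simp add: Tk lp_class_add[OF p] lp_class_smult[OF p])
    also have "\<dots> = lp_class p J (\<lambda>i. \<Sum>j\<in>insert k K. coef p J T i j * f j)"
      using insert(1,2) by (intro lp_class_eqI) (auto simp: mult.commute add.commute)
    finally show ?case .
  qed
  from this[OF subset_refl]
  have "T (lp_class p J (\<lambda>i. if i \<in> J then f i else 0)) = lp_class p J (mv J (coef p J T) f)"
    by (simp add: mv_def[abs_def])
  moreover have "lp_class p J (\<lambda>i. if i \<in> J then f i else 0) = lp_class p J f"
    by (rule lp_class_eqI) auto
  ultimately show ?thesis by simp
qed

lemma op_nrm_le_iff:
  assumes T: "T \<in> carrier BO" and C: "0 \<le> C"
  shows "nrm BO T \<le> C \<longleftrightarrow> (\<forall>f. lp_norm p J (mv J (coef p J T) f) \<le> C * lp_norm p J f)"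
proof
  assume le: "nrm BO T \<le> C"
  show "\<forall>f. lp_norm p J (mv J (coef p J T) f) \<le> C * lp_norm p J f"
  proof
    fix f
    have "nrm (lps p J) (T (lp_class p J f)) \<le> nrm BO T * nrm (lps p J) (lp_class p J f)"
      by (rule opnorm_bound[OF T]) simp
    also have "\<dots> \<le> C * nrm (lps p J) (lp_class p J f)"
      using le by (intro mult_right_mono) auto
    finally show "lp_norm p J (mv J (coef p J T) f) \<le> C * lp_norm p J f"
      by (simp add: op_eq_mv[OF T] nrm_lp_class)
  qed
next
  assume *: "\<forall>f. lp_norm p J (mv J (coef p J T) f) \<le> C * lp_norm p J f"
  show "nrm BO T \<le> C"
  proof (rule opnorm_le[OF T C])
    fix F assume "F \<in> carrier (lps p J)"
    then obtain f where "F = lp_class p J f" by (auto simp: carrier_Lp_space)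
    then show "nrm (lps p J) (T F) \<le> C * nrm (lps p J) F"
      using * by (simp add: op_eq_mv[OF T] nrm_lp_class)
  qed
qed

lemma coef_unique:
  assumes "T \<in> carrier BO" "T (lp_class p J (delta j)) = lp_class p J g" "i \<in> J"
  shows "coef p J T i j = g i"
  unfolding coef_def assms(2) using assms(3) by (intro lp_fun_class(2)) auto

lemma coef_add:
  assumes S: "S \<in> carrier BO" and T: "T \<in> carrier BO" and ij: "i \<in> J" "j \<in> J"
  shows "coef p J (S \<oplus>\<^bsub>BO\<^esub> T) i j = coef p J S i j + coef p J T i j"
proof (rule coef_unique[OF BO_add_closed[OF S T] _ ij(1)])
  show "(S \<oplus>\<^bsub>BO\<^esub> T) (lp_class p J (delta j)) = lp_class p J (\<lambda>i. coef p J S i j + coef p J T i j)"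
    using ij by (simp add: bounded_operators_simps op_eq_mv[OF S] op_eq_mv[OF T] lp_class_add[OF p])
      (rule lp_class_eqI, auto simp: mv_delta fin)
qed

lemma coef_smult:
  assumes T: "T \<in> carrier BO" and ij: "i \<in> J" "j \<in> J"
  shows "coef p J (c \<odot>\<^bsub>BO\<^esub> T) i j = c * coef p J T i j"
proof (rule coef_unique[OF BO_smult_closed[OF T] _ ij(1)])
  show "(c \<odot>\<^bsub>BO\<^esub> T) (lp_class p J (delta j)) = lp_class p J (\<lambda>i. c * coef p J T i j)"
    using ij by (simp add: bounded_operators_simps op_eq_mv[OF T] lp_class_smult[OF p])
      (rule lp_class_eqI, auto simp: mv_delta fin)
qed

lemma coef_mult:
  assumes S: "S \<in> carrier BO" and T: "T \<in> carrier BO" and ij: "i \<in> J" "j \<in> J"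
  shows "coef p J (S \<otimes>\<^bsub>BO\<^esub> T) i j = (\<Sum>k\<in>J. coef p J S i k * coef p J T k j)"
proof (rule coef_unique[OF BO_mult_closed(1)[OF S T] _ ij(1)])
  show "(S \<otimes>\<^bsub>BO\<^esub> T) (lp_class p J (delta j)) = lp_class p J (\<lambda>i. \<Sum>k\<in>J. coef p J S i k * coef p J T k j)"
    using ij by (simp add: bounded_operators_simps compose_def op_eq_mv[OF S] op_eq_mv[OF T])
      (rule lp_class_eqI, auto simp: mv_delta fin mv_mv)
qed

lemma coef_inj:
  assumes S: "S \<in> carrier BO" and T: "T \<in> carrier BO"
    and eq: "\<And>i j. i \<in> J \<Longrightarrow> j \<in> J \<Longrightarrow> coef p J S i j = coef p J T i j"
  shows "S = T"
proof (rule bounded_operators_eqI[OF S T])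
  fix F assume "F \<in> carrier (lps p J)"
  then obtain f where "F = lp_class p J f" by (auto simp: carrier_Lp_space)
  moreover have "lp_class p J (mv J (coef p J S) f) = lp_class p J (mv J (coef p J T) f)"
    by (rule lp_class_eqI) (auto simp: mv_def eq)
  ultimately show "S F = T F" by (simp add: op_eq_mv[OF S] op_eq_mv[OF T])
qed

lemma mat_op_class: "mat_op p J a (lp_class p J f) = lp_class p J (mv J a f)"
  by (simp add: mat_op_def) (rule lp_class_eqI, auto intro!: mv_cong lp_fun_class(2))

lemma mat_op_closed: "mat_op p J a \<in> carrier BO"
proof (rule bounded_operatorsI[where C = "real (card J) * (\<Sum>i\<in>J. \<Sum>j\<in>J. cmod (a i j))"])
  fix F assume "F \<in> carrier (lps p J)"
  then obtain f where f: "F = lp_class p J f" by (auto simp: carrier_Lp_space)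
  show "mat_op p J a F \<in> carrier (lps p J)" by (simp add: f mat_op_class)
  show "mat_op p J a (c \<odot>\<^bsub>lps p J\<^esub> F) = c \<odot>\<^bsub>lps p J\<^esub> mat_op p J a F" for c
    by (simp add: f mat_op_class lp_class_smult[OF p])
      (rule lp_class_eqI, auto simp: mv_def sum_distrib_left mult_ac)
  show "nrm (lps p J) (mat_op p J a F) \<le> real (card J) * (\<Sum>i\<in>J. \<Sum>j\<in>J. cmod (a i j)) * nrm (lps p J) F"
    using mv_lp_norm_le[OF fin p, of a f] by (simp add: f mat_op_class nrm_lp_class)
  fix G assume "G \<in> carrier (lps p J)"
  then obtain g where g: "G = lp_class p J g" by (auto simp: carrier_Lp_space)
  show "mat_op p J a (F \<oplus>\<^bsub>lps p J\<^esub> G) = mat_op p J a F \<oplus>\<^bsub>lps p J\<^esub> mat_op p J a G"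
    by (simp add: f g mat_op_class lp_class_add[OF p])
      (rule lp_class_eqI, auto simp: mv_def sum.distrib distrib_left)
qed (simp add: mat_op_def)

lemma coef_mat_op:
  assumes ij: "i \<in> J" "j \<in> J"
  shows "coef p J (mat_op p J a) i j = a i j"
proof (rule coef_unique[OF mat_op_closed _ ij(1)])
  show "mat_op p J a (lp_class p J (delta j)) = lp_class p J (\<lambda>i. a i j)"
    unfolding mat_op_class by (rule lp_class_eqI) (auto simp: mv_delta fin ij)
qed

end

text \<open>A unital Banach algebra identified, through \<open>R\<close>, with the algebra of those operators on
  \<open>l\<^sup>p(I)\<close> that respect the partition of \<open>I\<close> into the fibres of \<open>blk\<close>.\<close>

locale block_algebra = unital_banach_algebra A for A :: "('a, 'm) normed_module_scheme" (structure) +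
  fixes p :: real and I :: "'i set" and blk :: "'i \<Rightarrow> nat" and R :: "'a \<Rightarrow> 'i \<Rightarrow> 'i \<Rightarrow> complex"
  assumes p_ge_1: "1 \<le> p" and finite_I: "finite I"
    and R_support: "a \<in> carrier A \<Longrightarrow> R a i j \<noteq> 0 \<Longrightarrow> i \<in> I \<and> j \<in> I \<and> blk i = blk j"
    and R_add: "a \<in> carrier A \<Longrightarrow> b \<in> carrier A \<Longrightarrow> R (a \<oplus> b) i j = R a i j + R b i j"
    and R_smult: "a \<in> carrier A \<Longrightarrow> R (c \<odot> a) i j = c * R a i j"
    and R_mult: "a \<in> carrier A \<Longrightarrow> b \<in> carrier A \<Longrightarrow> R (a \<otimes> b) i j = (\<Sum>k\<in>I. R a i k * R b k j)"
    and R_inj: "a \<in> carrier A \<Longrightarrow> b \<in> carrier A \<Longrightarrow> R a = R b \<Longrightarrow> a = b"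
    and R_surj: "(\<And>i j. M i j \<noteq> 0 \<Longrightarrow> i \<in> I \<and> j \<in> I \<and> blk i = blk j) \<Longrightarrow> \<exists>a\<in>carrier A. R a = M"
    and R_nrm: "a \<in> carrier A \<Longrightarrow> 0 \<le> C \<Longrightarrow>
      nrm A a \<le> C \<longleftrightarrow> (\<forall>f. lp_norm p I (mv I (R a) f) \<le> C * lp_norm p I f)"

lemma lp_sum_Sigma:
  assumes "finite K" "\<And>k. k \<in> K \<Longrightarrow> finite (D k)"
  shows "lp_sum p (SIGMA k:K. D k) g = (\<Sum>k\<in>K. lp_sum p (D k) (\<lambda>i. g (k, i)))"
proof -
  have "lp_sum p (SIGMA k:K. D k) g = (\<Sum>z\<in>(SIGMA k:K. D k). cmod (g z) powr p)"
    by (rule lp_sum_finite) (use assms in auto)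
  also have "\<dots> = (\<Sum>k\<in>K. \<Sum>i\<in>D k. cmod (g (k, i)) powr p)"
    using assms by (subst sum.Sigma) auto
  also have "\<dots> = (\<Sum>k\<in>K. lp_sum p (D k) (\<lambda>i. g (k, i)))"
    using assms by (intro sum.cong) (auto simp: lp_sum_finite)
  finally show ?thesis .
qed

lemma direct_sum_simps:
  "carrier (direct_sum K A) = (\<Pi>\<^sub>E k\<in>K. carrier (A k))"
  "x \<otimes>\<^bsub>direct_sum K A\<^esub> y = (\<lambda>k\<in>K. x k \<otimes>\<^bsub>A k\<^esub> y k)"
  "x \<oplus>\<^bsub>direct_sum K A\<^esub> y = (\<lambda>k\<in>K. x k \<oplus>\<^bsub>A k\<^esub> y k)"
  "c \<odot>\<^bsub>direct_sum K A\<^esub> x = (\<lambda>k\<in>K. c \<odot>\<^bsub>A k\<^esub> x k)"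
  "nrm (direct_sum K A) x = Max ((\<lambda>k. nrm (A k) (x k)) ` K)"
  by (simp_all add: direct_sum_def)

text \<open>The coordinates are the pairs of a summand and a coordinate of the space on which the summand
  acts.  The maximum of the norms of the summands is the operator norm on the \<open>l\<^sup>p\<close> sum of these spaces,
  because \<open>p\<close>-th powers of norms add up over the blocks.\<close>

theorem spatial_fd_algebra_coordinates:
  fixes A :: "('a, 'm) normed_module_scheme"
  assumes p: "1 \<le> p" and A: "spatial_fd_algebra p A"
  shows "\<exists>(I :: (nat \<times> nat) set) blk R. block_algebra A p I blk R"
proof -
  obtain N d \<psi> where U: "unital_banach_algebra A" and N: "0 < N"
    and \<psi>: "\<psi> \<in> isometric_iso (matrix_sum p N d) A"
    using A unfolding spatial_fd_algebra_def matrix_decomposition_def by blast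
  interpret A: unital_banach_algebra A by fact
  define S where "S = matrix_sum p N d"
  define D where "D k = {1..d k}" for k
  define M where "M k = bounded_operators (lps p (D k))" for k
  have finD: "finite (D k)" for k by (simp add: D_def)
  have S_eq: "S = direct_sum {1..N} M"
    by (simp add: S_def M_def[abs_def] matrix_algebra_def D_def)
  have \<psi>h: "\<psi> \<in> alg_hom S A" and \<psi>n: "isometric S A \<psi>" and \<psi>b: "bij_betw \<psi> (carrier S) (carrier A)"
    using \<psi> by (auto simp: isometric_iso_def S_def)
  define \<rho> where "\<rho> = inv_into (carrier S) \<psi>"
  have \<rho>: "\<rho> a \<in> carrier S" "\<psi> (\<rho> a) = a" if "a \<in> carrier A" for a
    using \<psi>b that by (auto simp: \<rho>_def bij_betw_def inv_into_into f_inv_into_f)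
  have \<rho>\<psi>: "\<rho> (\<psi> x) = x" if "x \<in> carrier S" for x
    using \<psi>b that by (auto simp: \<rho>_def bij_betw_def)
  have comp: "x k \<in> carrier (M k)" if "x \<in> carrier S" "k \<in> {1..N}" for x k
    using that by (auto simp: S_eq direct_sum_simps)
  interpret Mk: complex_normed_space "lps p (D k)" for k by (rule complex_normed_space_Lp[OF p])
  have closed: "x \<oplus>\<^bsub>S\<^esub> y \<in> carrier S" "x \<otimes>\<^bsub>S\<^esub> y \<in> carrier S" "c \<odot>\<^bsub>S\<^esub> x \<in> carrier S"
    if "x \<in> carrier S" "y \<in> carrier S" for x y c
    using comp[OF that(1)] comp[OF that(2)] unfolding S_eq direct_sum_simps M_def
    by (auto intro: Mk.BO_add_closed Mk.BO_mult_closed Mk.BO_smult_closed)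
  have \<rho>_add: "\<rho> (a \<oplus>\<^bsub>A\<^esub> b) = \<rho> a \<oplus>\<^bsub>S\<^esub> \<rho> b" and \<rho>_mult: "\<rho> (a \<otimes>\<^bsub>A\<^esub> b) = \<rho> a \<otimes>\<^bsub>S\<^esub> \<rho> b"
    and \<rho>_smult: "\<rho> (c \<odot>\<^bsub>A\<^esub> a) = c \<odot>\<^bsub>S\<^esub> \<rho> a"
    if ab: "a \<in> carrier A" "b \<in> carrier A" for a b c
  proof -
    note c = \<rho>(1)[OF ab(1)] \<rho>(1)[OF ab(2)]
    show "\<rho> (a \<oplus>\<^bsub>A\<^esub> b) = \<rho> a \<oplus>\<^bsub>S\<^esub> \<rho> b"
      using \<rho>\<psi>[OF closed(1)[OF c]] alg_homD(3)[OF \<psi>h c] \<rho>(2) ab by simp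
    show "\<rho> (a \<otimes>\<^bsub>A\<^esub> b) = \<rho> a \<otimes>\<^bsub>S\<^esub> \<rho> b"
      using \<rho>\<psi>[OF closed(2)[OF c]] alg_homD(5)[OF \<psi>h c] \<rho>(2) ab by simp
    show "\<rho> (c \<odot>\<^bsub>A\<^esub> a) = c \<odot>\<^bsub>S\<^esub> \<rho> a"
      using \<rho>\<psi>[OF closed(3)[OF c]] alg_homD(4)[OF \<psi>h c(1)] \<rho>(2) ab by simp
  qed
  define I where "I = (SIGMA k:{1..N}. D k)"
  define R where "R a z w = (if z \<in> I \<and> w \<in> I \<and> fst z = fst w
    then coef p (D (fst z)) (\<rho> a (fst z)) (snd z) (snd w) else 0)" for a z w
  have finI: "finite I" using finD by (auto simp: I_def)
  have sumI: "(\<Sum>w\<in>I. h w) = (\<Sum>k\<in>{1..N}. \<Sum>j\<in>D k. h (k, j))" for h :: "nat \<times> nat \<Rightarrow> complex"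
    unfolding I_def using finD by (subst sum.Sigma) auto
  have mvI: "mv I (R a) f (k, i) = mv (D k) (coef p (D k) (\<rho> a k)) (\<lambda>j. f (k, j)) i"
    if k: "k \<in> {1..N}" and i: "i \<in> D k" for a f k i
  proof -
    have "mv I (R a) f (k, i) = (\<Sum>l\<in>{1..N}. \<Sum>j\<in>D l. R a (k, i) (l, j) * f (l, j))"
      unfolding mv_def sumI ..
    also have "\<dots> = (\<Sum>l\<in>{1..N}. if l = k then \<Sum>j\<in>D k. R a (k, i) (k, j) * f (k, j) else 0)"
      by (intro sum.cong) (auto simp: R_def)
    also have "\<dots> = (\<Sum>j\<in>D k. R a (k, i) (k, j) * f (k, j))" using k by simp
    also have "\<dots> = mv (D k) (coef p (D k) (\<rho> a k)) (\<lambda>j. f (k, j)) i"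
      unfolding mv_def using k i by (intro sum.cong) (auto simp: R_def I_def)
    finally show ?thesis .
  qed
  have "block_algebra A p I fst R"
  proof (intro block_algebra.intro block_algebra_axioms.intro U p finI)
    fix a assume a: "a \<in> carrier A"
    note ca = comp[OF \<rho>(1)[OF a], unfolded M_def]
    show "i \<in> I \<and> j \<in> I \<and> fst i = fst j" if "R a i j \<noteq> 0" for i j
      using that by (auto simp: R_def split: if_splits)
    show "R (c \<odot>\<^bsub>A\<^esub> a) i j = c * R a i j" for c i j
    proof (cases "i \<in> I \<and> j \<in> I \<and> fst i = fst j")
      case True
      then have "fst i \<in> {1..N}" "snd i \<in> D (fst i)" "snd j \<in> D (fst i)" by (auto simp: I_def)
      then show ?thesis using True coef_smult[OF p finD ca]
        by (simp add: R_def \<rho>_smult[OF a a] S_eq direct_sum_simps M_def)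
    qed (auto simp: R_def)
    show "nrm A a \<le> C \<longleftrightarrow> (\<forall>f. lp_norm p I (mv I (R a) f) \<le> C * lp_norm p I f)" if C: "0 \<le> C" for C
    proof -
      have "nrm A a = nrm S (\<rho> a)" using \<psi>n \<rho>[OF a] by (auto simp: isometric_def)
      also have "\<dots> \<le> C \<longleftrightarrow> (\<forall>k\<in>{1..N}. nrm (M k) (\<rho> a k) \<le> C)"
        using N by (simp add: S_eq direct_sum_simps)
      also have "\<dots> \<longleftrightarrow> (\<forall>k\<in>{1..N}. \<forall>f. lp_sum p (D k) (mv (D k) (coef p (D k) (\<rho> a k)) f) \<le> C powr p * lp_sum p (D k) f)"
        unfolding M_def using op_nrm_le_iff[OF p finD ca C] p C by (simp add: lp_sum_powr_scale)
      also have "\<dots> \<longleftrightarrow> (\<forall>f. lp_sum p I (mv I (R a) f) \<le> C powr p * lp_sum p I f)"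
      proof (intro iffI allI ballI)
        fix f :: "nat \<times> nat \<Rightarrow> complex"
        assume *: "\<forall>k\<in>{1..N}. \<forall>f. lp_sum p (D k) (mv (D k) (coef p (D k) (\<rho> a k)) f) \<le> C powr p * lp_sum p (D k) f"
        have "lp_sum p I (mv I (R a) f) = (\<Sum>k\<in>{1..N}. lp_sum p (D k) (\<lambda>i. mv I (R a) f (k, i)))"
          unfolding I_def by (rule lp_sum_Sigma) (use finD in auto)
        also have "\<dots> = (\<Sum>k\<in>{1..N}. lp_sum p (D k) (mv (D k) (coef p (D k) (\<rho> a k)) (\<lambda>j. f (k, j))))"
          by (intro sum.cong lp_sum_cong) (auto simp: mvI)
        also have "\<dots> \<le> (\<Sum>k\<in>{1..N}. C powr p * lp_sum p (D k) (\<lambda>j. f (k, j)))"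
          using * by (intro sum_mono) blast
        also have "\<dots> = C powr p * lp_sum p I f"
          unfolding I_def by (subst lp_sum_Sigma) (use finD in \<open>auto simp: sum_distrib_left\<close>)
        finally show "lp_sum p I (mv I (R a) f) \<le> C powr p * lp_sum p I f" .
      next
        fix k and f :: "nat \<Rightarrow> complex" assume *: "\<forall>f. lp_sum p I (mv I (R a) f) \<le> C powr p * lp_sum p I f" and k: "k \<in> {1..N}"
        define g where "g z = (if fst z = k then f (snd z) else 0)" for z :: "nat \<times> nat"
        have "lp_sum p (D k) (mv (D k) (coef p (D k) (\<rho> a k)) f) = lp_sum p (D k) (\<lambda>i. mv I (R a) g (k, i))"
          by (rule lp_sum_cong, subst mvI[OF k]) (simp_all add: g_def)
        also have "\<dots> \<le> (\<Sum>l\<in>{1..N}. lp_sum p (D l) (\<lambda>i. mv I (R a) g (l, i)))"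
          using k by (intro member_le_sum[of k "{1..N}" "\<lambda>l. lp_sum p (D l) (\<lambda>i. mv I (R a) g (l, i))"])
            (auto simp: lp_sum_nonneg)
        also have "\<dots> = lp_sum p I (mv I (R a) g)"
          unfolding I_def by (rule lp_sum_Sigma[symmetric]) (use finD in auto)
        also have "\<dots> \<le> C powr p * lp_sum p I g" using * by blast
        also have "lp_sum p I g = (\<Sum>l\<in>{1..N}. lp_sum p (D l) (\<lambda>i. g (l, i)))"
          unfolding I_def by (rule lp_sum_Sigma) (use finD in auto)
        also have "\<dots> = (\<Sum>l\<in>{1..N}. if l = k then lp_sum p (D k) f else 0)"
          by (intro sum.cong) (auto simp: g_def lp_sum_def)
        also have "\<dots> = lp_sum p (D k) f" using k by simp
        finally show "lp_sum p (D k) (mv (D k) (coef p (D k) (\<rho> a k)) f) \<le> C powr p * lp_sum p (D k) f" .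
      qed
      also have "\<dots> \<longleftrightarrow> (\<forall>f. lp_norm p I (mv I (R a) f) \<le> C * lp_norm p I f)"
        using p C by (simp add: lp_sum_powr_scale)
      finally show ?thesis .
    qed
    fix b assume b: "b \<in> carrier A"
    note cb = comp[OF \<rho>(1)[OF b], unfolded M_def]
    show "R (a \<oplus>\<^bsub>A\<^esub> b) i j = R a i j + R b i j" for i j
    proof (cases "i \<in> I \<and> j \<in> I \<and> fst i = fst j")
      case True
      then have "fst i \<in> {1..N}" "snd i \<in> D (fst i)" "snd j \<in> D (fst i)" by (auto simp: I_def)
      then show ?thesis using True coef_add[OF p finD ca cb]
        by (simp add: R_def \<rho>_add[OF a b] S_eq direct_sum_simps M_def)
    qed (auto simp: R_def)
    show "R (a \<otimes>\<^bsub>A\<^esub> b) i j = (\<Sum>k\<in>I. R a i k * R b k j)" for i j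
    proof (cases "i \<in> I \<and> j \<in> I \<and> fst i = fst j")
      case True
      then obtain k i' j' where ij: "i = (k, i')" "j = (k, j')" "k \<in> {1..N}" "i' \<in> D k" "j' \<in> D k"
        by (auto simp: I_def)
      have "R (a \<otimes>\<^bsub>A\<^esub> b) i j = (\<Sum>l\<in>D k. coef p (D k) (\<rho> a k) i' l * coef p (D k) (\<rho> b k) l j')"
        using True ij coef_mult[OF p finD ca[OF ij(3)] cb[OF ij(3)] ij(4,5)]
        by (simp add: R_def \<rho>_mult[OF a b] S_eq direct_sum_simps M_def)
      also have "\<dots> = mv (D k) (coef p (D k) (\<rho> a k)) (\<lambda>l. R b (k, l) j) i'"
        unfolding mv_def using ij by (intro sum.cong) (auto simp: R_def I_def)
      also have "\<dots> = mv I (R a) (\<lambda>w. R b w j) i" using mvI[OF ij(3,4)] by (simp add: ij)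
      finally show ?thesis by (simp add: mv_def)
    next
      case False
      have "(\<Sum>k\<in>I. R a i k * R b k j) = 0"
        by (rule sum.neutral) (use False in \<open>auto simp: R_def\<close>)
      moreover have "R (a \<otimes>\<^bsub>A\<^esub> b) i j = 0" using False by (auto simp: R_def)
      ultimately show ?thesis by simp
    qed
    show "a = b" if eq: "R a = R b"
    proof -
      have "\<rho> a k = \<rho> b k" if k: "k \<in> {1..N}" for k
      proof (rule coef_inj[OF p finD ca[OF k] cb[OF k]])
        fix i j assume "i \<in> D k" "j \<in> D k"
        then show "coef p (D k) (\<rho> a k) i j = coef p (D k) (\<rho> b k) i j"
          using fun_cong[OF fun_cong[OF eq, of "(k, i)"], of "(k, j)"] k by (auto simp: R_def I_def)
      qed
      then have "\<rho> a = \<rho> b"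
        using \<rho>(1)[OF a] \<rho>(1)[OF b] unfolding S_eq direct_sum_simps(1)
        by - (rule PiE_ext[of _ "{1..N}" "\<lambda>k. carrier (M k)"])
      then have "\<psi> (\<rho> a) = \<psi> (\<rho> b)" by (rule arg_cong)
      then show "a = b" by (simp only: \<rho>(2)[OF a] \<rho>(2)[OF b])
    qed
  next
    fix Q :: "nat \<times> nat \<Rightarrow> nat \<times> nat \<Rightarrow> complex"
    assume Q: "\<And>i j. Q i j \<noteq> 0 \<Longrightarrow> i \<in> I \<and> j \<in> I \<and> fst i = fst j"
    define x where "x = (\<lambda>k\<in>{1..N}. mat_op p (D k) (\<lambda>i j. Q (k, i) (k, j)))"
    have x: "x \<in> carrier S"
      using mat_op_closed[OF p finD] by (auto simp: S_eq direct_sum_simps x_def M_def)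
    have "R (\<psi> x) = Q"
    proof (intro ext)
      fix i j
      show "R (\<psi> x) i j = Q i j"
      proof (cases "i \<in> I \<and> j \<in> I \<and> fst i = fst j")
        case True
        then obtain k i' j' where ij: "i = (k, i')" "j = (k, j')" "k \<in> {1..N}" "i' \<in> D k" "j' \<in> D k"
          by (auto simp: I_def)
        have "x k = mat_op p (D k) (\<lambda>i j. Q (k, i) (k, j))" using ij(3) by (simp add: x_def)
        then show ?thesis using True ij by (simp add: R_def \<rho>\<psi>[OF x] coef_mat_op[OF p finD])
      next
        case False
        then show ?thesis using Q[of i j] by (auto simp: R_def)
      qed
    qed
    moreover have "\<psi> x \<in> carrier A" using x alg_homD(2)[OF \<psi>h] by blast
    ultimately show "\<exists>a\<in>carrier A. R a = Q" by blast
  qed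
  then show ?thesis by blast
qed

context block_algebra
begin

definition elt :: "('i \<Rightarrow> 'i \<Rightarrow> complex) \<Rightarrow> 'a" where
  "elt M = (THE a. a \<in> carrier A \<and> R a = M)"

lemma elt:
  assumes "\<And>i j. M i j \<noteq> 0 \<Longrightarrow> i \<in> I \<and> j \<in> I \<and> blk i = blk j"
  shows "elt M \<in> carrier A" "R (elt M) = M"
proof -
  obtain a where a: "a \<in> carrier A" "R a = M" using R_surj[OF assms] by blast
  have "elt M = a"
    unfolding elt_def by (rule the_equality) (use a R_inj in auto)
  then show "elt M \<in> carrier A" "R (elt M) = M" using a by auto
qed

definition munit :: "'i \<Rightarrow> 'i \<Rightarrow> 'a" where
  "munit i j = elt (\<lambda>r s. if r = i \<and> s = j then 1 else 0)"

definition dg :: "('i \<Rightarrow> complex) \<Rightarrow> 'a" where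
  "dg h = elt (\<lambda>r s. if r = s \<and> r \<in> I then h r else 0)"

lemma munit:
  assumes "i \<in> I" "j \<in> I" "blk i = blk j"
  shows "munit i j \<in> carrier A" "R (munit i j) r s = (if r = i \<and> s = j then 1 else 0)"
proof -
  have *: "(if r = i \<and> s = j then 1 else 0 :: complex) \<noteq> 0 \<Longrightarrow> r \<in> I \<and> s \<in> I \<and> blk r = blk s" for r s
    using assms by (auto split: if_splits)
  show "munit i j \<in> carrier A" "R (munit i j) r s = (if r = i \<and> s = j then 1 else 0)"
    unfolding munit_def by (rule elt(1), rule *, assumption) (subst elt(2), rule *, auto)
qed

lemma dg: "dg h \<in> carrier A" "R (dg h) r s = (if r = s \<and> r \<in> I then h r else 0)"
proof -
  have *: "(if r = s \<and> r \<in> I then h r else 0 :: complex) \<noteq> 0 \<Longrightarrow> r \<in> I \<and> s \<in> I \<and> blk r = blk s" for r s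
    by (auto split: if_splits)
  show "dg h \<in> carrier A" "R (dg h) r s = (if r = s \<and> r \<in> I then h r else 0)"
    unfolding dg_def by (rule elt(1), rule *, assumption) (subst elt(2), rule *, auto)
qed

lemma R_outside: "a \<in> carrier A \<Longrightarrow> i \<notin> I \<or> j \<notin> I \<or> blk i \<noteq> blk j \<Longrightarrow> R a i j = 0"
  using R_support[of a i j] by auto

lemma R_ext:
  assumes "a \<in> carrier A" "b \<in> carrier A" "\<And>i j. i \<in> I \<Longrightarrow> j \<in> I \<Longrightarrow> blk i = blk j \<Longrightarrow> R a i j = R b i j"
  shows "a = b"
proof (rule R_inj[OF assms(1,2)], intro ext)
  fix i j
  show "R a i j = R b i j"
    using assms(3)[of i j] R_outside[OF assms(1), of i j] R_outside[OF assms(2), of i j]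
    by (cases "i \<in> I \<and> j \<in> I \<and> blk i = blk j") auto
qed

lemma R_zero [simp]: "R \<zero> i j = 0"
  using R_smult[of "\<zero>" 0 i j] by simp

lemma R_minus: "a \<in> carrier A \<Longrightarrow> b \<in> carrier A \<Longrightarrow> R (a \<ominus> b) i j = R a i j - R b i j"
  by (simp add: minus_csmult R_add R_smult)

lemma R_one: "R \<one> r s = (if r = s \<and> r \<in> I then 1 else 0)"
proof -
  have "dg (\<lambda>_. 1) \<otimes> \<one> = \<one>"
  proof (rule R_ext)
    fix i j assume ij: "i \<in> I" "j \<in> I"
    have "R (dg (\<lambda>_. 1) \<otimes> \<one>) i j = (\<Sum>k\<in>I. (if k = i then R \<one> k j else 0))"
      using ij by (simp add: R_mult dg one_closed) (intro sum.cong, auto)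
    also have "\<dots> = R \<one> i j" using ij finite_I by simp
    finally show "R (dg (\<lambda>_. 1) \<otimes> \<one>) i j = R \<one> i j" .
  qed (auto intro: mult_closed dg one_closed)
  then have "\<one> = dg (\<lambda>_. 1)" by (simp add: one_right dg)
  then show ?thesis by (simp add: dg)
qed

lemma nrm_le_1_iff:
  "a \<in> carrier A \<Longrightarrow> nrm A a \<le> 1 \<longleftrightarrow> (\<forall>f. lp_sum p I (mv I (R a) f) \<le> lp_sum p I f)"
  using R_nrm[of a 1] p_ge_1 by (simp add: lp_sum_powr_scale[of p 1, simplified])

text \<open>A diagonal matrix multiplies each coordinate by a number of modulus at most \<open>K\<close>.\<close>

lemma nrm_diagonal_le:
  assumes a: "a \<in> carrier A" and diag: "\<And>i j. i \<in> I \<Longrightarrow> j \<in> I \<Longrightarrow> i \<noteq> j \<Longrightarrow> R a i j = 0"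
    and K: "0 \<le> K" "\<And>i. i \<in> I \<Longrightarrow> cmod (R a i i) \<le> K"
  shows "nrm A a \<le> K"
proof -
  have "lp_norm p I (mv I (R a) f) \<le> K * lp_norm p I f" for f
  proof -
    have "lp_sum p I (mv I (R a) f) = (\<Sum>i\<in>I. cmod (R a i i * f i) powr p)"
      unfolding lp_sum_finite[OF finite_I] using diag finite_I
      by (intro sum.cong refl) (simp add: mv_diag)
    also have "\<dots> \<le> (\<Sum>i\<in>I. (K * cmod (f i)) powr p)"
      using K p_ge_1 by (intro sum_mono powr_mono2) (auto simp: norm_mult intro: mult_right_mono)
    also have "\<dots> = K powr p * lp_sum p I f"
      using K by (simp add: lp_sum_finite[OF finite_I] powr_mult sum_distrib_left)
    finally show ?thesis using p_ge_1 K by (simp add: lp_sum_powr_scale)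
  qed
  then show ?thesis using R_nrm[OF a K(1)] by simp
qed

lemma nrm_one_le: "nrm A \<one> \<le> 1"
  by (rule nrm_diagonal_le) (auto simp: R_one one_closed)

text \<open>Linear statements need only be checked on matrix units.\<close>

lemma munit_induct:
  assumes a: "a \<in> carrier A" and zero: "P \<zero>"
    and step: "\<And>a i j c. a \<in> carrier A \<Longrightarrow> P a \<Longrightarrow> i \<in> I \<Longrightarrow> j \<in> I \<Longrightarrow> blk i = blk j \<Longrightarrow> P (a \<oplus> c \<odot> munit i j)"
  shows "P a"
proof -
  define cut where "cut Z = elt (\<lambda>i j. if (i, j) \<in> Z then R a i j else 0)" for Z
  have cut: "cut Z \<in> carrier A" "R (cut Z) = (\<lambda>i j. if (i, j) \<in> Z then R a i j else 0)" for Z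
    unfolding cut_def by (rule elt, use R_support[OF a] in \<open>auto split: if_splits\<close>)+
  have "P (cut Z)" if "finite Z" "Z \<subseteq> {(i, j). i \<in> I \<and> j \<in> I \<and> blk i = blk j}" for Z
    using that
  proof (induction Z)
    case empty
    have "cut {} = \<zero>" by (rule R_ext) (auto simp: cut)
    then show ?case using zero by simp
  next
    case (insert z Z)
    obtain i j where z: "z = (i, j)" by (cases z)
    then have ij: "i \<in> I" "j \<in> I" "blk i = blk j" using insert by auto
    have "cut (insert z Z) = cut Z \<oplus> R a i j \<odot> munit i j"
      by (rule R_ext) (use insert(2) ij in \<open>auto simp: cut R_add R_smult munit z\<close>)
    then show ?case using step[OF cut(1) insert(3) ij] insert by simp
  qed
  moreover have "finite {(i, j). i \<in> I \<and> j \<in> I \<and> blk i = blk j}"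
    by (rule finite_subset[of _ "I \<times> I"]) (use finite_I in auto)
  ultimately have "P (cut {(i, j). i \<in> I \<and> j \<in> I \<and> blk i = blk j})" by blast
  moreover have "cut {(i, j). i \<in> I \<and> j \<in> I \<and> blk i = blk j} = a"
    by (rule R_ext) (use a in \<open>auto simp: cut\<close>)
  ultimately show ?thesis by simp
qed

lemma mult_munit_munit:
  assumes "i \<in> I" "j \<in> I" "k \<in> I" "blk i = blk j" "blk j = blk k"
  shows "munit i j \<otimes> munit j k = munit i k"
proof (rule R_ext)
  fix r s assume "r \<in> I" "s \<in> I"
  show "R (munit i j \<otimes> munit j k) r s = R (munit i k) r s"
  proof -
    have "R (munit i j \<otimes> munit j k) r s = (\<Sum>l\<in>I. R (munit i j) r l * R (munit j k) l s)"
      using assms by (intro R_mult munit) auto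
    also have "\<dots> = (\<Sum>l\<in>I. if l = j then (if r = i \<and> s = k then 1 else 0) else 0)"
      using assms by (intro sum.cong) (auto simp: munit)
    also have "\<dots> = R (munit i k) r s" using assms finite_I by (simp add: munit)
    finally show ?thesis .
  qed
qed (use assms in \<open>auto intro!: mult_closed munit\<close>)

end

section \<open>Hermitian idempotents of a block algebra\<close>

text \<open>All powers of an idempotent but the zeroth agree, so that the exponential series can be summed.\<close>

lemma (in unital_banach_algebra) alg_exp_idempotent:
  assumes e: "e \<in> carrier A" "e \<otimes> e = e"
  shows "alg_exp A (c \<odot> e) = \<one> \<oplus> (exp c - 1) \<odot> e"
proof -
  define x where "x = c \<odot> e"
  have pow: "x [^] k = (if k = 0 then \<one> else (c ^ k) \<odot> e)" for k :: nat
  proof (induction k)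
    case 0
    then show ?case by (simp add: nat_pow_def)
  next
    case (Suc k)
    have "x [^] Suc k = x [^] k \<otimes> x" by (simp add: nat_pow_def)
    then show ?case
      using Suc e by (auto simp: x_def one_left smult_mult_left smult_mult_right csmult_assoc mult.commute)
  qed
  define t where "t k = (1 / fact k) \<odot> (x [^] k)" for k :: nat
  have t: "t k \<in> carrier A" for k using e by (simp add: t_def pow one_closed)
  define b where "b n = (\<Sum>k<n. c ^ k / fact k)" for n :: nat
  have partial: "(\<Oplus>k\<in>{..<Suc n}. t k) = \<one> \<oplus> (b (Suc n) - 1) \<odot> e" for n
  proof (induction n)
    case 0
    have "(\<Oplus>k\<in>{..<Suc 0}. t k) = t 0 \<oplus> (\<Oplus>k\<in>{..<0}. t k)"
      unfolding lessThan_Suc[of 0] using t by (subst M.finsum_insert) auto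
    then show ?case using one_closed e by (simp add: b_def t_def pow)
  next
    case (Suc n)
    have tS: "t (Suc n) = (c ^ Suc n / fact (Suc n)) \<odot> e"
      unfolding t_def pow using e by (simp add: csmult_assoc del: fact_Suc power_Suc)
    have "(\<Oplus>k\<in>{..<Suc (Suc n)}. t k) = t (Suc n) \<oplus> (\<Oplus>k\<in>{..<Suc n}. t k)"
      unfolding lessThan_Suc[of "Suc n"] using t by (subst M.finsum_insert) auto
    also have "\<dots> = \<one> \<oplus> ((b (Suc n) - 1) \<odot> e \<oplus> (c ^ Suc n / fact (Suc n)) \<odot> e)"
      unfolding Suc tS using e one_closed by (simp add: M.a_ac del: fact_Suc power_Suc)
    also have "(b (Suc n) - 1) \<odot> e \<oplus> (c ^ Suc n / fact (Suc n)) \<odot> e = (b (Suc (Suc n)) - 1) \<odot> e"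
    proof -
      have "b (Suc (Suc n)) - 1 = (b (Suc n) - 1) + c ^ Suc n / fact (Suc n)"
        unfolding b_def lessThan_Suc[of "Suc n"] by (simp del: fact_Suc power_Suc sum.lessThan_Suc)
      then show ?thesis by (simp only: csmult_add_left[OF e(1)])
    qed
    finally show ?case .
  qed
  interpret MS: Metric_space "carrier A" "ndist A" by (rule Metric_space_ndist)
  have lim: "limitin (ntopology A) (\<lambda>n. \<Oplus>k\<in>{..<n}. t k) (\<one> \<oplus> (exp c - 1) \<odot> e) sequentially"
    unfolding limitin_ntopology_iff
  proof (intro conjI allI impI)
    show "\<one> \<oplus> (exp c - 1) \<odot> e \<in> carrier A" using e one_closed by simp
    fix \<epsilon> :: real assume \<epsilon>: "0 < \<epsilon>"
    have "b \<longlonglongrightarrow> exp c"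
      using exp_converges[of c] unfolding sums_def b_def
      by (simp add: scaleR_conv_of_real divide_inverse mult.commute)
    moreover have "0 < \<epsilon> / (nrm A e + 1)" using \<epsilon> e by (simp add: add_nonneg_pos)
    ultimately obtain N where N: "\<And>n. n \<ge> N \<Longrightarrow> cmod (b n - exp c) < \<epsilon> / (nrm A e + 1)"
      unfolding LIMSEQ_iff by blast
    show "\<exists>N. \<forall>n\<ge>N. (\<Oplus>k\<in>{..<n}. t k) \<in> carrier A \<and> nrm A ((\<Oplus>k\<in>{..<n}. t k) \<ominus> (\<one> \<oplus> (exp c - 1) \<odot> e)) < \<epsilon>"
    proof (intro exI[of _ "Suc N"] allI impI)
      fix n assume n: "n \<ge> Suc N"
      then obtain m where m: "n = Suc m" by (cases n) auto
      have "(\<Oplus>k\<in>{..<n}. t k) \<ominus> (\<one> \<oplus> (exp c - 1) \<odot> e) = (b n - exp c) \<odot> e"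
        unfolding m partial using e one_closed
        by (simp add: add_minus_add csmult_diff_left)
      then have "nrm A ((\<Oplus>k\<in>{..<n}. t k) \<ominus> (\<one> \<oplus> (exp c - 1) \<odot> e)) = cmod (b n - exp c) * nrm A e"
        using e by (simp add: nrm_smult)
      also have "\<dots> \<le> cmod (b n - exp c) * (nrm A e + 1)" by (intro mult_left_mono) auto
      also have "\<dots> < \<epsilon>"
        using N[of n] n e by (simp add: pos_less_divide_eq add_nonneg_pos)
      finally show "(\<Oplus>k\<in>{..<n}. t k) \<in> carrier A \<and> nrm A ((\<Oplus>k\<in>{..<n}. t k) \<ominus> (\<one> \<oplus> (exp c - 1) \<odot> e)) < \<epsilon>"
        unfolding m partial using e one_closed by simp
    qed
  qed
  show ?thesis
    unfolding alg_exp_def x_def[symmetric] t_def[symmetric]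
  proof (rule the_equality)
    fix y assume y: "limitin (ntopology A) (\<lambda>n. \<Oplus>k\<in>{..<n}. t k) y sequentially"
    show "y = \<one> \<oplus> (exp c - 1) \<odot> e"
      by (rule MS.limitin_metric_unique[OF y lim]) simp
  qed (rule lim)
qed

text \<open>With the exponential of an idempotent computed, being hermitian says that the rotations
  \<open>1 + (e\<^sup>i\<^sup>l - 1)e\<close> are contractive.\<close>

lemma (in block_algebra) hermitian_idempotent_diagonal:
  assumes p2: "p \<noteq> 2" and e: "hermitian_idempotent A e" and ij: "i \<noteq> j"
  shows "R e i j = 0"
proof (cases "i \<in> I \<and> j \<in> I")
  case True
  have ec: "e \<in> carrier A" "e \<otimes> e = e" using e by (auto simp: hermitian_idempotent_def)
  show ?thesis
  proof (rule rotations_contractive_imp_diagonal[OF finite_I p_ge_1 p2])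
    fix l :: real and f :: "_ \<Rightarrow> complex"
    define u where "u = \<one> \<oplus> (cis l - 1) \<odot> e"
    have u: "u \<in> carrier A" using ec one_closed by (simp add: u_def)
    have "nrm A (alg_exp A ((\<i> * complex_of_real l) \<odot> e)) = 1"
      using e by (auto simp: hermitian_idempotent_def)
    then have "nrm A u \<le> 1" by (simp add: alg_exp_idempotent[OF ec] u_def cis_conv_exp)
    then have "lp_sum p I (mv I (R u) f) \<le> lp_sum p I f" using nrm_le_1_iff[OF u] by blast
    moreover have "lp_sum p I (mv I (R u) f) = lp_sum p I (\<lambda>i. f i + (cis l - 1) * mv I (R e) f i)"
    proof (rule lp_sum_cong)
      fix i assume i: "i \<in> I"
      have "mv I (R u) f i = mv I (R \<one>) f i + mv I (R ((cis l - 1) \<odot> e)) f i"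
        unfolding u_def mv_def using ec one_closed by (simp add: R_add distrib_right sum.distrib)
      also have "mv I (R \<one>) f i = f i" using i finite_I by (subst mv_diag) (auto simp: R_one)
      also have "mv I (R ((cis l - 1) \<odot> e)) f i = (cis l - 1) * mv I (R e) f i"
        unfolding mv_def using ec by (simp add: R_smult sum_distrib_left mult.assoc)
      finally show "mv I (R u) f i = f i + (cis l - 1) * mv I (R e) f i" .
    qed
    ultimately show "lp_sum p I (\<lambda>i. f i + (cis l - 1) * mv I (R e) f i) \<le> lp_sum p I f" by simp
  qed (use True ij in auto)
qed (use e R_outside in \<open>auto simp: hermitian_idempotent_def\<close>)

section \<open>Contractive homomorphisms with hermitian image of the identity\<close>

text \<open>Spatial homomorphisms enter through two properties: contractivity, and diagonality of the image of
  the identity, which follows from hermiticity of its components.\<close>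

locale block_hom =
  A: block_algebra A p I blk R + B: block_algebra B p J blkB RB
  for A :: "('a, 'm) normed_module_scheme" (structure) and p :: real
    and I :: "'i set" and blk R
    and B :: "('b, 'n) normed_module_scheme" and J :: "'j set" and blkB RB +
  fixes \<phi> :: "'a \<Rightarrow> 'b"
  assumes p_neq_2: "p \<noteq> 2" and hom: "\<phi> \<in> alg_hom A B" and contr: "contractive A B \<phi>"
    and one_diagonal: "y \<noteq> z \<Longrightarrow> RB (\<phi> \<one>\<^bsub>A\<^esub>) y z = 0"
begin

lemmas \<phi>_closed = alg_homD(2)[OF hom]
  and \<phi>_add = alg_homD(3)[OF hom]
  and \<phi>_smult = alg_homD(4)[OF hom]
  and \<phi>_mult = alg_homD(5)[OF hom]

lemma \<phi>_zero: "\<phi> \<zero>\<^bsub>A\<^esub> = \<zero>\<^bsub>B\<^esub>"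
  using \<phi>_smult[of "\<zero>\<^bsub>A\<^esub>" 0] \<phi>_closed[of "\<zero>\<^bsub>A\<^esub>"] by simp

abbreviation "\<phi>R a \<equiv> RB (\<phi> a)"

lemma \<phi>R_mult: "a \<in> carrier A \<Longrightarrow> b \<in> carrier A \<Longrightarrow>
    \<phi>R (a \<otimes>\<^bsub>A\<^esub> b) y z = (\<Sum>k\<in>J. \<phi>R a y k * \<phi>R b k z)"
  by (simp add: \<phi>_mult \<phi>_closed B.R_mult)

lemma \<phi>_contraction:
  assumes "a \<in> carrier A" "nrm A a \<le> 1"
  shows "lp_sum p J (mv J (\<phi>R a) f) \<le> lp_sum p J f"
proof -
  have "nrm B (\<phi> a) \<le> 1" using contr assms by (force simp: contractive_def)
  then show ?thesis using B.nrm_le_1_iff[OF \<phi>_closed[OF assms(1)]] by blast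
qed

lemma diagonal_idempotent_entry:
  assumes a: "a \<in> carrier A" "a \<otimes>\<^bsub>A\<^esub> a = a" and diag: "\<And>y z. y \<noteq> z \<Longrightarrow> \<phi>R a y z = 0"
  shows "\<phi>R a y y = 0 \<or> \<phi>R a y y = 1"
proof (cases "y \<in> J")
  case True
  have "\<phi>R a y y = (\<Sum>k\<in>J. \<phi>R a y k * \<phi>R a k y)" using \<phi>R_mult[OF a(1) a(1), of y y] a(2) by simp
  also have "\<dots> = (\<Sum>k\<in>{y}. \<phi>R a y k * \<phi>R a k y)"
    by (rule sum.mono_neutral_right) (use B.finite_I True diag in auto)
  finally show ?thesis by (simp add: mult_cancel_left1[of "\<phi>R a y y"]) 
next
  case False
  then show ?thesis using B.R_outside[OF \<phi>_closed[OF a(1)]] by blast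
qed

lemma mult_diagonal_left:
  assumes a: "a \<in> carrier A" "b \<in> carrier A" and diag: "\<And>y z. y \<noteq> z \<Longrightarrow> \<phi>R a y z = 0" and y: "y \<in> J"
  shows "\<phi>R (a \<otimes>\<^bsub>A\<^esub> b) y z = \<phi>R a y y * \<phi>R b y z"
proof -
  have "\<phi>R (a \<otimes>\<^bsub>A\<^esub> b) y z = (\<Sum>k\<in>{y}. \<phi>R a y k * \<phi>R b k z)"
    unfolding \<phi>R_mult[OF a] by (rule sum.mono_neutral_right) (use B.finite_I y diag in auto)
  then show ?thesis by simp
qed

lemma mult_diagonal_right:
  assumes a: "a \<in> carrier A" "b \<in> carrier A" and diag: "\<And>y z. y \<noteq> z \<Longrightarrow> \<phi>R b y z = 0" and z: "z \<in> J"
  shows "\<phi>R (a \<otimes>\<^bsub>A\<^esub> b) y z = \<phi>R a y z * \<phi>R b z z"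
proof -
  have "\<phi>R (a \<otimes>\<^bsub>A\<^esub> b) y z = (\<Sum>k\<in>{z}. \<phi>R a y k * \<phi>R b k z)"
    unfolding \<phi>R_mult[OF a] by (rule sum.mono_neutral_right) (use B.finite_I z diag in auto)
  then show ?thesis by simp
qed

lemma one_entry: "\<phi>R \<one>\<^bsub>A\<^esub> y y = 0 \<or> \<phi>R \<one>\<^bsub>A\<^esub> y y = 1"
  by (rule diagonal_idempotent_entry) (auto simp: A.one_closed A.one_left one_diagonal)

lemma mv_add_smult:
  assumes "a \<in> carrier A" "b \<in> carrier A"
  shows "mv J (\<phi>R (a \<oplus>\<^bsub>A\<^esub> c \<odot>\<^bsub>A\<^esub> b)) f y = mv J (\<phi>R a) f y + c * mv J (\<phi>R b) f y"
  using assms by (simp add: mv_def \<phi>_add \<phi>_smult \<phi>_closed B.R_add B.R_smult distrib_right sum.distrib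
      sum_distrib_left mult.assoc)

text \<open>A diagonal matrix unit is hermitian, and hermitian idempotents of the corner of the diagonal
  projection \<open>\<phi> \<one>\<close> are diagonal.\<close>

lemma munit_diagonal:
  assumes i: "i \<in> I" and yz: "y \<noteq> z"
  shows "\<phi>R (A.munit i i) y z = 0"
proof (cases "y \<in> J \<and> z \<in> J")
  case True
  define S where "S = {y\<in>J. \<phi>R \<one>\<^bsub>A\<^esub> y y = 1}"
  note E = A.munit[OF i i refl]
  show ?thesis
  proof (rule corner_rotations_contractive_imp_diagonal[OF B.finite_I B.p_ge_1 p_neq_2, of S])
    show "S \<subseteq> J" by (auto simp: S_def)
    fix j k assume jk: "j \<in> J" "k \<in> J" "\<phi>R (A.munit i i) j k \<noteq> 0"
    have "\<phi>R (A.munit i i) j k = \<phi>R \<one>\<^bsub>A\<^esub> j j * \<phi>R (A.munit i i) j k"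
      using mult_diagonal_left[OF A.one_closed E(1) one_diagonal jk(1)] E(1) by (simp add: A.one_left)
    moreover have "\<phi>R (A.munit i i) j k = \<phi>R (A.munit i i) j k * \<phi>R \<one>\<^bsub>A\<^esub> k k"
      using mult_diagonal_right[OF E(1) A.one_closed one_diagonal jk(2)] E(1) by (simp add: A.one_right)
    ultimately show "j \<in> S \<and> k \<in> S"
      using jk one_entry[of j] one_entry[of k] by (auto simp: S_def)
  next
    fix l :: real and f :: "'j \<Rightarrow> complex"
    define u where "u = \<one>\<^bsub>A\<^esub> \<oplus>\<^bsub>A\<^esub> (cis l - 1) \<odot>\<^bsub>A\<^esub> A.munit i i"
    have u: "u \<in> carrier A" using E A.one_closed by (simp add: u_def)
    have "nrm A u \<le> 1"
      by (rule A.nrm_diagonal_le[OF u])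
        (auto simp: u_def A.R_add A.R_smult A.R_one E A.one_closed)
    have "lp_sum p S (\<lambda>j. f j + (cis l - 1) * mv J (\<phi>R (A.munit i i)) f j) = lp_sum p S (mv J (\<phi>R u) f)"
    proof (rule lp_sum_cong)
      fix j assume j: "j \<in> S"
      have "mv J (\<phi>R \<one>\<^bsub>A\<^esub>) f j = f j"
        using j B.finite_I by (subst mv_diag) (auto simp: S_def one_diagonal)
      then show "f j + (cis l - 1) * mv J (\<phi>R (A.munit i i)) f j = mv J (\<phi>R u) f j"
        unfolding u_def mv_add_smult[OF A.one_closed E(1)] by simp
    qed
    also have "\<dots> \<le> lp_sum p J (mv J (\<phi>R u) f)"
    proof -
      have "finite S" using B.finite_I by (simp add: S_def)
      then show ?thesis
        unfolding lp_sum_finite[OF B.finite_I] lp_sum_finite[OF \<open>finite S\<close>]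
        using B.finite_I by (intro sum_mono2) (auto simp: S_def)
    qed
    also have "\<dots> \<le> lp_sum p J f" by (rule \<phi>_contraction[OF u \<open>nrm A u \<le> 1\<close>])
    finally show "lp_sum p S (\<lambda>j. f j + (cis l - 1) * mv J (\<phi>R (A.munit i i)) f j) \<le> lp_sum p J f" .
  qed (use True yz in auto)
next
  case False
  then show ?thesis using B.R_outside[OF \<phi>_closed[OF A.munit(1)[OF i i refl]]] by blast
qed

lemma munit_entry: "i \<in> I \<Longrightarrow> \<phi>R (A.munit i i) y y = 0 \<or> \<phi>R (A.munit i i) y y = 1"
  by (rule diagonal_idempotent_entry) (auto simp: A.munit A.mult_munit_munit munit_diagonal)

lemma nrm_munit_le:
  assumes "i \<in> I" "j \<in> I" "blk i = blk j"
  shows "nrm A (A.munit i j) \<le> 1"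
proof -
  have "lp_sum p I (mv I (R (A.munit i j)) f) \<le> lp_sum p I f" for f
  proof -
    have mv: "mv I (R (A.munit i j)) f r = (if r = i then f j else 0)" for r
    proof -
      have "mv I (R (A.munit i j)) f r = (\<Sum>s\<in>I. if s = j then (if r = i then f j else 0) else 0)"
        unfolding mv_def by (rule sum.cong) (auto simp: A.munit[OF assms])
      then show ?thesis using assms A.finite_I by simp
    qed
    have "lp_sum p I (mv I (R (A.munit i j)) f) = (\<Sum>r\<in>I. if r = i then cmod (f j) powr p else 0)"
      unfolding lp_sum_finite[OF A.finite_I] by (rule sum.cong) (auto simp: mv)
    also have "\<dots> = cmod (f j) powr p" using assms A.finite_I by simp
    also have "\<dots> \<le> lp_sum p I f"
      unfolding lp_sum_finite[OF A.finite_I]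
      using member_le_sum[of j I "\<lambda>j. cmod (f j) powr p"] assms A.finite_I by simp
    finally show ?thesis .
  qed
  then show ?thesis using A.nrm_le_1_iff[OF A.munit(1)[OF assms]] by blast
qed

text \<open>The elements \<open>\<phi> (munit i r)\<close> and \<open>\<phi> (munit r i)\<close> are contractions with product the coordinate
  projection \<open>\<phi> (munit i i)\<close>, so \<open>partial_isometry_row\<close> applies.\<close>

lemma row_monomial:
  assumes r: "r \<in> I" and i: "i \<in> I" and blk: "blk r = blk i"
    and y: "y \<in> J" "\<phi>R (A.munit r r) y y = 1"
  shows "\<exists>z\<in>J. \<phi>R (A.munit i i) z z = 1 \<and> blkB z = blkB y \<and> cmod (\<phi>R (A.munit r i) y z) = 1 \<and>
    (\<forall>k. k \<noteq> z \<longrightarrow> \<phi>R (A.munit r i) y k = 0)"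
proof -
  define S where "S = {z\<in>J. \<phi>R (A.munit i i) z z = 1}"
  note Eri = A.munit(1)[OF r i blk] and Eir = A.munit(1)[OF i r blk[symmetric]]
    and Eii = A.munit(1)[OF i i refl] and Err = A.munit(1)[OF r r refl]
  have S0: "\<phi>R (A.munit i i) k k = 0" if "k \<in> J" "k \<notin> S" for k
    using munit_entry[OF i, of k] that by (auto simp: S_def)
  have "\<exists>z\<in>S. cmod (\<phi>R (A.munit r i) y z) = 1 \<and> (\<forall>k\<in>J. k \<noteq> z \<longrightarrow> \<phi>R (A.munit r i) y k = 0)"
  proof (rule partial_isometry_row[OF B.finite_I B.p_ge_1 p_neq_2])
    show "S \<subseteq> J" by (auto simp: S_def)
    show "lp_sum p J (mv J (\<phi>R (A.munit i r)) f) \<le> lp_sum p J f" for f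
      by (rule \<phi>_contraction[OF Eir nrm_munit_le[OF i r blk[symmetric]]])
    show "lp_sum p J (mv J (\<phi>R (A.munit r i)) f) \<le> lp_sum p J f" for f
      by (rule \<phi>_contraction[OF Eri nrm_munit_le[OF r i blk]])
    show "(\<Sum>k\<in>J. \<phi>R (A.munit i r) j k * \<phi>R (A.munit r i) k l) = (if j = l \<and> j \<in> S then 1 else 0)"
      if "j \<in> J" "l \<in> J" for j l
      using that munit_diagonal[OF i, of j l] S0[of j]
      by (auto simp: \<phi>R_mult[symmetric] Eri Eir A.mult_munit_munit i r blk S_def)
    show "\<phi>R (A.munit i r) j k = 0" if "j \<in> J" "k \<in> J" "j \<notin> S" for j k
      using mult_diagonal_left[OF Eii Eir munit_diagonal[OF i] that(1), of k] S0[OF that(1,3)]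
      by (simp add: A.mult_munit_munit i r blk)
    show "\<phi>R (A.munit r i) k j = 0" if "j \<in> J" "k \<in> J" "j \<notin> S" for j k
      using mult_diagonal_right[OF Eri Eii munit_diagonal[OF i] that(1), of k] S0[OF that(1,3)]
      by (simp add: A.mult_munit_munit i r blk)
    show "(\<Sum>k\<in>J. \<phi>R (A.munit r i) y k * \<phi>R (A.munit i r) k y) = 1"
      using y by (simp add: \<phi>R_mult[symmetric] Eri Eir A.mult_munit_munit i r blk)
  qed (rule y(1))
  then obtain z where z: "z \<in> J" "\<phi>R (A.munit i i) z z = 1" "cmod (\<phi>R (A.munit r i) y z) = 1"
    "\<And>k. k \<in> J \<Longrightarrow> k \<noteq> z \<Longrightarrow> \<phi>R (A.munit r i) y k = 0" by (auto simp: S_def)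
  have "\<phi>R (A.munit r i) y z \<noteq> 0" using z(3) by auto
  then have "blkB z = blkB y" using B.R_support[OF \<phi>_closed[OF Eri], of y z] by simp
  moreover have "\<phi>R (A.munit r i) y k = 0" if "k \<noteq> z" for k
    using z(4)[of k] that B.R_outside[OF \<phi>_closed[OF Eri], of y k] by blast
  ultimately show ?thesis using z by blast
qed

text \<open>Expanding \<open>b\<close> in matrix units, \<open>munit r i \<otimes> b\<close> only sees row \<open>i\<close> of \<open>b\<close> and moves it to row \<open>r\<close>.\<close>

lemma row_expansion:
  assumes r: "r \<in> I" and i: "i \<in> I" and blk: "blk r = blk i" and b: "b \<in> carrier A"
  shows "\<phi>R (A.munit r i \<otimes>\<^bsub>A\<^esub> b) y k =
    (\<Sum>j\<in>I. R b i j * (if blk j = blk r then \<phi>R (A.munit r j) y k else 0))"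
  using b
proof (induction b rule: A.munit_induct[consumes 1])
  case 1
  then show ?case using A.munit(1)[OF r i blk] by (simp add: \<phi>_zero)
next
  case (2 a s t c)
  note Eri = A.munit(1)[OF r i blk] and Est = A.munit[OF 2(2-4)]
  have prod: "A.munit r i \<otimes>\<^bsub>A\<^esub> A.munit s t = (if i = s then A.munit r t else \<zero>\<^bsub>A\<^esub>)"
  proof (cases "i = s")
    case True
    then show ?thesis using A.mult_munit_munit[of r i t] r i 2 blk by simp
  next
    case False
    have "A.munit r i \<otimes>\<^bsub>A\<^esub> A.munit s t = \<zero>\<^bsub>A\<^esub>"
    proof (rule A.R_ext)
      show "R (A.munit r i \<otimes>\<^bsub>A\<^esub> A.munit s t) u v = R \<zero>\<^bsub>A\<^esub> u v" for u v
        unfolding A.R_mult[OF Eri Est(1)] A.R_zero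
        by (rule sum.neutral) (use False in \<open>auto simp: A.munit[OF r i blk] Est\<close>)
    qed (use Eri Est in \<open>auto intro: A.mult_closed\<close>)
    then show ?thesis using False by simp
  qed
  have Ert: "A.munit r t \<in> carrier A" if "i = s" using A.munit(1)[of r t] r 2 blk that by simp
  have "A.munit r i \<otimes>\<^bsub>A\<^esub> (a \<oplus>\<^bsub>A\<^esub> c \<odot>\<^bsub>A\<^esub> A.munit s t) =
      A.munit r i \<otimes>\<^bsub>A\<^esub> a \<oplus>\<^bsub>A\<^esub> c \<odot>\<^bsub>A\<^esub> (A.munit r i \<otimes>\<^bsub>A\<^esub> A.munit s t)"
    using Eri Est(1) 2(1) by (simp add: A.mult_distr_right A.smult_mult_right)
  then have "\<phi>R (A.munit r i \<otimes>\<^bsub>A\<^esub> (a \<oplus>\<^bsub>A\<^esub> c \<odot>\<^bsub>A\<^esub> A.munit s t)) y k =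
      \<phi>R (A.munit r i \<otimes>\<^bsub>A\<^esub> a) y k + c * (if i = s then \<phi>R (A.munit r t) y k else 0)"
    using Eri Est(1) 2(1) Ert
    by (auto simp: prod \<phi>_add \<phi>_smult \<phi>_closed A.mult_closed B.R_add B.R_smult \<phi>_zero)
  also have "c * (if i = s then \<phi>R (A.munit r t) y k else 0) =
      (\<Sum>j\<in>I. c * (if i = s \<and> j = t then 1 else 0) * (if blk j = blk r then \<phi>R (A.munit r j) y k else 0))"
  proof -
    have "(\<Sum>j\<in>I. c * (if i = s \<and> j = t then 1 else 0) * (if blk j = blk r then \<phi>R (A.munit r j) y k else 0)) =
        (\<Sum>j\<in>I. if j = t then c * (if i = s then \<phi>R (A.munit r t) y k else 0) else 0)"
      using 2(4) blk by (intro sum.cong) auto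
    then show ?thesis using 2(3) A.finite_I by simp
  qed
  also have "\<phi>R (A.munit r i \<otimes>\<^bsub>A\<^esub> a) y k + \<dots> =
      (\<Sum>j\<in>I. R (a \<oplus>\<^bsub>A\<^esub> c \<odot>\<^bsub>A\<^esub> A.munit s t) i j * (if blk j = blk r then \<phi>R (A.munit r j) y k else 0))"
    unfolding 2(5) sum.distrib[symmetric]
    by (rule sum.cong) (use 2(1) Est in \<open>auto simp: A.R_add A.R_smult distrib_right\<close>)
  finally show ?case .
qed

text \<open>The space of the domain, restricted to a set \<open>K\<close> of coordinates that is a union of blocks, is
  carried by \<open>\<sigma>\<close> onto coordinates of the codomain.  Each block of \<open>K\<close> is placed by choosing one of
  its coordinates \<open>r\<close> and a coordinate \<open>y\<close> in the range of \<open>\<phi> (munit r r)\<close>: the rows \<open>y\<close> of the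
  \<open>\<phi> (munit r i)\<close> then determine the position \<open>\<sigma> i\<close> and the phase \<open>w i\<close> of the other coordinates.\<close>

lemma coordinate_embedding:
  assumes K: "K \<subseteq> I" and T: "\<And>y z. y \<in> T \<Longrightarrow> z \<in> J \<Longrightarrow> blkB y = blkB z \<Longrightarrow> z \<in> T" "T \<subseteq> J"
    and ex: "\<And>i. i \<in> K \<Longrightarrow> \<exists>y\<in>T. \<phi>R (A.munit i i) y y = 1"
    and Kblk: "\<And>i j. i \<in> K \<Longrightarrow> j \<in> I \<Longrightarrow> blk i = blk j \<Longrightarrow> j \<in> K"
  shows "\<exists>\<sigma> w. inj_on \<sigma> K \<and> (\<forall>i\<in>K. \<sigma> i \<in> T \<and> cmod (w i) = 1) \<and>
    (\<forall>b\<in>carrier A. \<forall>f. \<forall>i\<in>K. w i * mv J (\<phi>R b) f (\<sigma> i) = mv I (R b) (\<lambda>j. w j * f (\<sigma> j)) i)"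
proof -
  define root where "root i = (SOME r. r \<in> K \<and> blk r = blk i)" for i
  have root: "root i \<in> K" "blk (root i) = blk i" if "i \<in> K" for i
    using someI[of "\<lambda>r. r \<in> K \<and> blk r = blk i" i] that by (auto simp: root_def)
  have root_eq: "root i = root j" if "blk i = blk j" for i j using that by (simp add: root_def)
  obtain y where y: "\<And>i. i \<in> K \<Longrightarrow> y i \<in> T" "\<And>i. i \<in> K \<Longrightarrow> \<phi>R (A.munit i i) (y i) (y i) = 1"
    using ex by metis
  define w where "w i k = \<phi>R (A.munit (root i) i) (y (root i)) k" for i k
  have "\<exists>z\<in>J. \<phi>R (A.munit i i) z z = 1 \<and> blkB z = blkB (y (root i)) \<and> cmod (w i z) = 1 \<and>
      (\<forall>k. k \<noteq> z \<longrightarrow> w i k = 0)" if i: "i \<in> K" for i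
    unfolding w_def by (rule row_monomial) (use K i T root[OF i] y[OF root(1)[OF i]] in auto)
  then obtain \<sigma> where \<sigma>: "\<And>i. i \<in> K \<Longrightarrow> \<sigma> i \<in> J" "\<And>i. i \<in> K \<Longrightarrow> \<phi>R (A.munit i i) (\<sigma> i) (\<sigma> i) = 1"
    "\<And>i. i \<in> K \<Longrightarrow> blkB (\<sigma> i) = blkB (y (root i))" "\<And>i. i \<in> K \<Longrightarrow> cmod (w i (\<sigma> i)) = 1"
    "\<And>i k. i \<in> K \<Longrightarrow> k \<noteq> \<sigma> i \<Longrightarrow> w i k = 0"
    by metis
  have "inj_on \<sigma> K"
  proof (rule inj_onI, rule ccontr)
    fix i j assume ij: "i \<in> K" "j \<in> K" "\<sigma> i = \<sigma> j" "i \<noteq> j"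
    have c: "i \<in> I" "j \<in> I" using ij K by auto
    note E = A.munit[OF c(1) c(1) refl] and F = A.munit[OF c(2) c(2) refl]
    have "A.munit i i \<otimes>\<^bsub>A\<^esub> A.munit j j = \<zero>\<^bsub>A\<^esub>"
    proof (rule A.R_ext)
      show "R (A.munit i i \<otimes>\<^bsub>A\<^esub> A.munit j j) u v = R \<zero>\<^bsub>A\<^esub> u v" for u v
        unfolding A.R_mult[OF E(1) F(1)] A.R_zero by (rule sum.neutral) (use ij in \<open>auto simp: E F\<close>)
    qed (use E F in \<open>auto intro: A.mult_closed\<close>)
    then have "\<phi>R (A.munit i i) (\<sigma> i) (\<sigma> i) * \<phi>R (A.munit j j) (\<sigma> i) (\<sigma> i) = 0"
      using mult_diagonal_left[OF E(1) F(1) munit_diagonal[OF c(1)] \<sigma>(1)[OF ij(1)], of "\<sigma> i"]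
      by (simp add: \<phi>_zero)
    then show False using \<sigma>(2)[OF ij(1)] \<sigma>(2)[OF ij(2)] ij(3) by simp
  qed
  moreover have "\<sigma> i \<in> T" if "i \<in> K" for i
    using T(1)[OF y(1)[OF root(1)[OF that]] \<sigma>(1)[OF that]] \<sigma>(3)[OF that] by simp
  moreover have "w i (\<sigma> i) * mv J (\<phi>R b) f (\<sigma> i) = mv I (R b) (\<lambda>j. w j (\<sigma> j) * f (\<sigma> j)) i"
    if b: "b \<in> carrier A" and i: "i \<in> K" for b f i
  proof -
    have iI: "i \<in> I" and rI: "root i \<in> I" using i root[OF i] K by auto
    have row: "w i (\<sigma> i) * \<phi>R b (\<sigma> i) k =
        (\<Sum>j\<in>I. R b i j * (if blk j = blk (root i) then \<phi>R (A.munit (root i) j) (y (root i)) k else 0))" for k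
    proof -
      have "\<phi>R (A.munit (root i) i \<otimes>\<^bsub>A\<^esub> b) (y (root i)) k = (\<Sum>l\<in>J. w i l * \<phi>R b l k)"
        using A.munit(1)[OF rI iI root(2)[OF i]] b by (simp add: \<phi>R_mult w_def)
      also have "\<dots> = (\<Sum>l\<in>{\<sigma> i}. w i l * \<phi>R b l k)"
        by (rule sum.mono_neutral_right) (use \<sigma>(1,5)[OF i] B.finite_I in auto)
      finally show ?thesis using row_expansion[OF rI iI root(2)[OF i] b] by simp
    qed
    have summand: "R b i j * (if blk j = blk (root i) then \<phi>R (A.munit (root i) j) (y (root i)) k else 0) =
        (if k = \<sigma> j then R b i j * w j (\<sigma> j) else 0)" if j: "j \<in> I" for j k
    proof (cases "blk j = blk i")
      case True
      have "j \<in> K" using Kblk[OF i j] True by simp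
      moreover have "root j = root i" by (rule root_eq) (rule True)
      ultimately show ?thesis using True root(2)[OF i] \<sigma>(5)[of j k] by (auto simp: w_def)
    next
      case False
      then show ?thesis using A.R_outside[OF b, of i j] by auto
    qed
    have "w i (\<sigma> i) * mv J (\<phi>R b) f (\<sigma> i) = (\<Sum>k\<in>J. \<Sum>j\<in>I. if k = \<sigma> j then R b i j * w j (\<sigma> j) * f (\<sigma> j) else 0)"
      unfolding mv_def sum_distrib_left
      by (rule sum.cong) (auto simp: mult.assoc[symmetric] row summand sum_distrib_right intro!: sum.cong)
    also have "\<dots> = (\<Sum>j\<in>I. \<Sum>k\<in>J. if k = \<sigma> j then R b i j * w j (\<sigma> j) * f (\<sigma> j) else 0)"
      by (rule sum.swap)
    also have "\<dots> = (\<Sum>j\<in>I. R b i j * w j (\<sigma> j) * f (\<sigma> j))"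
    proof (rule sum.cong[OF refl])
      fix j assume j: "j \<in> I"
      show "(\<Sum>k\<in>J. if k = \<sigma> j then R b i j * w j (\<sigma> j) * f (\<sigma> j) else 0) = R b i j * w j (\<sigma> j) * f (\<sigma> j)"
      proof (cases "blk j = blk i")
        case True
        then have "j \<in> K" using Kblk[OF i j] by simp
        then show ?thesis using \<sigma>(1) B.finite_I by simp
      next
        case False
        then have "R b i j = 0" using A.R_outside[OF b, of i j] by auto
        then show ?thesis by (auto intro!: sum.neutral)
      qed
    qed
    finally show ?thesis by (simp add: mv_def mult.assoc)
  qed
  ultimately show ?thesis
    using \<sigma>(4) by (intro exI[of _ \<sigma>] exI[of _ "\<lambda>i. w i (\<sigma> i)"]) blast
qed

text \<open>A coordinate projection is the sum of the minimal coordinate projections below it.\<close>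

lemma dg_indicator_zero:
  assumes "N \<subseteq> I" "\<And>i. i \<in> N \<Longrightarrow> \<phi> (A.munit i i) = \<zero>\<^bsub>B\<^esub>"
  shows "\<phi> (A.dg (\<lambda>i. if i \<in> N then 1 else 0)) = \<zero>\<^bsub>B\<^esub>"
  using finite_subset[OF assms(1) A.finite_I] assms
proof (induction N)
  case empty
  have "A.dg (\<lambda>i. if i \<in> {} then 1 else 0) = \<zero>\<^bsub>A\<^esub>" by (rule A.R_ext) (auto simp: A.dg)
  then show ?case by (simp add: \<phi>_zero)
next
  case (insert k N)
  then have k: "k \<in> I" by auto
  note E = A.munit[OF k k refl]
  have "A.dg (\<lambda>i. if i \<in> insert k N then 1 else 0) = A.dg (\<lambda>i. if i \<in> N then 1 else 0) \<oplus>\<^bsub>A\<^esub> A.munit k k"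
    by (rule A.R_ext) (use insert(2) in \<open>auto simp: A.dg A.R_add E\<close>)
  then show ?case using insert E by (simp add: \<phi>_add A.dg)
qed

end

text \<open>The image of the identity is a sum of hermitian idempotents, each of which is diagonal.\<close>

lemma spatial_hom_block_hom:
  assumes p2: "p \<noteq> 2" and A: "block_algebra A p I blk R" and B: "block_algebra B p J blkB RB"
    and \<phi>: "spatial_hom p A B \<phi>" and contr: "contractive A B \<phi>"
  shows "block_hom A p I blk R B J blkB RB \<phi>"
proof -
  interpret A: block_algebra A p I blk R by fact
  interpret B: block_algebra B p J blkB RB by fact
  obtain N d \<psi> where \<psi>: "\<psi> \<in> isometric_iso (matrix_sum p N d) A"
    and herm: "\<And>k. k \<in> {1..N} \<Longrightarrow> hermitian_idempotent B (\<phi> (\<psi> (summand_embedding {1..N}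
      (\<lambda>k. matrix_algebra p (d k)) k \<one>\<^bsub>matrix_algebra p (d k)\<^esub>)))" and hom: "\<phi> \<in> alg_hom A B"
    using \<phi> unfolding spatial_hom_def matrix_decomposition_def Let_def by blast
  define M where "M k = matrix_algebra p (d k)" for k
  define S where "S = direct_sum {1..N} M"
  define u where "u K = (\<lambda>k\<in>{1..N}. if k \<in> K then \<one>\<^bsub>M k\<^esub> else \<zero>\<^bsub>M k\<^esub>)" for K
  have \<psi>h: "\<psi> \<in> alg_hom S A" and \<psi>b: "bij_betw \<psi> (carrier S) (carrier A)"
    using \<psi> by (auto simp: isometric_iso_def S_def M_def[abs_def])
  interpret L: complex_normed_space "lps p {1..d k}" for k by (rule complex_normed_space_Lp[OF A.p_ge_1])
  interpret M: complex_normed_space "M k" for k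
    unfolding M_def matrix_algebra_def by (rule L.complex_normed_space_BO)
  have M_one: "\<one>\<^bsub>M k\<^esub> \<in> carrier (M k)" for k
    unfolding M_def matrix_algebra_def by (rule L.BO_one_closed)
  have M_one_left: "\<one>\<^bsub>M k\<^esub> \<otimes>\<^bsub>M k\<^esub> x = x" if x: "x \<in> carrier (M k)" for k x
  proof (rule bounded_operators_eqI)
    show "\<one>\<^bsub>M k\<^esub> \<otimes>\<^bsub>M k\<^esub> x \<in> carrier (bounded_operators (lps p {1..d k}))"
      using x M_one[of k] L.BO_mult_closed(1) unfolding M_def matrix_algebra_def by blast
    show "x \<in> carrier (bounded_operators (lps p {1..d k}))"
      using x unfolding M_def matrix_algebra_def .
    fix F assume F: "F \<in> carrier (lps p {1..d k})"
    then show "(\<one>\<^bsub>M k\<^esub> \<otimes>\<^bsub>M k\<^esub> x) F = x F"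
      using x bounded_operators_app(1)[of x "lps p {1..d k}" F]
      unfolding M_def matrix_algebra_def by (simp add: bounded_operators_simps compose_def)
  qed
  have u_closed: "u K \<in> carrier S" for K
    using M_one by (auto simp: u_def S_def direct_sum_simps)
  have u_single: "u {k} = summand_embedding {1..N} (\<lambda>k. matrix_algebra p (d k)) k \<one>\<^bsub>matrix_algebra p (d k)\<^esub>" for k
    by (auto simp: u_def M_def summand_embedding_def)
  note closed = alg_homD(2)[OF hom] alg_homD(2)[OF \<psi>h]
  have diag: "RB (\<phi> (\<psi> (u K))) y z = 0" if "K \<subseteq> {1..N}" "y \<noteq> z" for K y z
    using finite_subset[OF that(1) finite_atLeastAtMost] that(1)
  proof (induction K)
    case empty
    have "u {} = 0 \<odot>\<^bsub>S\<^esub> u {}" by (auto simp: u_def S_def direct_sum_simps)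
    then have "\<phi> (\<psi> (u {})) = 0 \<odot>\<^bsub>B\<^esub> \<phi> (\<psi> (u {}))"
      using alg_homD(4)[OF \<psi>h u_closed, of 0 "{}"] alg_homD(4)[OF hom closed(2)[OF u_closed], of 0 "{}"] by simp
    then have "\<phi> (\<psi> (u {})) = \<zero>\<^bsub>B\<^esub>" using closed u_closed by simp
    then show ?case by simp
  next
    case (insert k K)
    have "u (insert k K) = u K \<oplus>\<^bsub>S\<^esub> u {k}"
      using insert(2) M_one by (auto simp: u_def S_def direct_sum_simps restrict_def)
    then have "\<phi> (\<psi> (u (insert k K))) = \<phi> (\<psi> (u K)) \<oplus>\<^bsub>B\<^esub> \<phi> (\<psi> (u {k}))"
      using alg_homD(3)[OF \<psi>h u_closed u_closed] alg_homD(3)[OF hom closed(2)[OF u_closed] closed(2)[OF u_closed]]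
      by simp
    moreover have "RB (\<phi> (\<psi> (u {k}))) y z = 0"
      using B.hermitian_idempotent_diagonal[OF p2 _ that(2)] herm[of k] insert unfolding u_single by auto
    moreover have "RB (\<phi> (\<psi> (u K))) y z = 0" using insert by auto
    ultimately show ?case using closed u_closed by (simp add: B.R_add)
  qed
  have "\<psi> (u {1..N}) = \<one>\<^bsub>A\<^esub>"
  proof -
    have "\<one>\<^bsub>A\<^esub> \<in> \<psi> ` carrier S" using \<psi>b A.one_closed by (simp add: bij_betw_def)
    then obtain x where x: "x \<in> carrier S" "\<psi> x = \<one>\<^bsub>A\<^esub>" by (metis imageE)
    have "u {1..N} \<otimes>\<^bsub>S\<^esub> x = x"
    proof
      fix k
      have "x k \<in> carrier (M k)" if "k \<in> {1..N}"
        using x(1) that by (auto simp: S_def direct_sum_simps)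
      moreover have "x k = undefined" if "k \<notin> {1..N}"
        using x(1) that unfolding S_def direct_sum_simps by (rule PiE_arb)
      ultimately show "(u {1..N} \<otimes>\<^bsub>S\<^esub> x) k = x k"
        by (cases "k \<in> {1..N}") (auto simp: u_def S_def direct_sum_simps M_one_left)
    qed
    then have "\<psi> (u {1..N}) \<otimes>\<^bsub>A\<^esub> \<one>\<^bsub>A\<^esub> = \<one>\<^bsub>A\<^esub>"
      using alg_homD(5)[OF \<psi>h u_closed x(1), of "{1..N}"] x(2) by (simp only:)
    then show ?thesis using closed u_closed by (simp add: A.one_right)
  qed
  then have "RB (\<phi> \<one>\<^bsub>A\<^esub>) y z = 0" if "y \<noteq> z" for y z using diag[of "{1..N}", OF _ that] by simp
  then show ?thesis
    by (intro block_hom.intro block_hom_axioms.intro A B p2 hom contr)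
qed

section \<open>Direct systems of block algebras\<close>

locale block_system =
  fixes Am :: "nat \<Rightarrow> ('a, 'm) normed_module_scheme" and p :: real
    and I :: "nat \<Rightarrow> 'i::countable set" and blk :: "nat \<Rightarrow> 'i \<Rightarrow> nat"
    and R :: "nat \<Rightarrow> 'a \<Rightarrow> 'i \<Rightarrow> 'i \<Rightarrow> complex" and \<phi> :: "nat \<Rightarrow> nat \<Rightarrow> 'a \<Rightarrow> 'a"
  assumes block_hom: "m \<le> n \<Longrightarrow> block_hom (Am m) p (I m) (blk m) (R m) (Am n) (I n) (blk n) (R n) (\<phi> n m)"
    and \<phi>_id: "a \<in> carrier (Am n) \<Longrightarrow> \<phi> n n a = a"
    and \<phi>_comp: "k \<le> m \<Longrightarrow> m \<le> n \<Longrightarrow> a \<in> carrier (Am k) \<Longrightarrow> \<phi> n m (\<phi> m k a) = \<phi> n k a"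
begin

sublocale Al: block_algebra "Am n" p "I n" "blk n" "R n" for n
  using block_hom[OF le_refl, of n] by (rule block_hom.axioms(1))

lemmas \<phi>_closed = block_hom.\<phi>_closed[OF block_hom]
  and \<phi>_add = block_hom.\<phi>_add[OF block_hom]
  and \<phi>_smult = block_hom.\<phi>_smult[OF block_hom]
  and \<phi>_mult = block_hom.\<phi>_mult[OF block_hom]
  and \<phi>_zero = block_hom.\<phi>_zero[OF block_hom]

lemma nrm_\<phi>_le: "m \<le> n \<Longrightarrow> a \<in> carrier (Am m) \<Longrightarrow> nrm (Am n) (\<phi> n m a) \<le> nrm (Am m) a"
  using block_hom.contr[OF block_hom, of m n] by (simp add: contractive_def)

text \<open>The coordinates whose minimal projection is not annihilated at any later stage.  They carry the
  limit norm, and only they can be followed through all stages.\<close>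

definition surv :: "nat \<Rightarrow> 'i set" where
  "surv n = {i \<in> I n. \<forall>m\<ge>n. \<phi> m n (Al.munit n i i) \<noteq> \<zero>\<^bsub>Am m\<^esub>}"

lemma surv_subset: "surv n \<subseteq> I n" and finite_surv: "finite (surv n)"
  using finite_subset[OF _ Al.finite_I[of n], of "surv n"] by (auto simp: surv_def)

text \<open>Minimal projections of the same block factor through one another.\<close>

lemma surv_block:
  assumes i: "i \<in> surv n" and j: "j \<in> I n" and blk: "blk n i = blk n j"
  shows "j \<in> surv n"
proof (rule ccontr)
  have iI: "i \<in> I n" using i surv_subset by auto
  assume "j \<notin> surv n"
  then obtain m where m: "m \<ge> n" "\<phi> m n (Al.munit n j j) = \<zero>\<^bsub>Am m\<^esub>" using j by (auto simp: surv_def)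
  note E = Al.munit(1)[OF iI j blk] Al.munit(1)[OF j j refl] Al.munit(1)[OF j iI blk[symmetric]]
  have "Al.munit n i i = (Al.munit n i j \<otimes>\<^bsub>Am n\<^esub> Al.munit n j j) \<otimes>\<^bsub>Am n\<^esub> Al.munit n j i"
    using iI j blk by (simp add: Al.mult_munit_munit)
  then have "\<phi> m n (Al.munit n i i) =
      (\<phi> m n (Al.munit n i j) \<otimes>\<^bsub>Am m\<^esub> \<phi> m n (Al.munit n j j)) \<otimes>\<^bsub>Am m\<^esub> \<phi> m n (Al.munit n j i)"
    using E by (simp add: \<phi>_mult[OF m(1)] Al.mult_closed)
  also have "\<dots> = \<zero>\<^bsub>Am m\<^esub>" using E m by (simp add: \<phi>_closed)
  finally show False using i m(1) by (simp add: surv_def)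
qed

lemma vanishing_stays:
  assumes "n \<le> m" "m \<le> m'" "a \<in> carrier (Am n)" "\<phi> m n a = \<zero>\<^bsub>Am m\<^esub>"
  shows "\<phi> m' n a = \<zero>\<^bsub>Am m'\<^esub>"
  using \<phi>_comp[OF assms(1-3)] assms \<phi>_zero[OF assms(2)] by simp

text \<open>Finitely many projections that vanish eventually have vanished together at some common stage.\<close>

lemma no_survivors_vanish:
  assumes N: "N \<subseteq> I n - surv n"
  shows "\<exists>m\<ge>n. \<phi> m n (Al.dg n (\<lambda>i. if i \<in> N then 1 else 0)) = \<zero>\<^bsub>Am m\<^esub>"
proof -
  have "\<exists>m\<ge>n. \<phi> m n (Al.munit n i i) = \<zero>\<^bsub>Am m\<^esub>" if "i \<in> N" for i
    using N that by (auto simp: surv_def)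
  then obtain m where m: "\<And>i. i \<in> N \<Longrightarrow> m i \<ge> n" "\<And>i. i \<in> N \<Longrightarrow> \<phi> (m i) n (Al.munit n i i) = \<zero>\<^bsub>Am (m i)\<^esub>"
    by metis
  define M where "M = Max (insert n (m ` N))"
  have finN: "finite N" using N Al.finite_I[of n] finite_subset by blast
  have M: "n \<le> M" "\<And>i. i \<in> N \<Longrightarrow> m i \<le> M" using finN by (auto simp: M_def)
  have "\<phi> M n (Al.munit n i i) = \<zero>\<^bsub>Am M\<^esub>" if "i \<in> N" for i
    using vanishing_stays[OF m(1)[OF that] M(2)[OF that] _ m(2)[OF that]] N that Al.munit(1)[of i n i] by auto
  then have "\<phi> M n (Al.dg n (\<lambda>i. if i \<in> N then 1 else 0)) = \<zero>\<^bsub>Am M\<^esub>"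
    by (intro block_hom.dg_indicator_zero[OF block_hom[OF M(1)]]) (use N in auto)
  then show ?thesis using M(1) by blast
qed

text \<open>The image of a minimal projection is the coordinate projection onto some set \<open>Y\<close>; if \<open>Y\<close> contained
  no survivor, this projection and with it the given one would be annihilated later.\<close>

lemma survivor_has_surviving_child:
  assumes i: "i \<in> surv n"
  shows "\<exists>y\<in>surv (Suc n). R (Suc n) (\<phi> (Suc n) n (Al.munit n i i)) y y = 1"
proof (rule ccontr)
  assume neg: "\<not> ?thesis"
  interpret H: block_hom "Am n" p "I n" "blk n" "R n" "Am (Suc n)" "I (Suc n)" "blk (Suc n)" "R (Suc n)" "\<phi> (Suc n) n"
    by (rule block_hom) simp
  have iI: "i \<in> I n" using i surv_subset by auto
  note E = Al.munit(1)[OF iI iI refl]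
  define Y where "Y = {y \<in> I (Suc n). R (Suc n) (\<phi> (Suc n) n (Al.munit n i i)) y y = 1}"
  have "Y \<subseteq> I (Suc n) - surv (Suc n)" using neg by (auto simp: Y_def)
  then obtain m where m: "m \<ge> Suc n"
    "\<phi> m (Suc n) (Al.dg (Suc n) (\<lambda>y. if y \<in> Y then 1 else 0)) = \<zero>\<^bsub>Am m\<^esub>"
    using no_survivors_vanish by blast
  have "\<phi> (Suc n) n (Al.munit n i i) = Al.dg (Suc n) (\<lambda>y. if y \<in> Y then 1 else 0)"
  proof (rule Al.R_ext)
    fix y z assume "y \<in> I (Suc n)" "z \<in> I (Suc n)"
    then show "R (Suc n) (\<phi> (Suc n) n (Al.munit n i i)) y z =
        R (Suc n) (Al.dg (Suc n) (\<lambda>y. if y \<in> Y then 1 else 0)) y z"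
      using H.munit_entry[OF iI, of y] H.munit_diagonal[OF iI, of y z] by (auto simp: Al.dg Y_def)
  qed (use H.\<phi>_closed[OF E] in \<open>auto simp: Al.dg\<close>)
  then have "\<phi> m n (Al.munit n i i) = \<zero>\<^bsub>Am m\<^esub>"
    using m \<phi>_comp[of n "Suc n" m, OF _ _ E] by simp
  then show False using i m(1) by (auto simp: surv_def)
qed

end

text \<open>Functions on the sets \<open>D n\<close> can be prescribed recursively along injections
  \<open>\<sigma> n : D n \<rightarrow> D (n + 1)\<close>, with arbitrary values outside of the ranges.\<close>

lemma extend_along_injections:
  fixes \<sigma> :: "nat \<Rightarrow> 'i \<Rightarrow> 'i" and g :: "nat \<Rightarrow> 'i \<Rightarrow> 'v \<Rightarrow> 'v" and d :: "nat \<Rightarrow> 'i \<Rightarrow> 'v"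
  assumes inj: "\<And>n. inj_on (\<sigma> n) (D n)"
  shows "\<exists>h. h 0 = d 0 \<and> (\<forall>n. \<forall>i\<in>D n. h (Suc n) (\<sigma> n i) = g n i (h n i)) \<and>
    (\<forall>n z. z \<notin> \<sigma> n ` D n \<longrightarrow> h (Suc n) z = d (Suc n) z)"
proof -
  define step where "step n h z = (if z \<in> \<sigma> n ` D n
    then g n (inv_into (D n) (\<sigma> n) z) (h (inv_into (D n) (\<sigma> n) z)) else d (Suc n) z)" for n h z
  define h where "h = rec_nat (d 0) step"
  have "h 0 = d 0" and Suc: "h (Suc n) = step n (h n)" for n by (simp_all add: h_def)
  moreover have "h (Suc n) (\<sigma> n i) = g n i (h n i)" if "i \<in> D n" for n i
    using that inj[of n] by (simp add: Suc step_def)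
  moreover have "h (Suc n) z = d (Suc n) z" if "z \<notin> \<sigma> n ` D n" for n z
    using that by (simp add: Suc step_def)
  ultimately show ?thesis by blast
qed

text \<open>The surviving coordinates of all stages are labelled by real numbers in such a way that the
  label of a coordinate does not change when it is carried to the next stage by \<open>\<sigma>\<close>, and the phases
  \<open>ph\<close> make the identification of the spaces of consecutive stages equivariant.\<close>

locale labelled_system = block_system Am p I blk R \<phi>
  for Am :: "nat \<Rightarrow> ('a, 'm) normed_module_scheme" and p
    and I :: "nat \<Rightarrow> 'i::countable set" and blk R \<phi> +
  fixes \<sigma> :: "nat \<Rightarrow> 'i \<Rightarrow> 'i" and lab :: "nat \<Rightarrow> 'i \<Rightarrow> real" and ph :: "nat \<Rightarrow> 'i \<Rightarrow> complex"
  assumes inj_lab: "inj_on (lab n) (surv n)"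
    and \<sigma>_surv: "i \<in> surv n \<Longrightarrow> \<sigma> n i \<in> surv (Suc n)"
    and lab_\<sigma>: "i \<in> surv n \<Longrightarrow> lab (Suc n) (\<sigma> n i) = lab n i"
    and cmod_ph: "i \<in> surv n \<Longrightarrow> cmod (ph n i) = 1"
    and equivariant: "i \<in> surv n \<Longrightarrow> b \<in> carrier (Am n) \<Longrightarrow>
      cnj (ph (Suc n) (\<sigma> n i)) * mv (I (Suc n)) (R (Suc n) (\<phi> (Suc n) n b))
        (\<lambda>j. ph (Suc n) j * F (lab (Suc n) j)) (\<sigma> n i) =
      cnj (ph n i) * mv (I n) (R n b) (\<lambda>j. ph n j * F (lab n j)) i"

text \<open>By \<open>surv_block\<close> a row that belongs to a survivor has all its nonzero entries at survivors.\<close>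

lemma (in block_system) mv_surv_cong:
  assumes "i \<in> surv n" "b \<in> carrier (Am n)" "\<And>j. j \<in> surv n \<Longrightarrow> f j = g j"
  shows "mv (I n) (R n b) f i = mv (I n) (R n b) g i"
  unfolding mv_def
proof (rule sum.cong[OF refl])
  fix j assume "j \<in> I n"
  then show "R n b i j * f j = R n b i j * g j"
    using assms(3)[of j] surv_block[OF assms(1), of j] Al.R_support[OF assms(2), of i j] by (cases "R n b i j = 0") auto
qed

text \<open>A coordinate in the range of the embedding inherits its label and, up to the phase \<open>w\<close>, its phase.
  Any other coordinate is new, and its label encodes the stage together with the coordinate, so that
  labels that arise at different stages are distinct.\<close>

lemma (in block_system) labelled_system_exists:
  "\<exists>\<sigma> lab ph. labelled_system Am p I blk R \<phi> \<sigma> lab ph"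
proof -
  have "\<forall>n. \<exists>s. inj_on (fst s) (surv n) \<and> (\<forall>i\<in>surv n. fst s i \<in> surv (Suc n) \<and> cmod (snd s i) = 1) \<and>
    (\<forall>b\<in>carrier (Am n). \<forall>f. \<forall>i\<in>surv n.
      snd s i * mv (I (Suc n)) (R (Suc n) (\<phi> (Suc n) n b)) f (fst s i) =
      mv (I n) (R n b) (\<lambda>j. snd s j * f (fst s j)) i)"
  proof
    fix n
    interpret H: block_hom "Am n" p "I n" "blk n" "R n" "Am (Suc n)" "I (Suc n)" "blk (Suc n)" "R (Suc n)" "\<phi> (Suc n) n"
      by (rule block_hom) simp
    have "\<exists>\<sigma> w. inj_on \<sigma> (surv n) \<and> (\<forall>i\<in>surv n. \<sigma> i \<in> surv (Suc n) \<and> cmod (w i) = 1) \<and>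
      (\<forall>b\<in>carrier (Am n). \<forall>f. \<forall>i\<in>surv n. w i * mv (I (Suc n)) (R (Suc n) (\<phi> (Suc n) n b)) f (\<sigma> i) =
        mv (I n) (R n b) (\<lambda>j. w j * f (\<sigma> j)) i)"
      by (rule H.coordinate_embedding)
        (use surv_subset surv_block survivor_has_surviving_child in auto)
    then obtain \<sigma> w where "inj_on \<sigma> (surv n) \<and> (\<forall>i\<in>surv n. \<sigma> i \<in> surv (Suc n) \<and> cmod (w i) = 1) \<and>
      (\<forall>b\<in>carrier (Am n). \<forall>f. \<forall>i\<in>surv n. w i * mv (I (Suc n)) (R (Suc n) (\<phi> (Suc n) n b)) f (\<sigma> i) =
        mv (I n) (R n b) (\<lambda>j. w j * f (\<sigma> j)) i)"
      by blast
    then show "\<exists>s. inj_on (fst s) (surv n) \<and> (\<forall>i\<in>surv n. fst s i \<in> surv (Suc n) \<and> cmod (snd s i) = 1) \<and>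
      (\<forall>b\<in>carrier (Am n). \<forall>f. \<forall>i\<in>surv n.
        snd s i * mv (I (Suc n)) (R (Suc n) (\<phi> (Suc n) n b)) f (fst s i) =
        mv (I n) (R n b) (\<lambda>j. snd s j * f (fst s j)) i)"
      by (intro exI[of _ "(\<sigma>, w)"]) simp
  qed
  from choice[OF this] obtain s where s:
    "\<And>n. inj_on (fst (s n)) (surv n)"
    "\<And>n i. i \<in> surv n \<Longrightarrow> fst (s n) i \<in> surv (Suc n)"
    "\<And>n i. i \<in> surv n \<Longrightarrow> cmod (snd (s n) i) = 1"
    "\<And>n b f i. b \<in> carrier (Am n) \<Longrightarrow> i \<in> surv n \<Longrightarrow>
      snd (s n) i * mv (I (Suc n)) (R (Suc n) (\<phi> (Suc n) n b)) f (fst (s n) i) =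
      mv (I n) (R n b) (\<lambda>j. snd (s n) j * f (fst (s n) j)) i"
    by blast
  define \<sigma> where "\<sigma> n = fst (s n)" for n
  define w where "w n = snd (s n)" for n
  define enc where "enc n i = real (to_nat (n, i))" for n :: nat and i :: 'i
  have enc: "enc n i = enc m j \<longleftrightarrow> n = m \<and> i = j" for n m i j by (simp add: enc_def)
  note \<sigma> = s(1,2)[folded \<sigma>_def] and w = s(3)[folded w_def] and eqv = s(4)[folded \<sigma>_def w_def]
  obtain lab where lab: "lab 0 = enc 0" "\<And>n i. i \<in> surv n \<Longrightarrow> lab (Suc n) (\<sigma> n i) = lab n i"
    "\<And>n z. z \<notin> \<sigma> n ` surv n \<Longrightarrow> lab (Suc n) z = enc (Suc n) z"
    using extend_along_injections[of \<sigma> surv enc "\<lambda>_ _ v. v"] \<sigma>(1) by blast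
  obtain ph where ph: "ph 0 = (\<lambda>_. 1)" "\<And>n i. i \<in> surv n \<Longrightarrow> ph (Suc n) (\<sigma> n i) = cnj (w n i) * ph n i"
    "\<And>n z. z \<notin> \<sigma> n ` surv n \<Longrightarrow> ph (Suc n) z = (1 :: complex)"
    using extend_along_injections[of \<sigma> surv "\<lambda>_ _. 1" "\<lambda>n i v. cnj (w n i) * v"] \<sigma>(1) by blast
  have lab_range: "\<exists>m\<le>n. \<exists>j. lab n i = enc m j" for n i
  proof (induction n arbitrary: i)
    case 0
    then show ?case using lab(1) by auto
  next
    case (Suc n)
    show ?case
    proof (cases "i \<in> \<sigma> n ` surv n")
      case True
      then obtain j where j: "j \<in> surv n" "i = \<sigma> n j" by auto
      obtain m k where "m \<le> n" "lab n j = enc m k" using Suc[of j] by blast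
      then show ?thesis unfolding j(2) lab(2)[OF j(1)] using le_SucI by blast
    next
      case False
      show ?thesis using lab(3)[OF False] by blast
    qed
  qed
  have fresh: "lab n i \<noteq> enc (Suc n) z" for n i z
    using lab_range[of n i] enc by fastforce
  have "inj_on (lab n) (surv n)" for n
  proof (induction n)
    case 0
    then show ?case unfolding lab(1) by (auto simp: inj_on_def enc)
  next
    case (Suc n)
    show ?case
    proof (rule inj_onI)
      fix y z assume yz: "y \<in> surv (Suc n)" "z \<in> surv (Suc n)" "lab (Suc n) y = lab (Suc n) z"
      show "y = z"
      proof (cases "y \<in> \<sigma> n ` surv n")
        case True
        then obtain i where i: "i \<in> surv n" "y = \<sigma> n i" by auto
        have y: "lab (Suc n) y = lab n i" using lab(2)[OF i(1)] i(2) by simp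
        show ?thesis
        proof (cases "z \<in> \<sigma> n ` surv n")
          case True
          then obtain j where j: "j \<in> surv n" "z = \<sigma> n j" by auto
          then have "lab n i = lab n j" using yz(3) y lab(2)[OF j(1)] by simp
          then show ?thesis using Suc i j by (auto dest: inj_onD)
        next
          case False
          then show ?thesis using lab(3)[OF False] yz(3) y fresh[of n i z] by simp
        qed
      next
        case F: False
        show ?thesis
        proof (cases "z \<in> \<sigma> n ` surv n")
          case True
          then obtain j where j: "j \<in> surv n" "z = \<sigma> n j" by auto
          have "lab n j = enc (Suc n) y" using lab(3)[OF F] yz(3) lab(2)[OF j(1)] j(2) by metis
          then show ?thesis using fresh[of n j y] by blast
        next
          case False
          have "enc (Suc n) y = enc (Suc n) z" using lab(3)[OF F] lab(3)[OF False] yz(3) by metis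
          then show ?thesis by (simp add: enc)
        qed
      qed
    qed
  qed
  moreover have ph1: "cmod (ph n i) = 1" for n i
  proof (induction n arbitrary: i)
    case 0
    then show ?case by (simp add: ph(1))
  next
    case (Suc n)
    show ?case
    proof (cases "i \<in> \<sigma> n ` surv n")
      case True
      then obtain j where j: "j \<in> surv n" "i = \<sigma> n j" by auto
      then show ?thesis using ph(2)[OF j(1)] w[OF j(1)] Suc[of j] by (simp add: norm_mult)
    next
      case False
      then show ?thesis using ph(3)[OF False] by simp
    qed
  qed
  moreover have "cnj (ph (Suc n) (\<sigma> n i)) * mv (I (Suc n)) (R (Suc n) (\<phi> (Suc n) n b))
        (\<lambda>j. ph (Suc n) j * F (lab (Suc n) j)) (\<sigma> n i) =
      cnj (ph n i) * mv (I n) (R n b) (\<lambda>j. ph n j * F (lab n j)) i"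
    if i: "i \<in> surv n" and b: "b \<in> carrier (Am n)" for i n b F
  proof -
    define v where "v = mv (I (Suc n)) (R (Suc n) (\<phi> (Suc n) n b)) (\<lambda>j. ph (Suc n) j * F (lab (Suc n) j)) (\<sigma> n i)"
    have ww: "w n j * cnj (w n j) = 1" if "j \<in> surv n" for j
      using w[OF that] complex_norm_square[of "w n j"] by simp
    have "w n i * v = mv (I n) (R n b) (\<lambda>j. w n j * (ph (Suc n) (\<sigma> n j) * F (lab (Suc n) (\<sigma> n j)))) i"
      unfolding v_def by (rule eqv[OF b i])
    also have "\<dots> = mv (I n) (R n b) (\<lambda>j. ph n j * F (lab n j)) i"
      by (rule mv_surv_cong[OF i b]) (simp add: ph(2) lab(2) ww mult.assoc[symmetric])
    finally show ?thesis
      using ph(2)[OF i] unfolding v_def[symmetric] by (simp add: mult_ac)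
  qed
  ultimately have "labelled_system Am p I blk R \<phi> \<sigma> lab ph"
    by (intro labelled_system.intro labelled_system_axioms.intro block_system_axioms \<sigma>(2) lab(2))
  then show ?thesis by blast
qed

section \<open>The representation of a direct system of block algebras\<close>

context labelled_system
begin

definition C :: "real set" where
  "C = (\<Union>n. lab n ` surv n)"

text \<open>The restriction of a family on \<open>C\<close> to the coordinates of stage \<open>k\<close>, with phases removed so that
  the matrices of stage \<open>k\<close> act on it.\<close>

definition fr :: "nat \<Rightarrow> (real \<Rightarrow> complex) \<Rightarrow> 'i \<Rightarrow> complex" where
  "fr k F j = ph k j * F (lab k j)"

definition val :: "nat \<Rightarrow> 'a \<Rightarrow> (real \<Rightarrow> complex) \<Rightarrow> nat \<Rightarrow> 'i \<Rightarrow> complex" where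
  "val n a F k i = cnj (ph k i) * mv (I k) (R k (\<phi> k n a)) (fr k F) i"

text \<open>The value of the action at a label does not depend on the stage at which it is computed.\<close>

lemma lift_coordinate:
  assumes "k \<le> m" "i \<in> surv k"
  shows "\<exists>j\<in>surv m. lab m j = lab k i \<and>
    (\<forall>n a F. n \<le> k \<longrightarrow> a \<in> carrier (Am n) \<longrightarrow> val n a F m j = val n a F k i)"
  using assms(1)
proof (induction m rule: dec_induct)
  case base
  then show ?case using assms by blast
next
  case (step m)
  then obtain j where j: "j \<in> surv m" "lab m j = lab k i"
    "\<And>n a F. n \<le> k \<Longrightarrow> a \<in> carrier (Am n) \<Longrightarrow> val n a F m j = val n a F k i" by blast
  have "val n a F (Suc m) (\<sigma> m j) = val n a F m j" if n: "n \<le> k" "a \<in> carrier (Am n)" for n a F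
  proof -
    have "\<phi> (Suc m) n a = \<phi> (Suc m) m (\<phi> m n a)"
      using \<phi>_comp[of n m "Suc m" a] n step by simp
    moreover have "\<phi> m n a \<in> carrier (Am m)" using \<phi>_closed[of n m a] n step by simp
    ultimately show ?thesis
      using equivariant[OF j(1), of "\<phi> m n a" F] by (simp add: val_def fr_def[abs_def])
  qed
  then show ?case
    using \<sigma>_surv[OF j(1)] lab_\<sigma>[OF j(1)] j by (intro bexI[of _ "\<sigma> m j"]) auto
qed

lemma C_lab:
  assumes "c \<in> C"
  shows "\<exists>k\<ge>n. \<exists>i\<in>surv k. lab k i = c"
proof -
  obtain k i where ki: "i \<in> surv k" "c = lab k i" using assms by (auto simp: C_def)
  obtain j where "j \<in> surv (max n k)" "lab (max n k) j = lab k i"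
    using lift_coordinate[of k "max n k" i] ki(1) by auto
  then show ?thesis using ki by (intro exI[of _ "max n k"]) auto
qed

lemma lab_in_C: "i \<in> surv k \<Longrightarrow> lab k i \<in> C"
  by (auto simp: C_def)

lemma val_unique:
  assumes "n \<le> k" "n \<le> l" "i \<in> surv k" "j \<in> surv l" "lab k i = lab l j" "a \<in> carrier (Am n)"
  shows "val n a F k i = val n a F l j"
proof -
  define m where "m = max k l"
  obtain i' where i': "i' \<in> surv m" "lab m i' = lab k i" "val n a F m i' = val n a F k i"
    using lift_coordinate[of k m i] assms by (auto simp: m_def)
  obtain j' where j': "j' \<in> surv m" "lab m j' = lab l j" "val n a F m j' = val n a F l j"
    using lift_coordinate[of l m j] assms by (auto simp: m_def)
  have "lab m i' = lab m j'" using i' j' assms(5) by simp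
  then have "i' = j'" using i'(1) j'(1) by (rule inj_onD[OF inj_lab])
  then show ?thesis using i' j' by simp
qed

text \<open>An arbitrary stage is chosen at which the label \<open>c\<close> is visible; by \<open>val_unique\<close> the choice does not
  influence the value.\<close>

definition act :: "nat \<Rightarrow> 'a \<Rightarrow> (real \<Rightarrow> complex) \<Rightarrow> real \<Rightarrow> complex" where
  "act n a F c = (let z = (SOME z. n \<le> fst z \<and> snd z \<in> surv (fst z) \<and> lab (fst z) (snd z) = c)
    in val n a F (fst z) (snd z))"

lemma act_lab:
  assumes "n \<le> k" "i \<in> surv k" "a \<in> carrier (Am n)"
  shows "act n a F (lab k i) = val n a F k i"
proof -
  define P where "P z \<longleftrightarrow> n \<le> fst z \<and> snd z \<in> surv (fst z) \<and> lab (fst z) (snd z) = lab k i" for z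
  have "P (k, i)" using assms by (simp add: P_def)
  then have "P (SOME z. P z)" by (rule someI)
  then have "val n a F (fst (SOME z. P z)) (snd (SOME z. P z)) = val n a F k i"
    using assms by (intro val_unique) (auto simp: P_def)
  then show ?thesis by (simp add: act_def P_def Let_def)
qed

lemma ph_cnj: "i \<in> surv k \<Longrightarrow> ph k i * cnj (ph k i) = 1"
  using cmod_ph[of i k] complex_norm_square[of "ph k i"] by simp

text \<open>The set of labels of stage \<open>k\<close> is reducing: the restriction of the result depends only on the
  restriction of the argument, through the matrix of stage \<open>k\<close>.  All algebraic properties of the
  action follow from this.\<close>

lemma fr_act:
  assumes "n \<le> k" "i \<in> surv k" "a \<in> carrier (Am n)"
  shows "fr k (act n a F) i = mv (I k) (R k (\<phi> k n a)) (fr k F) i"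
  using ph_cnj[OF assms(2)] by (simp add: fr_def[of k "act n a F"] act_lab[OF assms] val_def mult.assoc[symmetric])

lemma eq_on_C:
  assumes "\<And>k i. n \<le> k \<Longrightarrow> i \<in> surv k \<Longrightarrow> fr k F i = fr k G i" "c \<in> C"
  shows "F c = G c"
proof -
  obtain k i where ki: "n \<le> k" "i \<in> surv k" "lab k i = c" using C_lab[OF assms(2)] by blast
  have "ph k i \<noteq> 0" using cmod_ph[OF ki(2)] by auto
  then show ?thesis using assms(1)[OF ki(1,2)] ki(3) by (simp add: fr_def)
qed

lemma fr_add: "fr k (\<lambda>c. F c + G c) = (\<lambda>i. fr k F i + fr k G i)"
  by (simp add: fr_def distrib_left fun_eq_iff)

lemma fr_scale: "fr k (\<lambda>c. t * F c) = (\<lambda>i. t * fr k F i)"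
  by (simp add: fr_def fun_eq_iff)

lemma act_cong:
  assumes "a \<in> carrier (Am n)" "\<And>c. c \<in> C \<Longrightarrow> F c = G c" "c \<in> C"
  shows "act n a F c = act n a G c"
proof (rule eq_on_C[OF _ assms(3)])
  fix k i assume ki: "n \<le> k" "i \<in> surv k"
  show "fr k (act n a F) i = fr k (act n a G) i"
    unfolding fr_act[OF ki assms(1)]
    by (rule mv_surv_cong[OF ki(2) \<phi>_closed[OF ki(1) assms(1)]]) (simp add: fr_def assms(2) lab_in_C)
qed

lemma act_add_right:
  assumes "a \<in> carrier (Am n)" "c \<in> C"
  shows "act n a (\<lambda>c. F c + G c) c = act n a F c + act n a G c"
proof (rule eq_on_C[OF _ assms(2)])
  fix k i assume ki: "n \<le> k" "i \<in> surv k"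
  show "fr k (act n a (\<lambda>c. F c + G c)) i = fr k (\<lambda>c. act n a F c + act n a G c) i"
    unfolding fr_add fr_act[OF ki assms(1)] by (simp add: mv_def distrib_left sum.distrib)
qed

lemma act_scale_right:
  assumes "a \<in> carrier (Am n)" "c \<in> C"
  shows "act n a (\<lambda>c. t * F c) c = t * act n a F c"
proof (rule eq_on_C[OF _ assms(2)])
  fix k i assume ki: "n \<le> k" "i \<in> surv k"
  show "fr k (act n a (\<lambda>c. t * F c)) i = fr k (\<lambda>c. t * act n a F c) i"
    unfolding fr_scale fr_act[OF ki assms(1)] by (simp add: mv_def sum_distrib_left mult_ac)
qed

lemma act_add_left:
  assumes "a \<in> carrier (Am n)" "b \<in> carrier (Am n)" "c \<in> C"
  shows "act n (a \<oplus>\<^bsub>Am n\<^esub> b) F c = act n a F c + act n b F c"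
proof (rule eq_on_C[OF _ assms(3)])
  fix k i assume ki: "n \<le> k" "i \<in> surv k"
  have ab: "a \<oplus>\<^bsub>Am n\<^esub> b \<in> carrier (Am n)" using assms by simp
  show "fr k (act n (a \<oplus>\<^bsub>Am n\<^esub> b) F) i = fr k (\<lambda>c. act n a F c + act n b F c) i"
    unfolding fr_add fr_act[OF ki assms(1)] fr_act[OF ki assms(2)] fr_act[OF ki ab] \<phi>_add[OF ki(1) assms(1,2)]
    by (simp add: mv_def Al.R_add \<phi>_closed[OF ki(1)] assms distrib_right sum.distrib)
qed

lemma act_scale_left:
  assumes "a \<in> carrier (Am n)" "c \<in> C"
  shows "act n (t \<odot>\<^bsub>Am n\<^esub> a) F c = t * act n a F c"
proof (rule eq_on_C[OF _ assms(2)])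
  fix k i assume ki: "n \<le> k" "i \<in> surv k"
  have ta: "t \<odot>\<^bsub>Am n\<^esub> a \<in> carrier (Am n)" using assms by simp
  show "fr k (act n (t \<odot>\<^bsub>Am n\<^esub> a) F) i = fr k (\<lambda>c. t * act n a F c) i"
    unfolding fr_scale fr_act[OF ki assms(1)] fr_act[OF ki ta] \<phi>_smult[OF ki(1) assms(1)]
    by (simp add: mv_def Al.R_smult \<phi>_closed[OF ki(1)] assms sum_distrib_left mult_ac)
qed

lemma act_mult:
  assumes "a \<in> carrier (Am n)" "b \<in> carrier (Am n)" "c \<in> C"
  shows "act n (a \<otimes>\<^bsub>Am n\<^esub> b) F c = act n a (act n b F) c"
proof (rule eq_on_C[OF _ assms(3)])
  fix k i assume ki: "n \<le> k" "i \<in> surv k"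
  have ab: "a \<otimes>\<^bsub>Am n\<^esub> b \<in> carrier (Am n)" using assms by (simp add: Al.mult_closed)
  note c = \<phi>_closed[OF ki(1) assms(1)] \<phi>_closed[OF ki(1) assms(2)]
  have "mv (I k) (R k (\<phi> k n a)) (fr k (act n b F)) i = mv (I k) (R k (\<phi> k n a)) (mv (I k) (R k (\<phi> k n b)) (fr k F)) i"
    by (rule mv_surv_cong[OF ki(2) c(1)]) (rule fr_act[OF ki(1) _ assms(2)])
  then show "fr k (act n (a \<otimes>\<^bsub>Am n\<^esub> b) F) i = fr k (act n a (act n b F)) i"
    unfolding fr_act[OF ki assms(1)] fr_act[OF ki ab] \<phi>_mult[OF ki(1) assms(1,2)] mv_mv
    by (simp add: mv_def Al.R_mult c)
qed

lemma act_\<phi>: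
  assumes "n \<le> m" "a \<in> carrier (Am n)" "c \<in> C"
  shows "act m (\<phi> m n a) F c = act n a F c"
proof (rule eq_on_C[OF _ assms(3)])
  fix k i assume ki: "m \<le> k" "i \<in> surv k"
  have nk: "n \<le> k" using ki assms by simp
  show "fr k (act m (\<phi> m n a) F) i = fr k (act n a F) i"
    unfolding fr_act[OF ki \<phi>_closed[OF assms(1,2)]] fr_act[OF nk ki(2) assms(2)]
    by (simp add: \<phi>_comp[OF assms(1) ki(1) assms(2)])
qed

lemma lp_sum_fr: "lp_sum p (surv k) (fr k F) = (\<Sum>c\<in>lab k ` surv k. cmod (F c) powr p)"
  unfolding lp_sum_finite[OF finite_surv] sum.reindex[OF inj_lab]
  by (rule sum.cong) (auto simp: fr_def norm_mult cmod_ph)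

lemma finite_subset_C:
  assumes "finite Z" "Z \<subseteq> C"
  shows "\<exists>k\<ge>n. Z \<subseteq> lab k ` surv k"
  using assms
proof (induction Z)
  case (insert c Z)
  then obtain k where k: "k \<ge> n" "Z \<subseteq> lab k ` surv k" by auto
  obtain l i where l: "l \<ge> k" "i \<in> surv l" "lab l i = c" using C_lab[of c k] insert by auto
  have "d \<in> lab l ` surv l" if "d \<in> Z" for d
  proof -
    have "d \<in> lab k ` surv k" using k(2) that by blast
    then obtain j where j: "j \<in> surv k" "d = lab k j" by blast
    obtain j' where "j' \<in> surv l" "lab l j' = lab k j" using lift_coordinate[OF l(1) j(1)] by blast
    then show ?thesis using j by (metis imageI)
  qed
  then show ?case using l k by (intro exI[of _ l]) auto
qed auto

text \<open>Only surviving coordinates contribute on a surviving row, so that the restriction of a block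
  matrix to them does not increase the norm.\<close>

lemma mv_surv_le:
  assumes b: "b \<in> carrier (Am k)" and K: "0 \<le> K" "nrm (Am k) b \<le> K"
  shows "lp_sum p (surv k) (mv (I k) (R k b) f) \<le> K powr p * lp_sum p (surv k) f"
proof -
  note p = Al.p_ge_1
  define g where "g i = (if i \<in> surv k then f i else 0)" for i
  have "lp_sum p (surv k) (mv (I k) (R k b) f) = lp_sum p (surv k) (mv (I k) (R k b) g)"
    by (rule lp_sum_cong, rule mv_surv_cong) (use b in \<open>auto simp: g_def\<close>)
  also have "\<dots> \<le> lp_sum p (I k) (mv (I k) (R k b) g)"
    unfolding lp_sum_finite[OF finite_surv] lp_sum_finite[OF Al.finite_I]
    using surv_subset Al.finite_I by (intro sum_mono2) auto
  also have "\<dots> \<le> K powr p * lp_sum p (I k) g"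
    using Al.R_nrm[OF b K(1)] K(2) by (simp add: lp_sum_powr_scale[OF p K(1)])
  also have "lp_sum p (I k) g = lp_sum p (surv k) f"
    unfolding lp_sum_finite[OF finite_surv] lp_sum_finite[OF Al.finite_I]
    using surv_subset Al.finite_I by (intro sum.mono_neutral_cong_right) (auto simp: g_def)
  finally show ?thesis .
qed

text \<open>A finite set of labels is visible at a single stage, where the norm of the matrix gives the bound.\<close>

lemma act_bounded:
  assumes a: "a \<in> carrier (Am n)" and K: "0 \<le> K"
    and m: "n \<le> m" "nrm (Am m) (\<phi> m n a) \<le> K" and F: "F \<in> lpf p C"
  shows "act n a F \<in> lpf p C" "lp_norm p C (act n a F) \<le> K * lp_norm p C F"
proof -
  note p = Al.p_ge_1
  have *: "(\<Sum>c\<in>Z. cmod (act n a F c) powr p) \<le> (K * lp_norm p C F) powr p"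
    if Z: "finite Z" "Z \<subseteq> C" for Z
  proof -
    obtain k where k: "k \<ge> m" "Z \<subseteq> lab k ` surv k" using finite_subset_C[OF Z] by blast
    then have nk: "n \<le> k" using m by simp
    note c = \<phi>_closed[OF nk a]
    have "nrm (Am k) (\<phi> k n a) \<le> K"
      using nrm_\<phi>_le[OF k(1) \<phi>_closed[OF m(1) a]] \<phi>_comp[OF m(1) k(1) a] m(2) by simp
    then have "lp_sum p (surv k) (mv (I k) (R k (\<phi> k n a)) (fr k F)) \<le> K powr p * lp_sum p (surv k) (fr k F)"
      by (rule mv_surv_le[OF c K])
    moreover have "lp_sum p (surv k) (fr k F) \<le> lp_sum p C F"
      unfolding lp_sum_fr by (rule sum_le_lp_sum[OF F]) (use finite_surv lab_in_C in auto)
    moreover have "lp_sum p (surv k) (fr k (act n a F)) = lp_sum p (surv k) (mv (I k) (R k (\<phi> k n a)) (fr k F))"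
      by (rule lp_sum_cong) (rule fr_act[OF nk _ a])
    moreover have "(\<Sum>c\<in>Z. cmod (act n a F c) powr p) \<le> lp_sum p (surv k) (fr k (act n a F))"
      unfolding lp_sum_fr using k finite_surv by (intro sum_mono2) auto
    ultimately have "(\<Sum>c\<in>Z. cmod (act n a F c) powr p) \<le> K powr p * lp_sum p C F"
      using mult_left_mono[of "lp_sum p (surv k) (fr k F)" "lp_sum p C F" "K powr p"] by simp
    then show ?thesis using K p by (simp add: powr_mult lp_norm_powr)
  qed
  show "act n a F \<in> lpf p C" by (rule Lp_functionsI) (rule *)
  show "lp_norm p C (act n a F) \<le> K * lp_norm p C F"
    by (rule lp_norm_le[OF p]) (use K * in auto)
qed

text \<open>Cutting \<open>a\<close> down by the projection \<open>e\<close> onto the survivors does not change its image at a stage where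
  the complementary projection \<open>d\<close> has vanished.  The norm of \<open>a \<otimes> e\<close> is computed by vectors supported
  on survivors, and these extend by zero to families on \<open>C\<close>.\<close>

lemma act_lower_bound:
  assumes a: "a \<in> carrier (Am n)" and K: "0 \<le> K"
    and le: "\<And>F. F \<in> lpf p C \<Longrightarrow> lp_norm p C (act n a F) \<le> K * lp_norm p C F"
  shows "\<exists>m\<ge>n. nrm (Am m) (\<phi> m n a) \<le> K"
proof -
  note p = Al.p_ge_1
  define e where "e = Al.dg n (\<lambda>i. if i \<in> surv n then 1 else 0)"
  define d where "d = Al.dg n (\<lambda>i. if i \<in> I n - surv n then 1 else 0)"
  have ed: "e \<in> carrier (Am n)" "d \<in> carrier (Am n)" by (auto simp: e_def d_def Al.dg)
  have ed1: "e \<oplus>\<^bsub>Am n\<^esub> d = \<one>\<^bsub>Am n\<^esub>"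
    by (rule Al.R_ext) (use ed in \<open>auto simp: e_def d_def Al.R_add Al.dg Al.R_one Al.one_closed\<close>)
  have ae: "a \<otimes>\<^bsub>Am n\<^esub> e \<in> carrier (Am n)" using a ed by (simp add: Al.mult_closed)
  have mv_ae: "mv (I n) (R n (a \<otimes>\<^bsub>Am n\<^esub> e)) f i = mv (I n) (R n a) (\<lambda>j. if j \<in> surv n then f j else 0) i" for f i
  proof -
    have "R n (a \<otimes>\<^bsub>Am n\<^esub> e) i j * f j = R n a i j * (if j \<in> surv n then f j else 0)" if j: "j \<in> I n" for j
    proof -
      have "R n (a \<otimes>\<^bsub>Am n\<^esub> e) i j = (\<Sum>k\<in>I n. R n a i k * R n e k j)" by (rule Al.R_mult[OF a ed(1)])
      also have "\<dots> = (\<Sum>k\<in>I n. if k = j then (if j \<in> surv n then R n a i j else 0) else 0)"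
        by (rule sum.cong) (auto simp: e_def Al.dg)
      finally show ?thesis using j Al.finite_I[of n] by simp
    qed
    then show ?thesis unfolding mv_def by (intro sum.cong) auto
  qed
  have "nrm (Am n) (a \<otimes>\<^bsub>Am n\<^esub> e) \<le> K"
  proof -
    have "lp_sum p (I n) (mv (I n) (R n (a \<otimes>\<^bsub>Am n\<^esub> e)) f) \<le> K powr p * lp_sum p (I n) f" for f
    proof -
      define g where "g j = (if j \<in> surv n then f j else 0)" for j
      \<comment> \<open>the family on \<open>C\<close> with restriction \<open>g\<close> at stage \<open>n\<close> that vanishes at all later labels\<close>
      define F where "F c = (if c \<in> lab n ` surv n then
        cnj (ph n (inv_into (surv n) (lab n) c)) * g (inv_into (surv n) (lab n) c) else 0)" for c
      have frF: "fr n F j = g j" if "j \<in> surv n" for j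
        using that inj_lab[of n] ph_cnj[OF that] by (simp add: fr_def F_def mult.assoc[symmetric])
      have F: "F \<in> lpf p C" by (rule lp_finite_support[of "lab n ` surv n"]) (auto simp: F_def finite_surv)
      have out: "mv (I n) (R n a) g i = 0" if "i \<in> I n - surv n" for i
        unfolding mv_def
      proof (rule sum.neutral, rule ballI)
        fix j assume "j \<in> I n"
        show "R n a i j * g j = 0"
        proof (cases "R n a i j = 0")
          case False
          then have "blk n j = blk n i" using Al.R_support[OF a, of i j] by simp
          then have "j \<notin> surv n" using surv_block[of j n i] that by auto
          then show ?thesis by (simp add: g_def)
        qed simp
      qed
      have "lp_sum p (I n) (mv (I n) (R n (a \<otimes>\<^bsub>Am n\<^esub> e)) f) = lp_sum p (I n) (mv (I n) (R n a) g)"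
        by (rule lp_sum_cong) (simp add: mv_ae g_def[abs_def])
      also have "\<dots> = lp_sum p (surv n) (mv (I n) (R n a) g)"
        unfolding lp_sum_finite[OF finite_surv] lp_sum_finite[OF Al.finite_I]
        using surv_subset Al.finite_I out by (intro sum.mono_neutral_right) auto
      also have "\<dots> = lp_sum p (surv n) (fr n (act n a F))"
      proof (rule lp_sum_cong)
        fix i assume i: "i \<in> surv n"
        have "fr n (act n a F) i = mv (I n) (R n a) (fr n F) i"
          using fr_act[OF le_refl i a] by (simp add: \<phi>_id[OF a])
        also have "\<dots> = mv (I n) (R n a) g i" by (rule mv_surv_cong[OF i a frF])
        finally show "mv (I n) (R n a) g i = fr n (act n a F) i" by simp
      qed
      also have "\<dots> \<le> lp_sum p C (act n a F)"
        unfolding lp_sum_fr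
        by (rule sum_le_lp_sum[OF act_bounded(1)[OF a Al.nrm_nonneg[OF \<phi>_closed[OF le_refl a]] le_refl order_refl F]])
          (use finite_surv lab_in_C in auto)
      also have "\<dots> \<le> K powr p * lp_sum p C F"
        using le[OF F] by (simp add: lp_sum_powr_scale[OF p K])
      also have "lp_sum p C F \<le> lp_sum p (surv n) (fr n F)"
        unfolding lp_sum_fr
      proof (rule lp_sum_le)
        fix Z assume Z: "finite Z" "Z \<subseteq> C"
        have "(\<Sum>c\<in>Z. cmod (F c) powr p) = (\<Sum>c\<in>Z \<inter> lab n ` surv n. cmod (F c) powr p)"
          using Z(1) by (intro sum.mono_neutral_right) (auto simp: F_def)
        also have "\<dots> \<le> (\<Sum>c\<in>lab n ` surv n. cmod (F c) powr p)"
          using finite_surv by (intro sum_mono2) auto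
        finally show "(\<Sum>c\<in>Z. cmod (F c) powr p) \<le> (\<Sum>c\<in>lab n ` surv n. cmod (F c) powr p)" .
      qed
      also have "lp_sum p (surv n) (fr n F) \<le> lp_sum p (I n) f"
        unfolding lp_sum_finite[OF finite_surv] lp_sum_finite[OF Al.finite_I]
        using surv_subset Al.finite_I frF by (intro order_trans[OF _ sum_mono2[of "I n" "surv n"]] sum_mono) (auto simp: g_def)
      finally show ?thesis by (simp add: mult_left_mono)
    qed
    then show ?thesis using Al.R_nrm[OF ae K] by (simp add: lp_sum_powr_scale[OF p K])
  qed
  moreover obtain m where m: "m \<ge> n" "\<phi> m n d = \<zero>\<^bsub>Am m\<^esub>"
    using no_survivors_vanish[of "I n - surv n" n] by (auto simp: d_def)
  moreover have "\<phi> m n a = \<phi> m n (a \<otimes>\<^bsub>Am n\<^esub> e)"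
  proof -
    have "a = a \<otimes>\<^bsub>Am n\<^esub> e \<oplus>\<^bsub>Am n\<^esub> a \<otimes>\<^bsub>Am n\<^esub> d"
      using a ed by (simp add: Al.mult_distr_right[symmetric] ed1 Al.one_right)
    then have "\<phi> m n a = \<phi> m n (a \<otimes>\<^bsub>Am n\<^esub> e) \<oplus>\<^bsub>Am m\<^esub> \<phi> m n a \<otimes>\<^bsub>Am m\<^esub> \<phi> m n d"
      using \<phi>_add[OF m(1) ae, of "a \<otimes>\<^bsub>Am n\<^esub> d"] \<phi>_mult[OF m(1) a ed(2)] a ed by (simp add: Al.mult_closed)
    then show ?thesis using m \<phi>_closed[OF m(1) a] \<phi>_closed[OF m(1) ae] by simp
  qed
  ultimately show ?thesis
    using nrm_\<phi>_le[OF m(1) ae] by (intro exI[of _ m]) simp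
qed

text \<open>At a stage \<open>l \<ge> k\<close> the identity of stage \<open>k\<close> is a coordinate projection; it is \<open>1\<close> at the labels of
  stage \<open>k\<close>, and at the others \<open>F\<close> vanishes.\<close>

lemma act_one_finite_support:
  assumes F: "\<And>c. c \<in> C - lab k ` surv k \<Longrightarrow> F c = 0" and c: "c \<in> C"
  shows "act k \<one>\<^bsub>Am k\<^esub> F c = F c"
proof (rule eq_on_C[OF _ c])
  fix l i assume l: "k \<le> l" "i \<in> surv l"
  interpret H: block_hom "Am k" p "I k" "blk k" "R k" "Am l" "I l" "blk l" "R l" "\<phi> l k"
    by (rule block_hom[OF l(1)])
  have iI: "i \<in> I l" using l surv_subset by auto
  have *: "fr l (act k \<one>\<^bsub>Am k\<^esub> F) i = R l (\<phi> l k \<one>\<^bsub>Am k\<^esub>) i i * fr l F i"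
    unfolding fr_act[OF l Al.one_closed] by (rule mv_diag[OF Al.finite_I iI]) (simp add: H.one_diagonal)
  show "fr l (act k \<one>\<^bsub>Am k\<^esub> F) i = fr l F i"
  proof (cases "lab l i \<in> lab k ` surv k")
    case False
    then have "fr l F i = 0" using F[of "lab l i"] lab_in_C[OF l(2)] by (simp add: fr_def)
    then show ?thesis unfolding * by simp
  next
    case True
    then obtain j where j: "j \<in> surv k" "lab l i = lab k j" by auto
    have jI: "j \<in> I k" using j surv_subset by auto
    have "act k \<one>\<^bsub>Am k\<^esub> F (lab k j) = F (lab k j)"
    proof -
      have "mv (I k) (R k (\<phi> k k \<one>\<^bsub>Am k\<^esub>)) (fr k F) j = fr k F j"
        unfolding \<phi>_id[OF Al.one_closed] using jI by (subst mv_diag) (auto simp: Al.R_one Al.finite_I)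
      then show ?thesis
        using ph_cnj[OF j(1)] by (simp add: act_lab[OF le_refl j(1) Al.one_closed] val_def fr_def mult.assoc[symmetric] mult.commute[of "cnj _"])
    qed
    then show ?thesis using j(2) by (simp add: fr_def)
  qed
qed

definition opr :: "nat \<Rightarrow> 'a \<Rightarrow> (real \<Rightarrow> complex) set \<Rightarrow> (real \<Rightarrow> complex) set" where
  "opr n a = (\<lambda>Z\<in>carrier (lps p C). lp_class p C (act n a (lp_fun Z)))"

sublocale E: complex_normed_space "lps p C"
  by (rule complex_normed_space_Lp[OF Al.p_ge_1])

lemma act_lpf: "a \<in> carrier (Am n) \<Longrightarrow> F \<in> lpf p C \<Longrightarrow> act n a F \<in> lpf p C"
  by (rule act_bounded(1)[OF _ Al.nrm_nonneg[OF \<phi>_closed[OF le_refl]] le_refl order_refl])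

lemma opr_class:
  assumes "a \<in> carrier (Am n)" "F \<in> lpf p C"
  shows "opr n a (lp_class p C F) = lp_class p C (act n a F)"
proof -
  have "lp_class p C (act n a (lp_fun (lp_class p C F))) = lp_class p C (act n a F)"
    by (rule lp_class_eqI)
      (use assms lp_fun_class[OF assms(2)] act_lpf in \<open>auto intro: act_cong\<close>)
  then show ?thesis using assms by (simp add: opr_def)
qed

lemma carrier_lps_cases:
  assumes "Z \<in> carrier (lps p C)"
  obtains F where "F \<in> lpf p C" "Z = lp_class p C F"
  using assms by (auto simp: carrier_Lp_space)

lemma opr_closed:
  assumes a: "a \<in> carrier (Am n)"
  shows "opr n a \<in> carrier E.BO"
proof (rule bounded_operatorsI[where C = "nrm (Am n) (\<phi> n n a)"])
  note p = Al.p_ge_1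
  show "opr n a \<in> extensional (carrier (lps p C))" by (simp add: opr_def)
  fix Z assume "Z \<in> carrier (lps p C)"
  then obtain F where F: "F \<in> lpf p C" "Z = lp_class p C F" by (rule carrier_lps_cases)
  show "opr n a Z \<in> carrier (lps p C)" using F a by (simp add: opr_class act_lpf)
  show "opr n a (t \<odot>\<^bsub>lps p C\<^esub> Z) = t \<odot>\<^bsub>lps p C\<^esub> opr n a Z" for t
    using F a lp_sum_cmult(1)[OF p F(1)] lp_sum_cmult(1)[OF p act_lpf[OF a F(1)]]
    by (simp add: lp_class_smult[OF p] opr_class act_lpf) (rule lp_class_eqI, auto simp: act_scale_right act_lpf)
  show "nrm (lps p C) (opr n a Z) \<le> nrm (Am n) (\<phi> n n a) * nrm (lps p C) Z"
    using act_bounded(2)[OF a Al.nrm_nonneg[OF \<phi>_closed[OF le_refl a]] le_refl order_refl F(1)] F a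
    by (simp add: opr_class nrm_lp_class act_lpf)
  fix Z2 assume "Z2 \<in> carrier (lps p C)"
  then obtain G where G: "G \<in> lpf p C" "Z2 = lp_class p C G" by (rule carrier_lps_cases)
  show "opr n a (Z \<oplus>\<^bsub>lps p C\<^esub> Z2) = opr n a Z \<oplus>\<^bsub>lps p C\<^esub> opr n a Z2"
    using F G a lp_sum_add(1)[OF p F(1) G(1)] lp_sum_add(1)[OF p act_lpf[OF a F(1)] act_lpf[OF a G(1)]]
    by (simp add: lp_class_add[OF p] opr_class act_lpf) (rule lp_class_eqI, auto simp: act_add_right act_lpf)
qed

lemma opr_eqI:
  assumes "T \<in> carrier E.BO" "a \<in> carrier (Am n)"
    "\<And>F. F \<in> lpf p C \<Longrightarrow> \<exists>G\<in>lpf p C. T (lp_class p C F) = lp_class p C G \<and> (\<forall>c\<in>C. G c = act n a F c)"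
  shows "opr n a = T"
proof (rule bounded_operators_eqI[OF opr_closed[OF assms(2)] assms(1)])
  fix Z assume "Z \<in> carrier (lps p C)"
  then obtain F where F: "F \<in> lpf p C" "Z = lp_class p C F" by (rule carrier_lps_cases)
  obtain G where G: "G \<in> lpf p C" "T Z = lp_class p C G" "\<forall>c\<in>C. G c = act n a F c" using assms(3)[OF F(1)] F(2) by auto
  show "opr n a Z = T Z"
    unfolding F(2) opr_class[OF assms(2) F(1)] G(2)[unfolded F(2)]
    by (rule lp_class_eqI) (use G act_lpf[OF assms(2) F(1)] in auto)
qed

lemma opr_add:
  assumes a: "a \<in> carrier (Am n)" and b: "b \<in> carrier (Am n)"
  shows "opr n (a \<oplus>\<^bsub>Am n\<^esub> b) = opr n a \<oplus>\<^bsub>E.BO\<^esub> opr n b"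
proof (rule opr_eqI[OF E.BO_add_closed[OF opr_closed[OF a] opr_closed[OF b]]])
  note p = Al.p_ge_1
  fix F assume F: "F \<in> lpf p C"
  show "\<exists>G\<in>lpf p C. (opr n a \<oplus>\<^bsub>E.BO\<^esub> opr n b) (lp_class p C F) = lp_class p C G \<and>
      (\<forall>c\<in>C. G c = act n (a \<oplus>\<^bsub>Am n\<^esub> b) F c)"
    by (rule bexI[OF _ lp_sum_add(1)[OF p act_lpf[OF a F] act_lpf[OF b F]]])
      (simp add: bounded_operators_simps opr_class a b F act_lpf lp_class_add[OF p] act_add_left)
qed (use a b in simp)

lemma opr_smult:
  assumes a: "a \<in> carrier (Am n)"
  shows "opr n (t \<odot>\<^bsub>Am n\<^esub> a) = t \<odot>\<^bsub>E.BO\<^esub> opr n a"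
proof (rule opr_eqI[OF E.BO_smult_closed[OF opr_closed[OF a]]])
  note p = Al.p_ge_1
  fix F assume F: "F \<in> lpf p C"
  show "\<exists>G\<in>lpf p C. (t \<odot>\<^bsub>E.BO\<^esub> opr n a) (lp_class p C F) = lp_class p C G \<and>
      (\<forall>c\<in>C. G c = act n (t \<odot>\<^bsub>Am n\<^esub> a) F c)"
    by (rule bexI[OF _ lp_sum_cmult(1)[OF p act_lpf[OF a F], of t]])
      (simp add: bounded_operators_simps opr_class a F act_lpf lp_class_smult[OF p] act_scale_left)
qed (use a in simp)

lemma opr_mult:
  assumes a: "a \<in> carrier (Am n)" and b: "b \<in> carrier (Am n)"
  shows "opr n (a \<otimes>\<^bsub>Am n\<^esub> b) = opr n a \<otimes>\<^bsub>E.BO\<^esub> opr n b"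
proof (rule opr_eqI[OF E.BO_mult_closed(1)[OF opr_closed[OF a] opr_closed[OF b]]])
  fix F assume F: "F \<in> lpf p C"
  show "\<exists>G\<in>lpf p C. (opr n a \<otimes>\<^bsub>E.BO\<^esub> opr n b) (lp_class p C F) = lp_class p C G \<and>
      (\<forall>c\<in>C. G c = act n (a \<otimes>\<^bsub>Am n\<^esub> b) F c)"
    by (rule bexI[OF _ act_lpf[OF a act_lpf[OF b F]]])
      (simp add: bounded_operators_simps compose_def opr_class a b F act_lpf act_mult)
qed (use a b in \<open>simp add: Al.mult_closed\<close>)

lemma opr_\<phi>:
  assumes nm: "n \<le> m" and a: "a \<in> carrier (Am n)"
  shows "opr m (\<phi> m n a) = opr n a"
proof (rule opr_eqI[OF opr_closed[OF a] \<phi>_closed[OF nm a]])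
  fix F assume F: "F \<in> lpf p C"
  show "\<exists>G\<in>lpf p C. opr n a (lp_class p C F) = lp_class p C G \<and> (\<forall>c\<in>C. G c = act m (\<phi> m n a) F c)"
    by (rule bexI[OF _ act_lpf[OF a F]]) (simp add: opr_class a F act_\<phi>[OF nm a])
qed

text \<open>The upper bound comes from the norms at late stages, the lower bound from \<open>act_lower_bound\<close> and
  monotonicity of the norms along the system.\<close>

lemma nrm_opr:
  assumes a: "a \<in> carrier (Am n)" and L: "(\<lambda>k. nrm (Am k) (\<phi> k n a)) \<longlonglongrightarrow> L"
  shows "nrm E.BO (opr n a) = L"
proof (rule antisym)
  note BO = opr_closed[OF a]
  have L_le: "L \<le> nrm (Am m) (\<phi> m n a)" if "n \<le> m" for m
  proof (rule LIMSEQ_le_const2[OF L], intro exI[of _ m] allI impI)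
    fix k assume "m \<le> k"
    then show "nrm (Am k) (\<phi> k n a) \<le> nrm (Am m) (\<phi> m n a)"
      using nrm_\<phi>_le[of m k "\<phi> m n a"] \<phi>_closed[OF that a] \<phi>_comp[OF that _ a] by simp
  qed
  have L0: "0 \<le> L"
  proof (rule LIMSEQ_le_const[OF L], intro exI[of _ n] allI impI)
    fix k assume "n \<le> k"
    then show "0 \<le> nrm (Am k) (\<phi> k n a)" using \<phi>_closed[OF _ a] by simp
  qed
  show "nrm E.BO (opr n a) \<le> L"
  proof (rule field_le_epsilon)
    fix \<epsilon> :: real assume e: "0 < \<epsilon>"
    then obtain N where N: "\<And>k. k \<ge> N \<Longrightarrow> \<bar>nrm (Am k) (\<phi> k n a) - L\<bar> < \<epsilon>"
      using L unfolding LIMSEQ_iff by auto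
    define m where "m = max n N"
    have m: "n \<le> m" "nrm (Am m) (\<phi> m n a) \<le> L + \<epsilon>" using N[of m] by (auto simp: m_def)
    show "nrm E.BO (opr n a) \<le> L + \<epsilon>"
    proof (rule E.opnorm_le[OF BO])
      show "0 \<le> L + \<epsilon>" using L0 e by simp
      fix Z assume "Z \<in> carrier (lps p C)"
      then obtain F where F: "F \<in> lpf p C" "Z = lp_class p C F" by (rule carrier_lps_cases)
      show "nrm (lps p C) (opr n a Z) \<le> (L + \<epsilon>) * nrm (lps p C) Z"
        using act_bounded(2)[OF a \<open>0 \<le> L + \<epsilon>\<close> m F(1)] F a by (simp add: opr_class nrm_lp_class act_lpf)
    qed
  qed
  have "\<exists>m\<ge>n. nrm (Am m) (\<phi> m n a) \<le> nrm E.BO (opr n a)"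
  proof (rule act_lower_bound[OF a E.opnorm_nonneg[OF BO]])
    fix F assume F: "F \<in> lpf p C"
    show "lp_norm p C (act n a F) \<le> nrm E.BO (opr n a) * lp_norm p C F"
      using E.opnorm_bound[OF BO lp_class_closed[OF F]] F a by (simp add: opr_class nrm_lp_class act_lpf)
  qed
  then show "L \<le> nrm E.BO (opr n a)" using L_le by (meson order_trans)
qed

end

section \<open>Direct limits\<close>

lemma spatial_AF_system_block_system:
  assumes p: "1 \<le> p" "p \<noteq> 2" and sys: "spatial_AF_system p Am \<phi>"
  shows "\<exists>(I :: nat \<Rightarrow> (nat \<times> nat) set) blk R. block_system Am p I blk R \<phi>"
proof -
  have "\<forall>n. \<exists>c. block_algebra (Am n) p (fst c :: (nat \<times> nat) set) (fst (snd c)) (snd (snd c))"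
  proof
    fix n
    have "spatial_fd_algebra p (Am n)" using sys by (simp add: spatial_AF_system_def)
    then obtain I :: "(nat \<times> nat) set" and blk R where "block_algebra (Am n) p I blk R"
      using spatial_fd_algebra_coordinates[OF p(1)] by blast
    then show "\<exists>c. block_algebra (Am n) p (fst c :: (nat \<times> nat) set) (fst (snd c)) (snd (snd c))"
      by (intro exI[of _ "(I, blk, R)"]) simp
  qed
  from choice[OF this] obtain c where
    c: "\<And>n. block_algebra (Am n) p (fst (c n) :: (nat \<times> nat) set) (fst (snd (c n))) (snd (snd (c n)))" by blast
  have "block_system Am p (\<lambda>n. fst (c n)) (\<lambda>n. fst (snd (c n))) (\<lambda>n. snd (snd (c n))) \<phi>"
  proof (rule block_system.intro)
    show "block_hom (Am m) p (fst (c m)) (fst (snd (c m))) (snd (snd (c m)))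
        (Am n) (fst (c n)) (fst (snd (c n))) (snd (snd (c n))) (\<phi> n m)" if "m \<le> n" for m n
      by (rule spatial_hom_block_hom[OF p(2) c c]) (use sys that in \<open>auto simp: spatial_AF_system_def\<close>)
  qed (use sys in \<open>auto simp: spatial_AF_system_def\<close>)
  then show ?thesis by blast
qed

context block_system
begin

abbreviation "cl n a \<equiv> limit_class Am \<phi> n a"

lemma cl_mem:
  "(m, b) \<in> cl n a \<longleftrightarrow> a \<in> carrier (Am n) \<and> b \<in> carrier (Am m) \<and> (\<exists>k\<ge>max n m. \<phi> k n a = \<phi> k m b)"
  by (auto simp: limit_class_def limit_rel_def)

lemma \<phi>_eq_mono:
  assumes "n \<le> k" "m \<le> k" "k \<le> l" "a \<in> carrier (Am n)" "b \<in> carrier (Am m)" "\<phi> k n a = \<phi> k m b"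
  shows "\<phi> l n a = \<phi> l m b"
  using \<phi>_comp[of n k l a] \<phi>_comp[of m k l b] assms by metis

lemma cl_eqI:
  assumes a: "a \<in> carrier (Am n)" and b: "b \<in> carrier (Am m)"
    and k: "n \<le> k" "m \<le> k" "\<phi> k n a = \<phi> k m b"
  shows "cl n a = cl m b"
proof -
  have sub: "cl n a \<subseteq> cl m b"
    if a: "a \<in> carrier (Am n)" and b: "b \<in> carrier (Am m)"
      and k: "n \<le> k" "m \<le> k" "\<phi> k n a = \<phi> k m b" for n m a b
  proof
    fix z assume z: "z \<in> cl n a"
    obtain l d where ld: "z = (l, d)" by (cases z)
    obtain h where h: "h \<ge> max n l" "\<phi> h n a = \<phi> h l d" and d: "d \<in> carrier (Am l)"
      using z unfolding ld cl_mem by blast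
    define s where "s = max h k"
    have "\<phi> s n a = \<phi> s l d" using h a d by (intro \<phi>_eq_mono[of n h l s]) (auto simp: s_def)
    moreover have "\<phi> s n a = \<phi> s m b" using k a b by (intro \<phi>_eq_mono[of n k m s]) (auto simp: s_def)
    moreover have "max m l \<le> s" using h k by (auto simp: s_def)
    ultimately show "z \<in> cl m b" unfolding ld cl_mem using b d by metis
  qed
  show ?thesis using sub[OF a b k] sub[OF b a k(2,1) k(3)[symmetric]] by (rule subset_antisym)
qed

lemma cl_self: "a \<in> carrier (Am n) \<Longrightarrow> (n, a) \<in> cl n a"
  unfolding cl_mem by auto

lemma cl_\<phi>:
  assumes "n \<le> m" "a \<in> carrier (Am n)"
  shows "cl m (\<phi> m n a) = cl n a"
  by (rule cl_eqI[of _ _ _ _ m]) (use assms \<phi>_closed \<phi>_id in auto)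

abbreviation "ALim \<equiv> algebraic_direct_limit Am \<phi>"

lemma carrier_ALim: "carrier ALim = {cl n a | n a. a \<in> carrier (Am n)}"
  by (auto simp: algebraic_direct_limit_def quotient_def limit_class_def)

text \<open>The operations of the algebraic direct limit are unions over all representatives.  All of these give
  the same class, since any two representatives agree at a common later stage.\<close>

lemma ALim_op:
  assumes ops: "\<And>k x y. x \<in> carrier (Am k) \<Longrightarrow> y \<in> carrier (Am k) \<Longrightarrow> f k x y \<in> carrier (Am k)"
    and hom: "\<And>k l x y. k \<le> l \<Longrightarrow> x \<in> carrier (Am k) \<Longrightarrow> y \<in> carrier (Am k) \<Longrightarrow>
      \<phi> l k (f k x y) = f l (\<phi> l k x) (\<phi> l k y)"
    and a: "a \<in> carrier (Am n)" and b: "b \<in> carrier (Am n)"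
  shows "(\<Union>(m, x)\<in>cl n a. \<Union>(l, y)\<in>cl n b. let k = max m l in cl k (f k (\<phi> k m x) (\<phi> k l y))) = cl n (f n a b)"
proof -
  have eq: "cl (max m l) (f (max m l) (\<phi> (max m l) m x) (\<phi> (max m l) l y)) = cl n (f n a b)"
    if x: "(m, x) \<in> cl n a" and y: "(l, y) \<in> cl n b" for m l x y
  proof -
    define k where "k = max m l"
    have k: "m \<le> k" "l \<le> k" by (auto simp: k_def)
    obtain h where h: "h \<ge> max n m" "\<phi> h n a = \<phi> h m x" and xc: "x \<in> carrier (Am m)"
      using x unfolding cl_mem by blast
    obtain g where g: "g \<ge> max n l" "\<phi> g n b = \<phi> g l y" and yc: "y \<in> carrier (Am l)"
      using y unfolding cl_mem by blast
    define s where "s = max k (max h g)"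
    have s: "k \<le> s" "h \<le> s" "g \<le> s" "n \<le> s" "m \<le> s" "l \<le> s" using h g k by (auto simp: s_def)
    have 1: "\<phi> s n a = \<phi> s m x" using h s a xc by (intro \<phi>_eq_mono[of n h m s]) auto
    have 2: "\<phi> s n b = \<phi> s l y" using g s b yc by (intro \<phi>_eq_mono[of n g l s]) auto
    note c = \<phi>_closed[OF k(1) xc] \<phi>_closed[OF k(2) yc]
    have "\<phi> s k (f k (\<phi> k m x) (\<phi> k l y)) = f s (\<phi> s k (\<phi> k m x)) (\<phi> s k (\<phi> k l y))"
      by (rule hom[OF s(1) c])
    also have "\<dots> = f s (\<phi> s n a) (\<phi> s n b)"
      using 1 2 \<phi>_comp[OF k(1) s(1) xc] \<phi>_comp[OF k(2) s(1) yc] by simp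
    also have "\<dots> = \<phi> s n (f n a b)" by (rule hom[OF s(4) a b, symmetric])
    finally show ?thesis
      unfolding k_def[symmetric] by (intro cl_eqI[OF ops[OF c] ops[OF a b] s(1,4)])
  qed
  show ?thesis
  proof (rule equalityI)
    show "(\<Union>(m, x)\<in>cl n a. \<Union>(l, y)\<in>cl n b. let k = max m l in cl k (f k (\<phi> k m x) (\<phi> k l y))) \<subseteq> cl n (f n a b)"
      using eq by (auto simp: Let_def)
    have "cl n (f n a b) = (let k = max n n in cl k (f k (\<phi> k n a) (\<phi> k n b)))"
      using eq[OF cl_self[OF a] cl_self[OF b]] by (simp add: Let_def)
    then show "cl n (f n a b) \<subseteq> (\<Union>(m, x)\<in>cl n a. \<Union>(l, y)\<in>cl n b. let k = max m l in cl k (f k (\<phi> k m x) (\<phi> k l y)))"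
      using cl_self[OF a] cl_self[OF b] by blast
  qed
qed

lemma ALim_add:
  assumes "a \<in> carrier (Am n)" "b \<in> carrier (Am n)"
  shows "cl n a \<oplus>\<^bsub>ALim\<^esub> cl n b = cl n (a \<oplus>\<^bsub>Am n\<^esub> b)"
proof -
  have "(\<Union>(m, x)\<in>cl n a. \<Union>(l, y)\<in>cl n b. let k = max m l in cl k (\<phi> k m x \<oplus>\<^bsub>Am k\<^esub> \<phi> k l y)) = cl n (a \<oplus>\<^bsub>Am n\<^esub> b)"
    by (rule ALim_op[where f = "\<lambda>k x y. x \<oplus>\<^bsub>Am k\<^esub> y"]) (use assms \<phi>_add in auto)
  then show ?thesis by (simp add: algebraic_direct_limit_def)
qed

lemma ALim_mult:
  assumes "a \<in> carrier (Am n)" "b \<in> carrier (Am n)"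
  shows "cl n a \<otimes>\<^bsub>ALim\<^esub> cl n b = cl n (a \<otimes>\<^bsub>Am n\<^esub> b)"
proof -
  have "(\<Union>(m, x)\<in>cl n a. \<Union>(l, y)\<in>cl n b. let k = max m l in cl k (\<phi> k m x \<otimes>\<^bsub>Am k\<^esub> \<phi> k l y)) = cl n (a \<otimes>\<^bsub>Am n\<^esub> b)"
    by (rule ALim_op[where f = "\<lambda>k x y. x \<otimes>\<^bsub>Am k\<^esub> y"]) (use assms \<phi>_mult Al.mult_closed in auto)
  then show ?thesis by (simp add: algebraic_direct_limit_def)
qed

lemma ALim_smult:
  assumes a: "a \<in> carrier (Am n)"
  shows "t \<odot>\<^bsub>ALim\<^esub> cl n a = cl n (t \<odot>\<^bsub>Am n\<^esub> a)"
proof -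
  have eq: "cl m (t \<odot>\<^bsub>Am m\<^esub> x) = cl n (t \<odot>\<^bsub>Am n\<^esub> a)" if x: "(m, x) \<in> cl n a" for m x
  proof -
    obtain h where h: "n \<le> h" "m \<le> h" "\<phi> h n a = \<phi> h m x" and xc: "x \<in> carrier (Am m)"
      using x unfolding cl_mem by auto
    show ?thesis
      by (rule cl_eqI[OF _ _ h(2,1)]) (use a xc h in \<open>auto simp: \<phi>_smult\<close>)
  qed
  have "(\<Union>(m, x)\<in>cl n a. cl m (t \<odot>\<^bsub>Am m\<^esub> x)) = cl n (t \<odot>\<^bsub>Am n\<^esub> a)"
  proof (rule equalityI)
    show "(\<Union>(m, x)\<in>cl n a. cl m (t \<odot>\<^bsub>Am m\<^esub> x)) \<subseteq> cl n (t \<odot>\<^bsub>Am n\<^esub> a)" using eq by auto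
    show "cl n (t \<odot>\<^bsub>Am n\<^esub> a) \<subseteq> (\<Union>(m, x)\<in>cl n a. cl m (t \<odot>\<^bsub>Am m\<^esub> x))" using cl_self[OF a] by blast
  qed
  then show ?thesis by (simp add: algebraic_direct_limit_def)
qed

lemma nrm_\<phi>_convergent:
  assumes a: "a \<in> carrier (Am n)"
  shows "convergent (\<lambda>k. nrm (Am k) (\<phi> k n a))"
proof -
  define s where "s k = nrm (Am (k + n)) (\<phi> (k + n) n a)" for k
  have "decseq s"
  proof (rule decseq_SucI)
    fix k
    show "s (Suc k) \<le> s k"
      using nrm_\<phi>_le[of "k + n" "Suc (k + n)" "\<phi> (k + n) n a"] \<phi>_closed[of n "k + n" a] a
        \<phi>_comp[of n "k + n" "Suc (k + n)" a] by (simp add: s_def)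
  qed
  moreover have "0 \<le> s k" for k using \<phi>_closed[of n "k + n" a] a by (simp add: s_def)
  ultimately obtain L where "s \<longlonglongrightarrow> L" using decseq_convergent[of s 0] by blast
  then have "(\<lambda>k. nrm (Am k) (\<phi> k n a)) \<longlonglongrightarrow> L" unfolding s_def by (rule LIMSEQ_offset)
  then show ?thesis by (rule convergentI)
qed

lemma nrm_ALim:
  assumes a: "a \<in> carrier (Am n)"
  shows "(\<lambda>k. nrm (Am k) (\<phi> k n a)) \<longlonglongrightarrow> nrm ALim (cl n a)"
proof -
  define z where "z = (SOME z. z \<in> cl n a)"
  have z: "z \<in> cl n a" unfolding z_def by (rule someI[of "\<lambda>z. z \<in> cl n a"], rule cl_self[OF a])
  obtain m b where mb: "z = (m, b)" by (cases z)
  obtain h where h: "n \<le> h" "m \<le> h" "\<phi> h n a = \<phi> h m b" and b: "b \<in> carrier (Am m)"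
    using z unfolding mb cl_mem by auto
  have lim: "nrm ALim (cl n a) = lim (\<lambda>k. nrm (Am k) (\<phi> k m b))"
    by (simp add: algebraic_direct_limit_def z_def[symmetric] mb)
  have conv: "(\<lambda>k. nrm (Am k) (\<phi> k m b)) \<longlonglongrightarrow> lim (\<lambda>k. nrm (Am k) (\<phi> k m b))"
    using nrm_\<phi>_convergent[OF b] by (simp add: convergent_LIMSEQ_iff)
  have "eventually (\<lambda>k. nrm (Am k) (\<phi> k m b) = nrm (Am k) (\<phi> k n a)) sequentially"
    unfolding eventually_sequentially
  proof (intro exI[of _ h] allI impI)
    fix k assume "h \<le> k"
    then have "\<phi> k n a = \<phi> k m b" using h a b by (intro \<phi>_eq_mono[of n h m k]) auto
    then show "nrm (Am k) (\<phi> k m b) = nrm (Am k) (\<phi> k n a)" by simp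
  qed
  then show ?thesis unfolding lim by (rule Lim_transform_eventually[OF conv])
qed

end

text \<open>What a direct limit provides: homomorphisms from all stages that are compatible, whose norms
  are the limit norms, and whose ranges together are dense.\<close>

locale block_limit = block_system Am p I blk R \<phi> + L: banach_algebra L
  for Am :: "nat \<Rightarrow> ('a, 'm) normed_module_scheme" and p
    and I :: "nat \<Rightarrow> 'i::countable set" and blk R \<phi>
    and L :: "('b, 'n) normed_module_scheme" +
  fixes \<phi>L :: "nat \<Rightarrow> 'a \<Rightarrow> 'b"
  assumes \<phi>L_hom: "\<phi>L n \<in> alg_hom (Am n) L"
    and \<phi>L_\<phi>: "n \<le> m \<Longrightarrow> a \<in> carrier (Am n) \<Longrightarrow> \<phi>L m (\<phi> m n a) = \<phi>L n a"
    and nrm_\<phi>L: "a \<in> carrier (Am n) \<Longrightarrow> (\<lambda>k. nrm (Am k) (\<phi> k n a)) \<longlonglongrightarrow> nrm L (\<phi>L n a)"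
    and dense: "x \<in> carrier L \<Longrightarrow> 0 < \<epsilon> \<Longrightarrow> \<exists>n. \<exists>a\<in>carrier (Am n). nrm L (x \<ominus>\<^bsub>L\<^esub> \<phi>L n a) < \<epsilon>"

lemma (in block_system) direct_limit_block_limit:
  assumes "is_direct_limit Am \<phi> L \<phi>L"
  shows "block_limit Am p I blk R \<phi> L \<phi>L"
proof -
  obtain \<iota> where comp: "hausdorff_completion ALim L \<iota>"
    and \<iota>: "\<And>n a. a \<in> carrier (Am n) \<Longrightarrow> \<phi>L n a = \<iota> (cl n a)"
    using assms unfolding is_direct_limit_def by blast
  have L: "banach_algebra L" and \<iota>h: "\<iota> \<in> alg_hom ALim L" and iso: "isometric ALim L \<iota>"
    and dense: "ntopology L closure_of (\<iota> ` carrier ALim) = carrier L"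
    using comp by (auto simp: hausdorff_completion_def)
  interpret L: banach_algebra L by fact
  have cl: "cl n a \<in> carrier ALim" if "a \<in> carrier (Am n)" for n a
    using that by (auto simp: carrier_ALim)
  show ?thesis
  proof (intro block_limit.intro block_limit_axioms.intro block_system_axioms L)
    show "\<phi>L n \<in> alg_hom (Am n) L" for n
    proof (rule alg_homI)
      fix a assume a: "a \<in> carrier (Am n)"
      show "\<phi>L n a \<in> carrier L" using alg_homD(2)[OF \<iota>h cl[OF a]] by (simp add: \<iota> a)
      show "\<phi>L n (t \<odot>\<^bsub>Am n\<^esub> a) = t \<odot>\<^bsub>L\<^esub> \<phi>L n a" for t
        using alg_homD(4)[OF \<iota>h cl[OF a], of t] a by (simp add: \<iota> ALim_smult)
      fix b assume b: "b \<in> carrier (Am n)"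
      show "\<phi>L n (a \<oplus>\<^bsub>Am n\<^esub> b) = \<phi>L n a \<oplus>\<^bsub>L\<^esub> \<phi>L n b"
        using alg_homD(3)[OF \<iota>h cl[OF a] cl[OF b]] a b by (simp add: \<iota> ALim_add)
      show "\<phi>L n (a \<otimes>\<^bsub>Am n\<^esub> b) = \<phi>L n a \<otimes>\<^bsub>L\<^esub> \<phi>L n b"
        using alg_homD(5)[OF \<iota>h cl[OF a] cl[OF b]] a b by (simp add: \<iota> ALim_mult Al.mult_closed)
    qed
    show "\<phi>L m (\<phi> m n a) = \<phi>L n a" if "n \<le> m" "a \<in> carrier (Am n)" for n m a
      using that by (simp add: \<iota> \<phi>_closed cl_\<phi>)
    show "(\<lambda>k. nrm (Am k) (\<phi> k n a)) \<longlonglongrightarrow> nrm L (\<phi>L n a)" if a: "a \<in> carrier (Am n)" for n a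
      using nrm_ALim[OF a] iso cl[OF a] by (simp add: \<iota>[OF a] isometric_def)
    show "\<exists>n. \<exists>a\<in>carrier (Am n). nrm L (x \<ominus>\<^bsub>L\<^esub> \<phi>L n a) < \<epsilon>" if "x \<in> carrier L" "0 < \<epsilon>" for x \<epsilon>
    proof -
      have "\<iota> ` carrier ALim \<subseteq> carrier L" using alg_homD(2)[OF \<iota>h] by blast
      from L.dense_iff[OF this] dense
      have "\<forall>x\<in>carrier L. \<forall>\<epsilon>>0. \<exists>y\<in>\<iota> ` carrier ALim. nrm L (x \<ominus>\<^bsub>L\<^esub> y) < \<epsilon>" by (rule iffD1)
      then obtain y where y: "y \<in> \<iota> ` carrier ALim" "nrm L (x \<ominus>\<^bsub>L\<^esub> y) < \<epsilon>"
        using \<open>x \<in> carrier L\<close> \<open>0 < \<epsilon>\<close> by meson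
      then obtain n a where "a \<in> carrier (Am n)" "y = \<iota> (cl n a)" by (auto simp: carrier_ALim)
      then show ?thesis using y(2) \<iota> by (intro exI[of _ n] bexI[of _ a]) simp_all
    qed
  qed
qed

context block_limit
begin

lemmas \<phi>L_closed = alg_homD(2)[OF \<phi>L_hom]
  and \<phi>L_add = alg_homD(3)[OF \<phi>L_hom]
  and \<phi>L_smult = alg_homD(4)[OF \<phi>L_hom]
  and \<phi>L_mult = alg_homD(5)[OF \<phi>L_hom]

lemma \<phi>L_zero: "\<phi>L n \<zero>\<^bsub>Am n\<^esub> = \<zero>\<^bsub>L\<^esub>"
  using \<phi>L_smult[of "\<zero>\<^bsub>Am n\<^esub>" n 0] \<phi>L_closed[of "\<zero>\<^bsub>Am n\<^esub>" n] by simp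

lemma \<phi>L_minus:
  assumes "a \<in> carrier (Am n)" "b \<in> carrier (Am n)"
  shows "\<phi>L n (a \<ominus>\<^bsub>Am n\<^esub> b) = \<phi>L n a \<ominus>\<^bsub>L\<^esub> \<phi>L n b"
  using assms by (simp add: Al.minus_csmult L.minus_csmult \<phi>L_add \<phi>L_smult \<phi>L_closed)

lemma nrm_\<phi>L_le:
  assumes a: "a \<in> carrier (Am n)"
  shows "nrm L (\<phi>L n a) \<le> nrm (Am n) a"
proof (rule LIMSEQ_le_const2[OF nrm_\<phi>L[OF a]], intro exI[of _ n] allI impI)
  fix k assume "n \<le> k"
  then show "nrm (Am k) (\<phi> k n a) \<le> nrm (Am n) a" by (rule nrm_\<phi>_le[OF _ a])
qed

section \<open>An isometric representation of the direct limit\<close>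

text \<open>The pairs of an element of some stage, mapped to the limit, and its operator on \<open>l\<^sup>p(C)\<close> form the
  graph of an isometric homomorphism on a dense subalgebra.  Truncations \<open>H\<close> of a family to finite sets
  of labels are fixed by the identity of some stage, which gives nondegeneracy.\<close>

lemma isometric_representation:
  shows "\<exists>(C :: real set) \<pi>. \<pi> \<in> alg_hom L (bounded_operators (lps p C)) \<and>
    isometric L (bounded_operators (lps p C)) \<pi> \<and>
    (\<forall>f\<in>carrier (lps p C). \<forall>\<epsilon>>0. \<exists>a\<in>carrier L. \<exists>g\<in>carrier (lps p C). nrm (lps p C) (f \<ominus>\<^bsub>lps p C\<^esub> \<pi> a g) < \<epsilon>)"
proof -
  obtain \<sigma> lab ph where "labelled_system Am p I blk R \<phi> \<sigma> lab ph" using labelled_system_exists by blast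
  then interpret S: labelled_system Am p I blk R \<phi> \<sigma> lab ph .
  note p = Al.p_ge_1
  have BO: "banach_algebra S.E.BO" by (rule S.E.banach_algebra_BO[OF complex_banach_space_Lp[OF p]])
  define G where "G = {(\<phi>L n a, S.opr n a) | n a. a \<in> carrier (Am n)}"
  have G: "(\<phi>L n a, S.opr n a) \<in> G" if "a \<in> carrier (Am n)" for n a
    using that by (auto simp: G_def)
  have common: "\<exists>k a b. a \<in> carrier (Am k) \<and> b \<in> carrier (Am k) \<and> x = \<phi>L k a \<and> T = S.opr k a \<and>
      y = \<phi>L k b \<and> W = S.opr k b" if xT: "(x, T) \<in> G" and yW: "(y, W) \<in> G" for x T y W
  proof -
    obtain n a where a: "x = \<phi>L n a" "T = S.opr n a" "a \<in> carrier (Am n)" using xT by (auto simp: G_def)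
    obtain m b where b: "y = \<phi>L m b" "W = S.opr m b" "b \<in> carrier (Am m)" using yW by (auto simp: G_def)
    define k where "k = max n m"
    have k: "n \<le> k" "m \<le> k" by (auto simp: k_def)
    show ?thesis
      by (intro exI[of _ k] exI[of _ "\<phi> k n a"] exI[of _ "\<phi> k m b"])
        (simp add: a b k \<phi>_closed \<phi>L_\<phi> S.opr_\<phi>)
  qed
  have "\<exists>\<pi>. \<pi> \<in> alg_hom L S.E.BO \<and> isometric L S.E.BO \<pi> \<and> (\<forall>(a, T) \<in> G. \<pi> a = T)"
  proof (rule isometric_graph_extends[OF L.banach_algebra_axioms BO])
    fix x T assume xT: "(x, T) \<in> G"
    then obtain n a where a: "x = \<phi>L n a" "T = S.opr n a" "a \<in> carrier (Am n)" by (auto simp: G_def)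
    show "x \<in> carrier L \<and> T \<in> carrier S.E.BO" using a by (simp add: \<phi>L_closed S.opr_closed)
    show "(t \<odot>\<^bsub>L\<^esub> x, t \<odot>\<^bsub>S.E.BO\<^esub> T) \<in> G" for t
      using G[of "t \<odot>\<^bsub>Am n\<^esub> a" n] a by (simp add: \<phi>L_smult S.opr_smult)
    show "nrm S.E.BO T = nrm L x" using S.nrm_opr[OF a(3) nrm_\<phi>L[OF a(3)]] a by simp
  next
    fix x T y W assume "(x, T) \<in> G" "(y, W) \<in> G"
    then obtain k a b where ab: "a \<in> carrier (Am k)" "b \<in> carrier (Am k)" "x = \<phi>L k a" "T = S.opr k a"
      "y = \<phi>L k b" "W = S.opr k b" using common by blast
    show "(x \<oplus>\<^bsub>L\<^esub> y, T \<oplus>\<^bsub>S.E.BO\<^esub> W) \<in> G"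
      using G[of "a \<oplus>\<^bsub>Am k\<^esub> b" k] ab by (simp add: \<phi>L_add S.opr_add)
    show "(x \<otimes>\<^bsub>L\<^esub> y, T \<otimes>\<^bsub>S.E.BO\<^esub> W) \<in> G"
      using G[of "a \<otimes>\<^bsub>Am k\<^esub> b" k] ab by (simp add: \<phi>L_mult S.opr_mult Al.mult_closed)
  next
    fix x and \<epsilon> :: real assume "x \<in> carrier L" "0 < \<epsilon>"
    then obtain n a where "a \<in> carrier (Am n)" "nrm L (x \<ominus>\<^bsub>L\<^esub> \<phi>L n a) < \<epsilon>" using dense by blast
    then show "\<exists>(a, T)\<in>G. nrm L (x \<ominus>\<^bsub>L\<^esub> a) < \<epsilon>" using G by (intro bexI[of _ "(\<phi>L n a, S.opr n a)"]) auto
  qed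
  then obtain \<pi> where \<pi>12: "\<pi> \<in> alg_hom L S.E.BO" "isometric L S.E.BO \<pi>" and \<pi>3: "\<forall>(a, T) \<in> G. \<pi> a = T"
    by (elim exE conjE)
  have "\<pi> a = T" if "(a, T) \<in> G" for a T using bspec[OF \<pi>3 that] by simp
  note \<pi> = \<pi>12 this
  have "\<exists>a\<in>carrier L. \<exists>g\<in>carrier (lps p S.C). nrm (lps p S.C) (f \<ominus>\<^bsub>lps p S.C\<^esub> \<pi> a g) < \<epsilon>"
    if f: "f \<in> carrier (lps p S.C)" and \<epsilon>: "0 < \<epsilon>" for f \<epsilon>
  proof -
    obtain F where F: "F \<in> lpf p S.C" "f = lp_class p S.C F" using f by (rule S.carrier_lps_cases)
    obtain D where D: "finite D" "D \<subseteq> S.C" "lp_norm p S.C (\<lambda>x. F x - (if x \<in> D then F x else 0)) < \<epsilon>"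
      using lp_finite_support_dense[OF p F(1) \<epsilon>] by blast
    define H where "H x = (if x \<in> D then F x else 0)" for x
    have H: "H \<in> lpf p S.C" by (rule lp_finite_support[OF D(1)]) (simp add: H_def)
    obtain k where k: "D \<subseteq> lab k ` surv k" using S.finite_subset_C[OF D(1,2), of 0] by blast
    have "S.opr k \<one>\<^bsub>Am k\<^esub> (lp_class p S.C H) = lp_class p S.C H"
      unfolding S.opr_class[OF Al.one_closed H]
    proof (rule lp_class_eqI[OF _ S.act_lpf[OF Al.one_closed H] H])
      show "S.act k \<one>\<^bsub>Am k\<^esub> H c = H c" if "c \<in> S.C" for c
        by (rule S.act_one_finite_support[OF _ that]) (use k in \<open>auto simp: H_def\<close>)
    qed
    then have "\<pi> (\<phi>L k \<one>\<^bsub>Am k\<^esub>) (lp_class p S.C H) = lp_class p S.C H"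
      using \<pi>(3)[OF G[OF Al.one_closed]] by simp
    moreover have "nrm (lps p S.C) (f \<ominus>\<^bsub>lps p S.C\<^esub> lp_class p S.C H) < \<epsilon>"
      using D(3) lp_class_minus[OF p F(1) H] by (simp add: F(2) nrm_lp_class H_def)
    ultimately show ?thesis
      using H Al.one_closed[of k] by (intro bexI[of _ "\<phi>L k \<one>\<^bsub>Am k\<^esub>"] bexI[of _ "lp_class p S.C H"]) (simp_all add: \<phi>L_closed)
  qed
  then show ?thesis using \<pi>(1,2) by (intro exI[of _ S.C] exI[of _ \<pi>] conjI) auto
qed

end

lemma (in complex_normed_space) submodule_closed_under:
  assumes "H \<subseteq> carrier V" "H \<noteq> {}" "\<And>x y. x \<in> H \<Longrightarrow> y \<in> H \<Longrightarrow> x \<oplus> y \<in> H"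
    "\<And>c x. x \<in> H \<Longrightarrow> c \<odot> x \<in> H"
  shows "submodule H complex_ring V"
proof (rule submoduleI)
  obtain x where x: "x \<in> H" using assms(2) by blast
  then show "\<zero> \<in> H" using assms(4)[OF x, of 0] assms(1) by (simp add: subset_iff)
  show "\<ominus> x \<in> H" if "x \<in> H" for x
    using that assms(1) assms(4)[OF that, of "-1"] by (simp add: uminus_csmult subset_iff)
qed (use assms in auto)

text \<open>The range of an isometric homomorphism of a Banach algebra is complete, hence closed.\<close>

lemma isometric_range_Lp_operator_algebra:
  fixes C :: "'x set"
  assumes p: "1 \<le> p" and L: "banach_algebra L" and \<pi>: "\<pi> \<in> alg_hom L (bounded_operators (lps p C))"
    and iso: "isometric L (bounded_operators (lps p C)) \<pi>"
  shows "Lp_operator_algebra TYPE('x) p L"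
proof -
  interpret L: banach_algebra L by fact
  interpret E: complex_normed_space "lps p C" by (rule complex_normed_space_Lp[OF p])
  interpret BO: banach_algebra E.BO by (rule E.banach_algebra_BO[OF complex_banach_space_Lp[OF p]])
  interpret MS: Metric_space "carrier E.BO" "ndist E.BO" by (rule BO.Metric_space_ndist)
  define B where "B = \<pi> ` carrier L"
  note \<pi>c = alg_homD(2)[OF \<pi>]
  have diff: "nrm E.BO (\<pi> a \<ominus>\<^bsub>E.BO\<^esub> \<pi> b) = nrm L (a \<ominus>\<^bsub>L\<^esub> b)" if "a \<in> carrier L" "b \<in> carrier L" for a b
    using linear_maps_minus[OF alg_homD(1)[OF \<pi>] L.complex_normed_space_axioms BO.complex_normed_space_axioms that]
      iso that unfolding isometric_def by (metis L.M.minus_closed)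
  have B: "B \<subseteq> carrier E.BO" using \<pi>c by (auto simp: B_def)
  have sub: "submodule B complex_ring E.BO"
  proof (rule BO.submodule_closed_under[OF B])
    show "B \<noteq> {}" using L.M.zero_closed by (auto simp: B_def)
    fix S T assume "S \<in> B" "T \<in> B"
    then obtain a b where "S = \<pi> a" "T = \<pi> b" "a \<in> carrier L" "b \<in> carrier L" by (auto simp: B_def)
    then show "S \<oplus>\<^bsub>E.BO\<^esub> T \<in> B"
      using alg_homD(3)[OF \<pi>, of a b] unfolding B_def by (metis L.M.add.m_closed imageI)
  next
    fix c S assume "S \<in> B"
    then obtain a where "S = \<pi> a" "a \<in> carrier L" by (auto simp: B_def)
    then show "c \<odot>\<^bsub>E.BO\<^esub> S \<in> B"
      using alg_homD(4)[OF \<pi>, of a c] unfolding B_def by (metis L.csmult_closed imageI)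
  qed
  have mult: "S \<otimes>\<^bsub>E.BO\<^esub> T \<in> B" if "S \<in> B" "T \<in> B" for S T
  proof -
    obtain a b where "S = \<pi> a" "T = \<pi> b" "a \<in> carrier L" "b \<in> carrier L" using \<open>S \<in> B\<close> \<open>T \<in> B\<close> by (auto simp: B_def)
    then show ?thesis using alg_homD(5)[OF \<pi>, of a b] unfolding B_def by (metis L.mult_closed imageI)
  qed
  have closed: "closedin (ntopology E.BO) B"
    unfolding MS.metric_closedin_iff_sequentially_closed
  proof (intro conjI B allI impI)
    fix s T assume "range s \<subseteq> B \<and> limitin (ntopology E.BO) s T sequentially"
    then have s: "\<And>n. s n \<in> \<pi> ` carrier L" and T: "T \<in> carrier E.BO"
      and lim: "\<And>\<epsilon>. \<epsilon> > 0 \<Longrightarrow> \<exists>N. \<forall>n\<ge>N. nrm E.BO (s n \<ominus>\<^bsub>E.BO\<^esub> T) < \<epsilon>"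
      unfolding BO.limitin_ntopology_iff by (auto simp: B_def) (meson)
    have "\<forall>n. \<exists>x. x \<in> carrier L \<and> s n = \<pi> x" using s by blast
    from choice[OF this] obtain a where a: "\<And>n. a n \<in> carrier L" "\<And>n. s n = \<pi> (a n)" by blast
    have "\<exists>x\<in>carrier L. \<forall>\<epsilon>>0. \<exists>N. \<forall>n\<ge>N. nrm L (a n \<ominus>\<^bsub>L\<^esub> x) < \<epsilon>"
    proof (rule L.complete[unfolded L.mcomplete_ndist_iff, THEN spec, THEN mp, THEN mp])
      show "\<forall>n. a n \<in> carrier L" using a by blast
      show "\<forall>\<epsilon>>0. \<exists>N. \<forall>m\<ge>N. \<forall>n\<ge>N. nrm L (a m \<ominus>\<^bsub>L\<^esub> a n) < \<epsilon>"
      proof (intro allI impI)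
        fix \<epsilon> :: real assume "0 < \<epsilon>"
        then obtain N where N: "\<And>n. n \<ge> N \<Longrightarrow> nrm E.BO (s n \<ominus>\<^bsub>E.BO\<^esub> T) < \<epsilon>/2" using lim[of "\<epsilon>/2"] by auto
        have "nrm L (a m \<ominus>\<^bsub>L\<^esub> a n) < \<epsilon>" if "m \<ge> N" "n \<ge> N" for m n
        proof -
          have c: "s m \<in> carrier E.BO" "s n \<in> carrier E.BO" using a \<pi>c by auto
          have "nrm L (a m \<ominus>\<^bsub>L\<^esub> a n) = nrm E.BO (s m \<ominus>\<^bsub>E.BO\<^esub> s n)" using diff[OF a(1) a(1)] a(2) by simp
          also have "\<dots> \<le> nrm E.BO (s m \<ominus>\<^bsub>E.BO\<^esub> T) + nrm E.BO (T \<ominus>\<^bsub>E.BO\<^esub> s n)"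
            by (rule BO.nrm_minus_triangle[OF c(1) T c(2)])
          also have "\<dots> < \<epsilon>" using N[OF that(1)] N[OF that(2)] BO.nrm_minus_commute[OF T c(2)] by linarith
          finally show ?thesis .
        qed
        then show "\<exists>N. \<forall>m\<ge>N. \<forall>n\<ge>N. nrm L (a m \<ominus>\<^bsub>L\<^esub> a n) < \<epsilon>" by blast
      qed
    qed
    then obtain x where x: "x \<in> carrier L" "\<And>\<epsilon>. \<epsilon> > 0 \<Longrightarrow> \<exists>N. \<forall>n\<ge>N. nrm L (a n \<ominus>\<^bsub>L\<^esub> x) < \<epsilon>" by blast
    have "T = \<pi> x"
    proof (rule BO.eq_if_nrm_minus_small[OF T \<pi>c[OF x(1)], where K = 2])
      fix \<epsilon> :: real assume e: "0 < \<epsilon>"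
      obtain N where N: "\<forall>n\<ge>N. nrm L (a n \<ominus>\<^bsub>L\<^esub> x) < \<epsilon>" using x(2)[OF e] by blast
      obtain M where M: "\<forall>n\<ge>M. nrm E.BO (s n \<ominus>\<^bsub>E.BO\<^esub> T) < \<epsilon>" using lim[OF e] by blast
      define n where "n = max N M"
      have c: "s n \<in> carrier E.BO" using a \<pi>c by auto
      have "nrm E.BO (T \<ominus>\<^bsub>E.BO\<^esub> \<pi> x) \<le> nrm E.BO (T \<ominus>\<^bsub>E.BO\<^esub> s n) + nrm E.BO (s n \<ominus>\<^bsub>E.BO\<^esub> \<pi> x)"
        by (rule BO.nrm_minus_triangle[OF T c \<pi>c[OF x(1)]])
      moreover have "nrm E.BO (s n \<ominus>\<^bsub>E.BO\<^esub> \<pi> x) < \<epsilon>" using N diff[OF a(1) x(1)] a(2) by (simp add: n_def)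
      moreover have "nrm E.BO (T \<ominus>\<^bsub>E.BO\<^esub> s n) < \<epsilon>" using M BO.nrm_minus_commute[OF T c] by (simp add: n_def)
      ultimately show "nrm E.BO (T \<ominus>\<^bsub>E.BO\<^esub> \<pi> x) \<le> 2 * \<epsilon>" by linarith
    qed
    then show "T \<in> B" using x(1) by (simp add: B_def)
  qed
  have "inj_on \<pi> (carrier L)"
  proof (rule inj_onI)
    fix a b assume ab: "a \<in> carrier L" "b \<in> carrier L" "\<pi> a = \<pi> b"
    then have "nrm L (a \<ominus>\<^bsub>L\<^esub> b) = 0" using diff[OF ab(1,2)] \<pi>c by simp
    then show "a = b" using ab by (simp add: L.nrm_eq_0_iff L.minus_eq_zero_iff)
  qed
  then have "\<pi> \<in> isometric_iso L (E.BO\<lparr>carrier := B\<rparr>)"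
    using \<pi> iso by (auto simp: isometric_iso_def isometric_def bij_betw_def B_def alg_hom_def linear_maps_def hom_def)
  then show ?thesis
    unfolding Lp_operator_algebra_def using L sub mult closed by blast
qed

lemma dense_action_nondegenerately_representable:
  fixes C :: "'x set"
  assumes p: "1 \<le> p" and \<pi>: "\<pi> \<in> alg_hom L (bounded_operators (lps p C))"
    and iso: "isometric L (bounded_operators (lps p C)) \<pi>"
    and dense: "\<And>f \<epsilon>. f \<in> carrier (lps p C) \<Longrightarrow> 0 < \<epsilon> \<Longrightarrow>
      \<exists>a\<in>carrier L. \<exists>g\<in>carrier (lps p C). nrm (lps p C) (f \<ominus>\<^bsub>lps p C\<^esub> \<pi> a g) < \<epsilon>"
  shows "nondegenerately_representable TYPE('x) p L"
proof -
  interpret E: complex_normed_space "lps p C" by (rule complex_normed_space_Lp[OF p])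
  define Z where "Z = {\<pi> a \<xi> | a \<xi>. a \<in> carrier L \<and> \<xi> \<in> carrier (lps p C)}"
  have Z: "Z \<subseteq> carrier (lps p C)"
    using bounded_operators_app(1)[OF alg_homD(2)[OF \<pi>]] by (auto simp: Z_def)
  have "carrier (lps p C) \<subseteq> ntopology (lps p C) closure_of Z"
  proof
    fix f assume f: "f \<in> carrier (lps p C)"
    have "\<exists>y\<in>Z. nrm (lps p C) (f \<ominus>\<^bsub>lps p C\<^esub> y) < \<epsilon>" if "0 < \<epsilon>" for \<epsilon>
    proof -
      obtain a g where "a \<in> carrier L" "g \<in> carrier (lps p C)" "nrm (lps p C) (f \<ominus>\<^bsub>lps p C\<^esub> \<pi> a g) < \<epsilon>"
        using dense[OF f \<open>0 < \<epsilon>\<close>] by blast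
      moreover from this have "\<pi> a g \<in> Z" unfolding Z_def by blast
      ultimately show ?thesis by blast
    qed
    then show "f \<in> ntopology (lps p C) closure_of Z"
      unfolding E.in_closure_ntopology_iff[OF Z] using f by simp
  qed
  also have "\<dots> \<subseteq> ntopology (lps p C) closure_of linear_span (lps p C) Z"
    unfolding linear_span_def by (rule closure_of_mono) (rule hull_subset)
  finally have "ntopology (lps p C) closure_of linear_span (lps p C) Z = carrier (lps p C)"
    using closure_of_subset_topspace[of "ntopology (lps p C)"] by auto
  then show ?thesis
    unfolding nondegenerately_representable_def Z_def using \<pi> iso by blast
qed

context block_limit
begin

section \<open>Separability\<close>

text \<open>This crude bound shows that entrywise approximation is approximation in norm.\<close>

lemma nrm_le_sum_entries:
  assumes a: "a \<in> carrier (Am n)"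
  shows "nrm (Am n) a \<le> real (card (I n)) * (\<Sum>i\<in>I n. \<Sum>j\<in>I n. cmod (R n a i j))"
proof -
  have "0 \<le> real (card (I n)) * (\<Sum>i\<in>I n. \<Sum>j\<in>I n. cmod (R n a i j))" by (simp add: sum_nonneg)
  then show ?thesis
    using Al.R_nrm[OF a] mv_lp_norm_le[OF Al.finite_I[of n] Al.p_ge_1, of "R n a"] by blast
qed

text \<open>A countable dense subset of a stage.\<close>

definition rational_elements :: "nat \<Rightarrow> 'a set" where
  "rational_elements n = {a \<in> carrier (Am n). \<forall>i j. Re (R n a i j) \<in> \<rat> \<and> Im (R n a i j) \<in> \<rat>}"

lemma countable_rational_elements: "countable (rational_elements n)"
proof (rule countable_image_inj_on[where f = "\<lambda>a. \<lambda>ij\<in>I n \<times> I n. R n a (fst ij) (snd ij)"])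
  define Q where "Q = {z. Re z \<in> \<rat> \<and> Im z \<in> \<rat>}"
  have "Q \<subseteq> (\<lambda>(x, y). Complex x y) ` (\<rat> \<times> \<rat>)" by (force simp: Q_def intro: image_eqI[of _ _ "(Re z, Im z)" for z])
  then have "countable Q" using countable_rat by (meson countable_SIGMA countable_image countable_subset)
  then have "countable (PiE (I n \<times> I n) (\<lambda>_. Q))"
    using Al.finite_I by (intro countable_PiE) auto
  moreover have "(\<lambda>a. \<lambda>ij\<in>I n \<times> I n. R n a (fst ij) (snd ij)) ` rational_elements n \<subseteq> PiE (I n \<times> I n) (\<lambda>_. Q)"
  proof (rule image_subsetI)
    fix a assume "a \<in> rational_elements n"
    then show "(\<lambda>ij\<in>I n \<times> I n. R n a (fst ij) (snd ij)) \<in> PiE (I n \<times> I n) (\<lambda>_. Q)"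
      unfolding restrict_PiE_iff by (simp add: rational_elements_def Q_def)
  qed
  ultimately show "countable ((\<lambda>a. \<lambda>ij\<in>I n \<times> I n. R n a (fst ij) (snd ij)) ` rational_elements n)"
    by (rule countable_subset[rotated])
  show "inj_on (\<lambda>a. \<lambda>ij\<in>I n \<times> I n. R n a (fst ij) (snd ij)) (rational_elements n)"
  proof (rule inj_onI)
    fix a b assume ab: "a \<in> rational_elements n" "b \<in> rational_elements n"
      "(\<lambda>ij\<in>I n \<times> I n. R n a (fst ij) (snd ij)) = (\<lambda>ij\<in>I n \<times> I n. R n b (fst ij) (snd ij))"
    show "a = b"
    proof (rule Al.R_ext)
      fix i j assume "i \<in> I n" "j \<in> I n"
      then show "R n a i j = R n b i j" using fun_cong[OF ab(3), of "(i, j)"] by simp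
    qed (use ab in \<open>auto simp: rational_elements_def\<close>)
  qed
qed

lemma rational_elements_dense:
  assumes a: "a \<in> carrier (Am n)" and \<epsilon>: "0 < \<epsilon>"
  shows "\<exists>b\<in>rational_elements n. nrm (Am n) (a \<ominus>\<^bsub>Am n\<^esub> b) < \<epsilon>"
proof -
  define N where "N = real (card (I n))"
  define \<delta> where "\<delta> = \<epsilon> / (N * (N * N) + 1)"
  have N: "0 \<le> N" by (simp add: N_def)
  have \<delta>: "0 < \<delta>" using \<epsilon> N by (simp add: \<delta>_def add_nonneg_pos)
  have "\<exists>q. Re q \<in> \<rat> \<and> Im q \<in> \<rat> \<and> cmod (z - q) < \<delta>" for z
  proof -
    obtain x where x: "x \<in> \<rat>" "Re z < x" "x < Re z + \<delta>/2" using Rats_dense_in_real[of "Re z" "Re z + \<delta>/2"] \<delta> by auto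
    obtain y where y: "y \<in> \<rat>" "Im z < y" "y < Im z + \<delta>/2" using Rats_dense_in_real[of "Im z" "Im z + \<delta>/2"] \<delta> by auto
    have "cmod (z - Complex x y) \<le> \<bar>Re z - x\<bar> + \<bar>Im z - y\<bar>" using cmod_le[of "z - Complex x y"] by simp
    also have "\<dots> < \<delta>" using x y by linarith
    finally show ?thesis using x y by (intro exI[of _ "Complex x y"]) simp
  qed
  then have "\<forall>z. \<exists>q. Re q \<in> \<rat> \<and> Im q \<in> \<rat> \<and> cmod (z - q) < \<delta>" by blast
  from choice[OF this] obtain q where q: "\<And>z. Re (q z) \<in> \<rat>" "\<And>z. Im (q z) \<in> \<rat>" "\<And>z. cmod (z - q z) < \<delta>" by blast
  \<comment> \<open>entries outside of the blocks have to remain zero\<close>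
  define M where "M i j = (if R n a i j = 0 then 0 else q (R n a i j))" for i j
  have M: "M i j \<noteq> 0 \<Longrightarrow> i \<in> I n \<and> j \<in> I n \<and> blk n i = blk n j" for i j
    using Al.R_support[OF a, of i j] by (auto simp: M_def split: if_splits)
  obtain b where b: "b \<in> carrier (Am n)" "R n b = M" using Al.R_surj[OF M] by blast
  have "b \<in> rational_elements n" using b q by (auto simp: rational_elements_def M_def)
  moreover have "nrm (Am n) (a \<ominus>\<^bsub>Am n\<^esub> b) < \<epsilon>"
  proof -
    have "nrm (Am n) (a \<ominus>\<^bsub>Am n\<^esub> b) \<le> N * (\<Sum>i\<in>I n. \<Sum>j\<in>I n. cmod (R n (a \<ominus>\<^bsub>Am n\<^esub> b) i j))"
      unfolding N_def by (rule nrm_le_sum_entries) (use a b in simp)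
    also have "\<dots> \<le> N * (\<Sum>i\<in>I n. \<Sum>j\<in>I n. \<delta>)"
    proof (intro mult_left_mono sum_mono N)
      fix i j
      show "cmod (R n (a \<ominus>\<^bsub>Am n\<^esub> b) i j) \<le> \<delta>"
        using q(3)[of "R n a i j"] \<delta> by (simp add: Al.R_minus a b M_def)
    qed
    also have "\<dots> = N * (N * N) * \<delta>" by (simp add: N_def mult.assoc)
    also have "\<dots> < (N * (N * N) + 1) * \<delta>" using \<delta> by simp
    also have "\<dots> = \<epsilon>" using N by (simp add: \<delta>_def add_nonneg_eq_0_iff)
    finally show ?thesis .
  qed
  ultimately show ?thesis by blast
qed

lemma separable: "separable_space (ntopology L)"
proof -
  define D where "D = (\<Union>n. \<phi>L n ` rational_elements n)"
  have D: "D \<subseteq> carrier L" by (auto simp: D_def rational_elements_def \<phi>L_closed)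
  have "\<forall>x\<in>carrier L. \<forall>\<epsilon>>0. \<exists>y\<in>D. nrm L (x \<ominus>\<^bsub>L\<^esub> y) < \<epsilon>"
  proof (intro ballI allI impI)
    fix x and \<epsilon> :: real assume x: "x \<in> carrier L" and e: "0 < \<epsilon>"
    then obtain n a where a: "a \<in> carrier (Am n)" "nrm L (x \<ominus>\<^bsub>L\<^esub> \<phi>L n a) < \<epsilon>/2" using dense[of x "\<epsilon>/2"] by auto
    obtain b where b: "b \<in> rational_elements n" "nrm (Am n) (a \<ominus>\<^bsub>Am n\<^esub> b) < \<epsilon>/2"
      using rational_elements_dense[OF a(1), of "\<epsilon>/2"] e by auto
    have bc: "b \<in> carrier (Am n)" using b by (simp add: rational_elements_def)
    have "nrm L (x \<ominus>\<^bsub>L\<^esub> \<phi>L n b) \<le> nrm L (x \<ominus>\<^bsub>L\<^esub> \<phi>L n a) + nrm L (\<phi>L n a \<ominus>\<^bsub>L\<^esub> \<phi>L n b)"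
      by (rule L.nrm_minus_triangle[OF x \<phi>L_closed[OF a(1)] \<phi>L_closed[OF bc]])
    moreover have "nrm L (\<phi>L n a \<ominus>\<^bsub>L\<^esub> \<phi>L n b) \<le> nrm (Am n) (a \<ominus>\<^bsub>Am n\<^esub> b)"
      using nrm_\<phi>L_le[of "a \<ominus>\<^bsub>Am n\<^esub> b" n] a bc by (simp add: \<phi>L_minus)
    ultimately have "nrm L (x \<ominus>\<^bsub>L\<^esub> \<phi>L n b) < \<epsilon>" using a b by linarith
    then show "\<exists>y\<in>D. nrm L (x \<ominus>\<^bsub>L\<^esub> y) < \<epsilon>" using b(1) by (auto simp: D_def)
  qed
  then have "ntopology L closure_of D = carrier L" using L.dense_iff[OF D] by simp
  moreover have "countable D" unfolding D_def using countable_rational_elements by (intro countable_UN) auto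
  ultimately show ?thesis
    unfolding separable_space_def using D by (intro exI[of _ D]) simp
qed

end

section \<open>The approximate identity\<close>

context block_limit
begin

text \<open>The member with index \<open>0\<close> is zero, as in the convention for the homomorphism \<open>\<theta>\<close>.\<close>

definition unit :: "nat \<Rightarrow> 'b" where
  "unit n = (if n = 0 then \<zero>\<^bsub>L\<^esub> else \<phi>L n \<one>\<^bsub>Am n\<^esub>)"

text \<open>The element \<open>unit n\<close> before passing from stage \<open>m\<close> to the limit.\<close>

definition stage_unit :: "nat \<Rightarrow> nat \<Rightarrow> 'a" where
  "stage_unit m n = (if n = 0 then \<zero>\<^bsub>Am m\<^esub> else \<phi> m n \<one>\<^bsub>Am n\<^esub>)"

lemma stage_unit_closed: "n \<le> m \<Longrightarrow> stage_unit m n \<in> carrier (Am m)"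
  by (simp add: stage_unit_def \<phi>_closed Al.one_closed)

lemma unit_eq: "n \<le> m \<Longrightarrow> unit n = \<phi>L m (stage_unit m n)"
  by (simp add: unit_def stage_unit_def \<phi>L_zero \<phi>L_\<phi> Al.one_closed)

lemma unit_closed [simp]: "unit n \<in> carrier L"
  by (simp add: unit_def \<phi>L_closed Al.one_closed)

lemma unit_mult:
  assumes a: "a \<in> carrier (Am m)" and n: "m \<le> n" "0 < n"
  shows "unit n \<otimes>\<^bsub>L\<^esub> \<phi>L m a = \<phi>L m a" "\<phi>L m a \<otimes>\<^bsub>L\<^esub> unit n = \<phi>L m a"
proof -
  have c: "\<phi> n m a \<in> carrier (Am n)" by (rule \<phi>_closed[OF n(1) a])
  have "\<phi>L m a = \<phi>L n (\<phi> n m a)" using \<phi>L_\<phi>[OF n(1) a] by simp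
  moreover have "unit n = \<phi>L n \<one>\<^bsub>Am n\<^esub>" using n by (simp add: unit_def)
  ultimately show "unit n \<otimes>\<^bsub>L\<^esub> \<phi>L m a = \<phi>L m a" "\<phi>L m a \<otimes>\<^bsub>L\<^esub> unit n = \<phi>L m a"
    using \<phi>L_mult[OF Al.one_closed c] \<phi>L_mult[OF c Al.one_closed] c
    by (simp_all add: Al.one_left Al.one_right)
qed

lemma unit_mult_unit:
  assumes "m \<le> n"
  shows "unit m \<otimes>\<^bsub>L\<^esub> unit n = unit m" "unit n \<otimes>\<^bsub>L\<^esub> unit m = unit m"
proof -
  show "unit m \<otimes>\<^bsub>L\<^esub> unit n = unit m"
  proof (cases "m = 0")
    case True
    then show ?thesis using unit_closed[of n] by (simp add: unit_def[of 0])
  next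
    case False
    then show ?thesis
      using unit_mult(2)[OF Al.one_closed[of m] assms] assms by (simp add: unit_def[of m])
  qed
  show "unit n \<otimes>\<^bsub>L\<^esub> unit m = unit m"
  proof (cases "m = 0")
    case True
    then show ?thesis using unit_closed[of n] by (simp add: unit_def[of 0])
  next
    case False
    then show ?thesis
      using unit_mult(1)[OF Al.one_closed[of m] assms] assms by (simp add: unit_def[of m])
  qed
qed

lemma nrm_unit_le: "nrm L (unit n) \<le> 1"
  using nrm_\<phi>L_le[OF Al.one_closed[of n]] Al.nrm_one_le[of n] by (simp add: unit_def)

lemma nondecreasing_units:
  assumes e: "\<And>n. n > 0 \<Longrightarrow> e n = unit n"
  shows "nondecreasing_idempotents L e"
  unfolding nondecreasing_idempotents_def
  by (simp add: e unit_mult_unit)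

lemma approximate_units:
  assumes e: "\<And>n. n > 0 \<Longrightarrow> e n = unit n"
  shows "approximate_identity L e"
  unfolding approximate_identity_def L.limitin_ntopology_iff
proof (intro ballI conjI allI impI)
  fix x and \<epsilon> :: real assume x: "x \<in> carrier L" and "0 < \<epsilon>"
  then obtain m a where a: "a \<in> carrier (Am m)" "nrm L (x \<ominus>\<^bsub>L\<^esub> \<phi>L m a) < \<epsilon>/2"
    using dense[of x "\<epsilon>/2"] by auto
  define y where "y = \<phi>L m a"
  have y: "y \<in> carrier L" using a by (simp add: y_def \<phi>L_closed)
  have xy: "x \<ominus>\<^bsub>L\<^esub> y \<in> carrier L" "nrm L (x \<ominus>\<^bsub>L\<^esub> y) < \<epsilon>/2" using x y a by (auto simp: y_def)
  have est: "nrm L (z \<ominus>\<^bsub>L\<^esub> x) < \<epsilon>"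
    if z: "z \<in> carrier L" "nrm L (z \<ominus>\<^bsub>L\<^esub> y) \<le> nrm L (x \<ominus>\<^bsub>L\<^esub> y)" for z
    using L.nrm_minus_triangle[OF z(1) y x] z(2) xy(2) L.nrm_minus_commute[OF x y] by linarith
  show "\<exists>N. \<forall>n\<ge>N. e n \<otimes>\<^bsub>L\<^esub> x \<in> carrier L \<and> nrm L (e n \<otimes>\<^bsub>L\<^esub> x \<ominus>\<^bsub>L\<^esub> x) < \<epsilon>"
  proof (intro exI[of _ "Suc m"] allI impI conjI)
    fix n assume n: "Suc m \<le> n"
    have en: "e n = unit n" using e[of n] n by simp
    show c: "e n \<otimes>\<^bsub>L\<^esub> x \<in> carrier L" using x by (simp add: en L.mult_closed)
    have "unit n \<otimes>\<^bsub>L\<^esub> x \<ominus>\<^bsub>L\<^esub> y = unit n \<otimes>\<^bsub>L\<^esub> (x \<ominus>\<^bsub>L\<^esub> y)"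
      using unit_mult(1)[OF a(1), of n] n x y by (simp add: L.mult_minus_right y_def)
    then have "nrm L (unit n \<otimes>\<^bsub>L\<^esub> x \<ominus>\<^bsub>L\<^esub> y) \<le> nrm L (unit n) * nrm L (x \<ominus>\<^bsub>L\<^esub> y)"
      using L.nrm_mult[OF unit_closed[of n] xy(1)] by simp
    also have "\<dots> \<le> 1 * nrm L (x \<ominus>\<^bsub>L\<^esub> y)" using nrm_unit_le xy by (intro mult_right_mono) auto
    finally show "nrm L (e n \<otimes>\<^bsub>L\<^esub> x \<ominus>\<^bsub>L\<^esub> x) < \<epsilon>" using est[OF c] by (simp add: en)
  qed
  show "\<exists>N. \<forall>n\<ge>N. x \<otimes>\<^bsub>L\<^esub> e n \<in> carrier L \<and> nrm L (x \<otimes>\<^bsub>L\<^esub> e n \<ominus>\<^bsub>L\<^esub> x) < \<epsilon>"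
  proof (intro exI[of _ "Suc m"] allI impI conjI)
    fix n assume n: "Suc m \<le> n"
    have en: "e n = unit n" using e[of n] n by simp
    show c: "x \<otimes>\<^bsub>L\<^esub> e n \<in> carrier L" using x by (simp add: en L.mult_closed)
    have "x \<otimes>\<^bsub>L\<^esub> unit n \<ominus>\<^bsub>L\<^esub> y = (x \<ominus>\<^bsub>L\<^esub> y) \<otimes>\<^bsub>L\<^esub> unit n"
      using unit_mult(2)[OF a(1), of n] n x y by (simp add: L.mult_minus_left y_def)
    then have "nrm L (x \<otimes>\<^bsub>L\<^esub> unit n \<ominus>\<^bsub>L\<^esub> y) \<le> nrm L (x \<ominus>\<^bsub>L\<^esub> y) * nrm L (unit n)"
      using L.nrm_mult[OF xy(1) unit_closed[of n]] by simp
    also have "\<dots> \<le> nrm L (x \<ominus>\<^bsub>L\<^esub> y) * 1" using nrm_unit_le xy by (intro mult_left_mono) auto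
    finally show "nrm L (x \<otimes>\<^bsub>L\<^esub> e n \<ominus>\<^bsub>L\<^esub> x) < \<epsilon>" using est[OF c] by (simp add: en)
  qed
qed auto

section \<open>The homomorphism of finitely supported functions\<close>

definition gap :: "nat \<Rightarrow> 'b" where
  "gap n = unit n \<ominus>\<^bsub>L\<^esub> unit (n - 1)"

lemma gap_closed [simp]: "gap n \<in> carrier L"
  by (simp add: gap_def)

lemma gap_mult_gap: "gap m \<otimes>\<^bsub>L\<^esub> gap n = (if m = n then gap m else \<zero>\<^bsub>L\<^esub>)"
proof -
  have "gap m \<otimes>\<^bsub>L\<^esub> gap n = (unit m \<otimes>\<^bsub>L\<^esub> unit n \<ominus>\<^bsub>L\<^esub> unit m \<otimes>\<^bsub>L\<^esub> unit (n - 1)) \<ominus>\<^bsub>L\<^esub>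
      (unit (m - 1) \<otimes>\<^bsub>L\<^esub> unit n \<ominus>\<^bsub>L\<^esub> unit (m - 1) \<otimes>\<^bsub>L\<^esub> unit (n - 1))"
    unfolding gap_def by (subst L.mult_minus_left) (simp_all add: L.mult_minus_right)
  also have "\<dots> = (if m = n then gap m else \<zero>\<^bsub>L\<^esub>)"
  proof (cases m n rule: linorder_cases)
    case less
    then have "m \<le> n" "m \<le> n - 1" "m - 1 \<le> n" "m - 1 \<le> n - 1" by auto
    then show ?thesis using less by (simp add: unit_mult_unit)
  next
    case equal
    then show ?thesis by (simp add: unit_mult_unit gap_def)
  next
    case greater
    then have "n \<le> m" "n \<le> m - 1" "n - 1 \<le> m" "n - 1 \<le> m - 1" by auto
    then show ?thesis using greater by (simp add: unit_mult_unit)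
  qed
  finally show ?thesis .
qed

text \<open>The value of \<open>\<theta>\<close> at a function supported in \<open>{1..n}\<close>.\<close>

primrec gap_sum :: "(nat \<Rightarrow> complex) \<Rightarrow> nat \<Rightarrow> 'b" where
  "gap_sum f 0 = \<zero>\<^bsub>L\<^esub>"
| "gap_sum f (Suc n) = gap_sum f n \<oplus>\<^bsub>L\<^esub> f (Suc n) \<odot>\<^bsub>L\<^esub> gap (Suc n)"

lemma gap_sum_closed [simp]: "gap_sum f n \<in> carrier L"
  by (induction n) auto

lemma gap_sum_gap: "n < m \<Longrightarrow> gap_sum f n \<otimes>\<^bsub>L\<^esub> gap m = \<zero>\<^bsub>L\<^esub>"
  by (induction n) (auto simp: L.mult_distr_left L.smult_mult_left gap_mult_gap)

lemma gap_gap_sum: "n < m \<Longrightarrow> gap m \<otimes>\<^bsub>L\<^esub> gap_sum f n = \<zero>\<^bsub>L\<^esub>"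
  by (induction n) (auto simp: L.mult_distr_right L.smult_mult_right gap_mult_gap)

text \<open>The gaps are orthogonal idempotents.\<close>

lemma gap_sum_mult: "gap_sum f n \<otimes>\<^bsub>L\<^esub> gap_sum g n = gap_sum (\<lambda>n. f n * g n) n"
proof (induction n)
  case (Suc n)
  have "gap_sum f (Suc n) \<otimes>\<^bsub>L\<^esub> gap_sum g (Suc n) =
      gap_sum f n \<otimes>\<^bsub>L\<^esub> gap_sum g n \<oplus>\<^bsub>L\<^esub> (f (Suc n) * g (Suc n)) \<odot>\<^bsub>L\<^esub> gap (Suc n)"
    by (simp add: L.mult_distr_left L.mult_distr_right L.smult_mult_left L.smult_mult_right L.mult_closed
        gap_sum_gap gap_gap_sum gap_mult_gap L.csmult_assoc mult.commute)
  then show ?case using Suc by simp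
qed simp

lemma gap_sum_add: "gap_sum (\<lambda>n. f n + g n) n = gap_sum f n \<oplus>\<^bsub>L\<^esub> gap_sum g n"
  by (induction n) (simp_all add: L.csmult_add_left L.M.a_ac)

lemma gap_sum_scale: "gap_sum (\<lambda>n. c * f n) n = c \<odot>\<^bsub>L\<^esub> gap_sum f n"
  by (induction n) (simp_all add: L.csmult_add_right L.csmult_assoc)

lemma gap_sum_stable:
  assumes "n \<le> m" "\<And>k. k > n \<Longrightarrow> f k = 0"
  shows "gap_sum f m = gap_sum f n"
  using assms(1) by (induction m rule: dec_induct) (use assms(2) in auto)

lemma gap_sum_indicator:
  assumes "0 < k"
  shows "gap_sum (indicator {k}) n = (if k \<le> n then gap k else \<zero>\<^bsub>L\<^esub>)"
  by (induction n) (use assms in \<open>auto simp: indicator_def le_Suc_eq\<close>)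

text \<open>At every later stage the partial sum is represented by a diagonal matrix whose entries are
  values of \<open>f\<close> or zero, because the images of the identities are increasing coordinate
  projections.\<close>

lemma gap_sum_diagonal:
  assumes K: "0 \<le> K" "\<And>k. cmod (f k) \<le> K" and n: "n \<le> m"
  shows "\<exists>h\<in>carrier (Am m). gap_sum f n = \<phi>L m h \<and> (\<forall>i j. i \<noteq> j \<longrightarrow> R m h i j = 0) \<and>
    (\<forall>i. cmod (R m h i i) \<le> K) \<and> (\<forall>i. R m (stage_unit m n) i i = 0 \<longrightarrow> R m h i i = 0)"
  using n
proof (induction n)
  case 0
  show ?case
    by (rule bexI[of _ "\<zero>\<^bsub>Am m\<^esub>"]) (auto simp: \<phi>L_zero K)
next
  case (Suc n)
  obtain h where hc: "h \<in> carrier (Am m)" and hs: "gap_sum f n = \<phi>L m h \<and> (\<forall>i j. i \<noteq> j \<longrightarrow> R m h i j = 0) \<and>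
    (\<forall>i. cmod (R m h i i) \<le> K) \<and> (\<forall>i. R m (stage_unit m n) i i = 0 \<longrightarrow> R m h i i = 0)"
    using Suc.IH[OF Suc_leD[OF Suc.prems]] by (elim bexE)
  then have h: "h \<in> carrier (Am m)" "gap_sum f n = \<phi>L m h" "\<And>i j. i \<noteq> j \<Longrightarrow> R m h i j = 0"
    "\<And>i. cmod (R m h i i) \<le> K" "\<And>i. R m (stage_unit m n) i i = 0 \<Longrightarrow> R m h i i = 0"
    by simp_all
  define u where "u = stage_unit m n"
  define v where "v = stage_unit m (Suc n)"
  have nm: "n \<le> m" "Suc n \<le> m" using Suc.prems by auto
  have uv: "u \<in> carrier (Am m)" "v \<in> carrier (Am m)" using nm by (auto simp: u_def v_def stage_unit_closed)
  have entries: "(\<forall>i j. i \<noteq> j \<longrightarrow> R m (stage_unit m k) i j = 0) \<and>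
      (\<forall>i. R m (stage_unit m k) i i = 0 \<or> R m (stage_unit m k) i i = 1)" if k: "k \<le> m" for k
  proof (cases "k = 0")
    case False
    interpret H: block_hom "Am k" p "I k" "blk k" "R k" "Am m" "I m" "blk m" "R m" "\<phi> m k"
      by (rule block_hom[OF k])
    show ?thesis using False H.one_diagonal H.one_entry by (simp add: stage_unit_def)
  qed (simp add: stage_unit_def)
  have u: "\<And>i j. i \<noteq> j \<Longrightarrow> R m u i j = 0" "\<And>i. R m u i i = 0 \<or> R m u i i = 1"
    using entries[OF nm(1)] by (auto simp: u_def)
  have v: "\<And>i j. i \<noteq> j \<Longrightarrow> R m v i j = 0" "\<And>i. R m v i i = 0 \<or> R m v i i = 1"
    using entries[OF nm(2)] by (auto simp: v_def)
  have "u \<otimes>\<^bsub>Am m\<^esub> v = u"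
  proof (cases "n = 0")
    case True
    then show ?thesis using uv by (simp add: u_def stage_unit_def)
  next
    case False
    have "\<phi> m n \<one>\<^bsub>Am n\<^esub> = \<phi> m (Suc n) (\<phi> (Suc n) n \<one>\<^bsub>Am n\<^esub>)"
      using \<phi>_comp[of n "Suc n" m "\<one>\<^bsub>Am n\<^esub>"] nm by (simp add: Al.one_closed)
    moreover have c: "\<phi> (Suc n) n \<one>\<^bsub>Am n\<^esub> \<in> carrier (Am (Suc n))" by (simp add: \<phi>_closed Al.one_closed)
    ultimately show ?thesis
      using \<phi>_mult[OF nm(2) c Al.one_closed] False c by (simp add: u_def v_def stage_unit_def Al.one_right)
  qed
  have mono: "R m u i i = 0" if "R m v i i = 0" for i
  proof -
    have "R m u i i = (\<Sum>k\<in>I m. R m u i k * R m v k i)"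
      using Al.R_mult[OF uv, of i i] \<open>u \<otimes>\<^bsub>Am m\<^esub> v = u\<close> by simp
    also have "\<dots> = 0"
    proof (rule sum.neutral, rule ballI)
      fix k show "R m u i k * R m v k i = 0" using v(1)[of k i] that by (cases "k = i") auto
    qed
    finally show ?thesis .
  qed
  define h' where "h' = h \<oplus>\<^bsub>Am m\<^esub> f (Suc n) \<odot>\<^bsub>Am m\<^esub> (v \<ominus>\<^bsub>Am m\<^esub> u)"
  have h': "h' \<in> carrier (Am m)" using h uv by (simp add: h'_def)
  have Rh': "R m h' i j = R m h i j + f (Suc n) * (R m v i j - R m u i j)" for i j
    using h uv by (simp add: h'_def Al.R_add Al.R_smult Al.R_minus)
  have "gap_sum f (Suc n) = \<phi>L m h'"
    using h uv unit_eq[OF nm(1)] unit_eq[OF nm(2)]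
    by (simp add: h'_def \<phi>L_add \<phi>L_smult \<phi>L_minus gap_def u_def v_def)
  moreover have "cmod (R m h' i i) \<le> K" for i
    using u(2)[of i] v(2)[of i] mono[of i] h(4)[of i] h(5)[of i] K(2)[of "Suc n"]
    by (auto simp: Rh' u_def)
  moreover have "R m h' i i = 0" if "R m v i i = 0" for i
    using that mono[OF that] h(5)[of i] by (simp add: Rh' u_def)
  moreover have "R m h' i j = 0" if "i \<noteq> j" for i j
    using that u(1) v(1) h(3) by (simp add: Rh')
  ultimately show ?case using h' by (intro bexI[of _ h']) (auto simp: v_def)
qed

lemma nrm_gap_sum_le:
  assumes K: "0 \<le> K" "\<And>k. cmod (f k) \<le> K"
  shows "nrm L (gap_sum f n) \<le> K"
proof -
  obtain h where hc: "h \<in> carrier (Am n)" and hs: "gap_sum f n = \<phi>L n h \<and> (\<forall>i j. i \<noteq> j \<longrightarrow> R n h i j = 0) \<and>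
    (\<forall>i. cmod (R n h i i) \<le> K) \<and> (\<forall>i. R n (stage_unit n n) i i = 0 \<longrightarrow> R n h i i = 0)"
    using gap_sum_diagonal[of K f, OF K le_refl[of n]] by (elim bexE)
  then have h: "h \<in> carrier (Am n)" "gap_sum f n = \<phi>L n h" "\<And>i j. i \<noteq> j \<Longrightarrow> R n h i j = 0"
    "\<And>i. cmod (R n h i i) \<le> K"
    by simp_all
  have "nrm (Am n) h \<le> K" by (rule Al.nrm_diagonal_le) (use h K in auto)
  then show ?thesis using nrm_\<phi>L_le[OF h(1)] h(2) by simp
qed

lemma Cc_algebra_simps:
  "carrier (Cc_algebra S) = {f. finite {n. f n \<noteq> 0} \<and> {n. f n \<noteq> 0} \<subseteq> S}"
  "f \<oplus>\<^bsub>Cc_algebra S\<^esub> g = (\<lambda>n. f n + g n)"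
  "f \<otimes>\<^bsub>Cc_algebra S\<^esub> g = (\<lambda>n. f n * g n)"
  "c \<odot>\<^bsub>Cc_algebra S\<^esub> f = (\<lambda>n. c * f n)"
  "nrm (Cc_algebra S) f = (SUP n. cmod (f n))"
  by (simp_all add: Cc_algebra_def)

lemma corresponding_hom_iff:
  assumes e: "\<And>n. n > 0 \<Longrightarrow> e n = unit n"
  shows "corresponding_hom L e \<theta> \<longleftrightarrow> \<theta> \<in> alg_hom (Cc_algebra {0<..}) L \<and> (\<forall>n>0. \<theta> (indicator {n}) = gap n)"
proof -
  have "(e(0 := \<zero>\<^bsub>L\<^esub>)) n = unit n" for n using e[of n] by (simp add: unit_def)
  then show ?thesis by (simp add: corresponding_hom_def gap_def del: fun_upd_apply)
qed

lemma finite_support_bound: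
  fixes f :: "nat \<Rightarrow> complex"
  assumes "finite {n. f n \<noteq> 0}"
  shows "\<exists>N. \<forall>n>N. f n = 0"
proof -
  obtain N where "\<forall>n\<in>{n. f n \<noteq> 0}. n \<le> N" using assms by (auto simp: finite_nat_set_iff_bounded_le)
  then show ?thesis by (intro exI[of _ N]) force
qed

lemma corresponding_hom_exists:
  assumes e: "\<And>n. n > 0 \<Longrightarrow> e n = unit n"
  shows "\<exists>\<theta>. corresponding_hom L e \<theta>"
proof -
  define bd where "bd f = (SOME N. \<forall>n>N. f n = (0::complex))" for f :: "nat \<Rightarrow> complex"
  define \<theta> where "\<theta> f = gap_sum f (bd f)" for f
  have bd: "\<forall>n>bd f. f n = 0" if "\<forall>n>N. f n = 0" for f N
    unfolding bd_def by (rule someI[of "\<lambda>N. \<forall>n>N. f n = 0" N]) (rule that)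
  have \<theta>: "\<theta> f = gap_sum f N" if N: "\<forall>n>N. f n = 0" for f N
  proof -
    have "gap_sum f (max N (bd f)) = gap_sum f N" by (rule gap_sum_stable) (use N in auto)
    moreover have "gap_sum f (max N (bd f)) = gap_sum f (bd f)" by (rule gap_sum_stable) (use bd[OF N] in auto)
    ultimately show ?thesis by (simp add: \<theta>_def)
  qed
  have "\<theta> \<in> alg_hom (Cc_algebra {0<..}) L"
  proof (rule alg_homI)
    fix f assume "f \<in> carrier (Cc_algebra {0<..})"
    then obtain N where N: "\<forall>n>N. f n = 0" using finite_support_bound[of f] by (auto simp: Cc_algebra_simps)
    show "\<theta> f \<in> carrier L" by (simp add: \<theta>_def)
    show "\<theta> (c \<odot>\<^bsub>Cc_algebra {0<..}\<^esub> f) = c \<odot>\<^bsub>L\<^esub> \<theta> f" for c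
      using \<theta>[OF N] \<theta>[of N "\<lambda>n. c * f n"] N by (simp add: Cc_algebra_simps gap_sum_scale)
    fix g assume "g \<in> carrier (Cc_algebra {0<..})"
    then obtain M where M: "\<forall>n>M. g n = 0" using finite_support_bound[of g] by (auto simp: Cc_algebra_simps)
    define B where "B = max N M"
    have B: "\<forall>n>B. f n = 0" "\<forall>n>B. g n = 0" using N M by (auto simp: B_def)
    show "\<theta> (f \<oplus>\<^bsub>Cc_algebra {0<..}\<^esub> g) = \<theta> f \<oplus>\<^bsub>L\<^esub> \<theta> g"
      using \<theta>[OF B(1)] \<theta>[OF B(2)] \<theta>[of B "\<lambda>n. f n + g n"] B by (simp add: Cc_algebra_simps gap_sum_add)
    show "\<theta> (f \<otimes>\<^bsub>Cc_algebra {0<..}\<^esub> g) = \<theta> f \<otimes>\<^bsub>L\<^esub> \<theta> g"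
      using \<theta>[OF B(1)] \<theta>[OF B(2)] \<theta>[of B "\<lambda>n. f n * g n"] B by (simp add: Cc_algebra_simps gap_sum_mult)
  qed
  moreover have "\<theta> (indicator {n}) = gap n" if "0 < n" for n
    using \<theta>[of n "indicator {n}"] gap_sum_indicator[OF that, of n] by simp
  ultimately show ?thesis using corresponding_hom_iff[OF e] by blast
qed

text \<open>The indicators span the finitely supported functions, so every such homomorphism is given by
  \<open>gap_sum\<close>, whose norm has been estimated.\<close>

lemma corresponding_hom_contractive:
  assumes e: "\<And>n. n > 0 \<Longrightarrow> e n = unit n" and \<theta>: "corresponding_hom L e \<theta>"
  shows "contractive (Cc_algebra {0<..}) L \<theta>"
  unfolding contractive_def
proof
  have hom: "\<theta> \<in> alg_hom (Cc_algebra {0<..}) L" and ind: "\<And>n. 0 < n \<Longrightarrow> \<theta> (indicator {n}) = gap n"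
    using \<theta> corresponding_hom_iff[OF e] by auto
  fix f assume f: "f \<in> carrier (Cc_algebra {0<..})"
  then have f': "finite {n. f n \<noteq> 0}" "f 0 = 0" by (auto simp: Cc_algebra_simps)
  define cut where "cut N = (\<lambda>n. if n \<le> N then f n else 0)" for N
  have cut: "cut N \<in> carrier (Cc_algebra {0<..})" for N
  proof -
    have "{n. cut N n \<noteq> 0} \<subseteq> {n. f n \<noteq> 0}" by (auto simp: cut_def)
    then show ?thesis using f by (auto simp: Cc_algebra_simps intro: finite_subset)
  qed
  have indc: "indicator {n} \<in> carrier (Cc_algebra {0<..})" if "0 < n" for n
  proof -
    have "{k. (indicator {n} k :: complex) \<noteq> 0} = {n}" by (auto simp: indicator_def)
    then show ?thesis using that by (simp add: Cc_algebra_simps)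
  qed
  have "\<theta> (cut N) = gap_sum f N" for N
  proof (induction N)
    case 0
    have "cut 0 = 0 \<odot>\<^bsub>Cc_algebra {0<..}\<^esub> f" using f' by (auto simp: cut_def Cc_algebra_simps)
    then show ?case using alg_homD(4)[OF hom f, of 0] alg_homD(2)[OF hom f] by simp
  next
    case (Suc N)
    have "cut (Suc N) = cut N \<oplus>\<^bsub>Cc_algebra {0<..}\<^esub> f (Suc N) \<odot>\<^bsub>Cc_algebra {0<..}\<^esub> indicator {Suc N}"
      by (auto simp: cut_def Cc_algebra_simps indicator_def le_Suc_eq fun_eq_iff)
    moreover have "f (Suc N) \<odot>\<^bsub>Cc_algebra {0<..}\<^esub> indicator {Suc N} \<in> carrier (Cc_algebra {0<..})"
    proof -
      have "{k. f (Suc N) * indicator {Suc N} k \<noteq> 0} \<subseteq> {Suc N}" by (auto simp: indicator_def)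
      then have "finite {k. f (Suc N) * indicator {Suc N} k \<noteq> 0}" using finite_subset by blast
      then show ?thesis by (auto simp: Cc_algebra_simps indicator_def split: if_splits)
    qed
    ultimately show ?case
      using alg_homD(3)[OF hom cut] alg_homD(4)[OF hom indc[of "Suc N"]] Suc ind[of "Suc N"] by simp
  qed
  moreover obtain N where N: "\<forall>n>N. f n = 0" using finite_support_bound[OF f'(1)] by blast
  moreover have "cut N = f" using N by (auto simp: cut_def fun_eq_iff)
  ultimately have "\<theta> f = gap_sum f N" by metis
  moreover have "nrm L (gap_sum f N) \<le> (SUP n. cmod (f n))"
  proof -
    have "range (\<lambda>n. cmod (f n)) \<subseteq> insert 0 ((\<lambda>n. cmod (f n)) ` {n. f n \<noteq> 0})" by auto
    then have "finite (range (\<lambda>n. cmod (f n)))" by (rule finite_subset) (use f'(1) in simp)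
    then have bdd: "bdd_above (range (\<lambda>n. cmod (f n)))" by (rule bdd_above_finite)
    have le: "cmod (f k) \<le> (SUP n. cmod (f n))" for k by (rule cSUP_upper[OF UNIV_I bdd])
    show ?thesis by (rule nrm_gap_sum_le[OF order_trans[OF norm_ge_zero le[of 0]] le])
  qed
  ultimately show "nrm L (\<theta> f) \<le> nrm (Cc_algebra {0<..}) f" by (simp add: Cc_algebra_simps)
qed

end

theorem proposition9p10:
  fixes p :: real
    and Am :: "nat \<Rightarrow> ('a, 'm) normed_module_scheme"
    and \<phi> :: "nat \<Rightarrow> nat \<Rightarrow> 'a \<Rightarrow> 'a"
    and A :: "('b, 'n) normed_module_scheme"
    and \<phi>\<^sub>A :: "nat \<Rightarrow> 'a \<Rightarrow> 'b"
    and e :: "nat \<Rightarrow> 'b"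
  assumes "1 \<le> p" and "p \<noteq> 2"
    and "spatial_AF_system p Am \<phi>"
    and "is_direct_limit Am \<phi> A \<phi>\<^sub>A"
    and e_def: "\<And>n. n > 0 \<Longrightarrow> e n = \<phi>\<^sub>A n \<one>\<^bsub>Am n\<^esub>"
  shows "Lp_operator_algebra TYPE(real) p A \<and>
    separable_space (ntopology A) \<and>
    nondegenerately_representable TYPE(real) p A \<and>
    nondecreasing_idempotents A e \<and>
    approximate_identity A e \<and>
    (\<exists>\<theta>. corresponding_hom A e \<theta>) \<and>
    (\<forall>\<theta>. corresponding_hom A e \<theta> \<longrightarrow> contractive (Cc_algebra {0<..}) A \<theta>)"
proof -
  obtain I :: "nat \<Rightarrow> (nat \<times> nat) set" and blk R where "block_system Am p I blk R \<phi>"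
    using spatial_AF_system_block_system[OF assms(1-3)] by blast
  then have "block_limit Am p I blk R \<phi> A \<phi>\<^sub>A"
    using assms(4) by (rule block_system.direct_limit_block_limit)
  then interpret block_limit Am p I blk R \<phi> A \<phi>\<^sub>A .
  have e: "e n = unit n" if "n > 0" for n
    using e_def[OF that] that by (simp add: unit_def)
  obtain C :: "real set" and \<pi> where \<pi>: "\<pi> \<in> alg_hom A (bounded_operators (lps p C))"
    "isometric A (bounded_operators (lps p C)) \<pi>"
    and dense: "\<forall>f\<in>carrier (lps p C). \<forall>\<epsilon>>0. \<exists>a\<in>carrier A. \<exists>g\<in>carrier (lps p C).
      nrm (lps p C) (f \<ominus>\<^bsub>lps p C\<^esub> \<pi> a g) < \<epsilon>"
    using isometric_representation by (elim exE conjE)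
  show ?thesis
  proof (intro conjI allI impI)
    show "Lp_operator_algebra TYPE(real) p A"
      by (rule isometric_range_Lp_operator_algebra[OF assms(1) L.banach_algebra_axioms \<pi>])
    show "nondegenerately_representable TYPE(real) p A"
      by (rule dense_action_nondegenerately_representable[OF assms(1) \<pi>]) (use dense in simp)
    show "separable_space (ntopology A)" by (rule separable)
    show "nondecreasing_idempotents A e" by (rule nondecreasing_units) (rule e)
    show "approximate_identity A e" by (rule approximate_units) (rule e)
    show "\<exists>\<theta>. corresponding_hom A e \<theta>" by (rule corresponding_hom_exists) (rule e)
    show "contractive (Cc_algebra {0<..}) A \<theta>" if "corresponding_hom A e \<theta>" for \<theta>
      by (rule corresponding_hom_contractive[OF _ that]) (rule e)
  qed
qed

end
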